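(* Let $\mathbb{k}$ be an algebraically closed field, let $p,q\in\mathbb{k}^*$ with $pq\neq1$ be primitive $m$-th and $n$-th roots of unity, respectively, let $l=\operatorname{lcm}(m,n)$, and let $\theta=yx-p^{-1}xy\in\mathcal{H}_{p,q}$. Let $\mathcal{N}$ be a simple $z,\theta$-torsionfree right $\mathcal{H}_{p,q}$-module. Then: (1) if $\mathcal{N}$ is $x$-torsionfree, then $\mathcal{N}$ is isomorphic to $\mathcal{V}_1(\mu,\lambda,\gamma)$ for some $(\mu,\lambda,\gamma)\in(\mathbb{k}^* )^3$; (2) if $\mathcal{N}$ is $x$-torsion and $y$-torsionfree, then $\mathcal{N}$ is isomorphic to $\mathcal{V}_2(\mu,\lambda)$ for some $(\mu,\lambda)\in(\mathbb{k}^* )^2$; (3) if $\mathcal{N}$ is $x$-torsion and $y$-torsion, then $\mathcal{N}$ is isomorphic to $\mathcal{V}_3(\lambda)$ for some $\lambda\in\mathbb{k}^*$.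
   Context: For $p,q\in\mathbb{k}^*=\mathbb{k}\setminus\{0\}$, $\mathcal{H}_{p,q}$ is the $\mathbb{k}$-algebra generated by $x,y,z$ subject to the relations $zx=p^{-1}xz$, $zy=pyz$, $yx-qxy=z$. All modules are right modules. For an element $a$ of the algebra, a module $M$ is $a$-torsion if every $w\in M$ satisfies $wa^i=0$ for some $i\ge0$, and $a$-torsionfree if $wa^i=0$ with $w\in M$, $i\geq 0$ implies $w=0$; "$a,b$-torsionfree" means both $a$-torsionfree and $b$-torsionfree. Put $[k]_{p,q}:=\frac{q^k-p^{-k}}{q-p^{-1}}=\sum_{i=0}^{k-1}q^ip^{-(k-1-i)}$. The following formulas define right $\mathcal{H}_{p,q}$-modules. $\mathcal{V}_1(\mu,\lambda,\gamma)$ ($\mu,\lambda,\gamma\in\mathbb{k}^*$): basis $\{v_k\mid0\le k\le l-1\}$, $v_kz=p^k\lambda v_k$; $v_kx=\mu v_{k+1}$ for $0\le k\le l-2$, $v_{l-1}x=\mu v_0$; $v_ky=\mu^{-1}q^{-k}\frac{pq\gamma-(pq)^k\lambda}{pq-1}v_{k-1}$ for $1\le k\le l-1$, $v_0y=\mu^{-1}\frac{pq\gamma-\lambda}{pq-1}v_{l-1}$. $\mathcal{V}_2(\mu,\lambda)$ ($\mu,\lambda\in\mathbb{k}^*$): basis $\{v_k\mid0\le k\le l-1\}$, $v_kz=p^{-k}\lambda v_k$; $v_ky=\mu v_{k+1}$ for $0\le k\le l-2$, $v_{l-1}y=\mu v_0$; $v_kx=\mu^{-1}\lambda[k]_{p,q}v_{k-1}$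 for $1\le k\le l-1$, $v_0x=0$. $\mathcal{V}_3(\lambda)$ ($\lambda\in\mathbb{k}^*$): with $N=\operatorname{ord}(pq)$ the multiplicative order of $pq$, basis $\{v_k\mid0\le k\le N-1\}$, $v_kz=p^{-k}\lambda v_k$; $v_ky=v_{k+1}$ for $0\le k\le N-2$, $v_{N-1}y=0$; $v_kx=\lambda[k]_{p,q}v_{k-1}$ for $1\le k\le N-1$, $v_0x=0$. *)

theory Defs
  imports
    "HOL-Library.Poly_Mapping"
    "HOL-Algebra.QuotRing"
    "HOL-Algebra.Algebraic_Closure_Type"
begin

section \<open>The algebra on \<open>x, y, z\<close> with \<open>zx = p\<inverse>xz\<close>, \<open>zy = pyz\<close>, \<open>yx - qxy = z\<close>\<close>

datatype gen = GX | GY | GZ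

text \<open>Words form the free monoid, written additively because the convolution product of
  \<^theory>\<open>HOL-Library.Poly_Mapping\<close> is available over \<^class>\<open>monoid_add\<close>. Consequently
  finitely supported functions \<open>gword \<Rightarrow>\<^sub>0 'k\<close> are the free algebra on the three generators.\<close>

datatype gword = Word (letters: "gen list")

instantiation gword :: monoid_add
begin
definition "0 = Word []"
definition "u + v = Word (letters u @ letters v)"
instance by standard (auto simp: zero_gword_def plus_gword_def)
end

type_synonym 'k free_alg = "gword \<Rightarrow>\<^sub>0 'k"

definition fgen :: "gen \<Rightarrow> 'k::field free_alg" where
  "fgen g = Poly_Mapping.single (Word [g]) 1"

definition fconst :: "'k::field \<Rightarrow> 'k free_alg" where
  "fconst c = Poly_Mapping.single 0 c"

definition relators :: "'k::field \<Rightarrow> 'k \<Rightarrow> 'k free_alg set" where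
  "relators p q =
    {fgen GZ * fgen GX - fconst (inverse p) * (fgen GX * fgen GZ),
     fgen GZ * fgen GY - fconst p * (fgen GY * fgen GZ),
     fgen GY * fgen GX - fconst q * (fgen GX * fgen GY) - fgen GZ}"

definition rel_ideal :: "'k::field \<Rightarrow> 'k \<Rightarrow> 'k free_alg set" where
  "rel_ideal p q = Idl\<^bsub>ring_of_type_algebra\<^esub> (relators p q)"

definition hpq :: "'k::field \<Rightarrow> 'k \<Rightarrow> 'k free_alg set ring" where
  "hpq p q = ring_of_type_algebra Quot (rel_ideal p q)"

definition hclass :: "'k::field \<Rightarrow> 'k \<Rightarrow> 'k free_alg \<Rightarrow> 'k free_alg set" where
  "hclass p q f = rel_ideal p q +>\<^bsub>ring_of_type_algebra\<^esub> f"

definition hx :: "'k::field \<Rightarrow> 'k \<Rightarrow> 'k free_alg set" where "hx p q = hclass p q (fgen GX)"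
definition hy :: "'k::field \<Rightarrow> 'k \<Rightarrow> 'k free_alg set" where "hy p q = hclass p q (fgen GY)"
definition hz :: "'k::field \<Rightarrow> 'k \<Rightarrow> 'k free_alg set" where "hz p q = hclass p q (fgen GZ)"

definition hscalar :: "'k::field \<Rightarrow> 'k \<Rightarrow> 'k \<Rightarrow> 'k free_alg set" where
  "hscalar p q c = hclass p q (fconst c)"

definition htheta :: "'k::field \<Rightarrow> 'k \<Rightarrow> 'k free_alg set" where
  "htheta p q =
    (hy p q \<otimes>\<^bsub>hpq p q\<^esub> hx p q) \<ominus>\<^bsub>hpq p q\<^esub>
    (hscalar p q (inverse p) \<otimes>\<^bsub>hpq p q\<^esub> (hx p q \<otimes>\<^bsub>hpq p q\<^esub> hy p q))"


section \<open>Right modules over a ring\<close>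

text \<open>As for the library's modules, the underlying abelian group is the additive part of a ring
  record; the fields for multiplication and unit carry no meaning. For a ring that is a
  \<open>k\<close>-algebra the \<open>k\<close>-space structure of a right module is the action of the scalars, so
  module isomorphisms are automatically \<open>k\<close>-linear.\<close>

record ('a, 'b) rmodule = "'b ring" +
  ract :: "'b \<Rightarrow> 'a \<Rightarrow> 'b" (infixl \<open>\<triangleleft>\<index>\<close> 70)

locale right_module = R?: ring R + M?: abelian_group M
  for R :: "('a, 'r) ring_scheme" (structure) and M :: "('a, 'b, 'm) rmodule_scheme" (structure) +
  assumes ract_closed:
      "\<lbrakk>w \<in> carrier M; a \<in> carrier R\<rbrakk> \<Longrightarrow> w \<triangleleft>\<^bsub>M\<^esub> a \<in> carrier M"
    and ract_add_left:
      "\<lbrakk>w \<in> carrier M; w' \<in> carrier M; a \<in> carrier R\<rbrakk> \<Longrightarrow>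
        (w \<oplus>\<^bsub>M\<^esub> w') \<triangleleft>\<^bsub>M\<^esub> a = w \<triangleleft>\<^bsub>M\<^esub> a \<oplus>\<^bsub>M\<^esub> w' \<triangleleft>\<^bsub>M\<^esub> a"
    and ract_add_right:
      "\<lbrakk>w \<in> carrier M; a \<in> carrier R; b \<in> carrier R\<rbrakk> \<Longrightarrow>
        w \<triangleleft>\<^bsub>M\<^esub> (a \<oplus>\<^bsub>R\<^esub> b) = w \<triangleleft>\<^bsub>M\<^esub> a \<oplus>\<^bsub>M\<^esub> w \<triangleleft>\<^bsub>M\<^esub> b"
    and ract_mult:
      "\<lbrakk>w \<in> carrier M; a \<in> carrier R; b \<in> carrier R\<rbrakk> \<Longrightarrow>
        w \<triangleleft>\<^bsub>M\<^esub> (a \<otimes>\<^bsub>R\<^esub> b) = (w \<triangleleft>\<^bsub>M\<^esub> a) \<triangleleft>\<^bsub>M\<^esub> b"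
    and ract_one: "w \<in> carrier M \<Longrightarrow> w \<triangleleft>\<^bsub>M\<^esub> \<one>\<^bsub>R\<^esub> = w"

definition right_submodule ::
    "('a, 'r) ring_scheme \<Rightarrow> ('a, 'b, 'm) rmodule_scheme \<Rightarrow> 'b set \<Rightarrow> bool" where
  "right_submodule R M S \<longleftrightarrow>
    subgroup S (add_monoid M) \<and> (\<forall>w\<in>S. \<forall>a\<in>carrier R. w \<triangleleft>\<^bsub>M\<^esub> a \<in> S)"

definition simple_right_module ::
    "('a, 'r) ring_scheme \<Rightarrow> ('a, 'b, 'm) rmodule_scheme \<Rightarrow> bool" where
  "simple_right_module R M \<longleftrightarrow>
    right_module R M \<and> carrier M \<noteq> {\<zero>\<^bsub>M\<^esub>} \<and>
    (\<forall>S. right_submodule R M S \<longrightarrow> S = {\<zero>\<^bsub>M\<^esub>} \<or> S = carrier M)"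

definition right_module_iso ::
    "('a, 'r) ring_scheme \<Rightarrow> ('a, 'b, 'm) rmodule_scheme \<Rightarrow> ('a, 'c, 'n) rmodule_scheme \<Rightarrow> bool" where
  "right_module_iso R M N \<longleftrightarrow>
    (\<exists>h. h \<in> iso (add_monoid M) (add_monoid N) \<and>
         (\<forall>w\<in>carrier M. \<forall>a\<in>carrier R. h (w \<triangleleft>\<^bsub>M\<^esub> a) = h w \<triangleleft>\<^bsub>N\<^esub> a))"

definition torsion ::
    "('a, 'r) ring_scheme \<Rightarrow> ('a, 'b, 'm) rmodule_scheme \<Rightarrow> 'a \<Rightarrow> bool" where
  "torsion R M a \<longleftrightarrow> (\<forall>w\<in>carrier M. \<exists>i::nat. w \<triangleleft>\<^bsub>M\<^esub> (a [^]\<^bsub>R\<^esub> i) = \<zero>\<^bsub>M\<^esub>)"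

definition torsionfree ::
    "('a, 'r) ring_scheme \<Rightarrow> ('a, 'b, 'm) rmodule_scheme \<Rightarrow> 'a \<Rightarrow> bool" where
  "torsionfree R M a \<longleftrightarrow>
    (\<forall>w\<in>carrier M. \<forall>i::nat. w \<triangleleft>\<^bsub>M\<^esub> (a [^]\<^bsub>R\<^esub> i) = \<zero>\<^bsub>M\<^esub> \<longrightarrow> w = \<zero>\<^bsub>M\<^esub>)"


section \<open>Roots of unity\<close>

definition primitive_root_of_unity :: "nat \<Rightarrow> 'k::field \<Rightarrow> bool" where
  "primitive_root_of_unity n a \<longleftrightarrow> 0 < n \<and> a ^ n = 1 \<and> (\<forall>k. 0 < k \<and> k < n \<longrightarrow> a ^ k \<noteq> 1)"

definition mult_order :: "'k::field \<Rightarrow> nat" where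
  "mult_order a = (LEAST k. 0 < k \<and> a ^ k = 1)"

definition pq_number :: "'k::field \<Rightarrow> 'k \<Rightarrow> nat \<Rightarrow> 'k" where
  "pq_number p q k = (q ^ k - inverse p ^ k) / (q - inverse p)"

lemma pq_number_eq_sum:
  assumes "p \<noteq> 0" "p * q \<noteq> 1"
  shows "pq_number p q k = (\<Sum>i<k. q ^ i * inverse p ^ (k - 1 - i))"
proof -
  have "q - inverse p \<noteq> 0" using assms by (auto simp: field_simps)
  moreover have "q ^ k - inverse p ^ k = (q - inverse p) * (\<Sum>i<k. q ^ i * inverse p ^ (k - 1 - i))"
    by (subst power_diff_sumr2) (simp add: mult.commute)
  ultimately show ?thesis by (simp add: pq_number_def)
qed


section \<open>Modules given by a basis and the images of the basis vectors\<close>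

text \<open>The space with basis \<open>v\<^sub>0, \<dots>, v\<^bsub>d-1\<^esub>\<close> consists of the coordinate functions
  \<open>nat \<Rightarrow> 'k\<close> vanishing from \<open>d\<close> on; \<open>bvec c k\<close> is \<open>c v\<^sub>k\<close>. A generator acts by the
  linear extension of its values \<open>ims g k\<close> at \<open>v\<^sub>k\<close>, a word acts letter by letter from the left
  (the action is on the right), and a coset acts through any representative: this is
  well defined as soon as the relations hold, see \<open>basis_module_act\<close> below.\<close>

definition bvec :: "'k::field \<Rightarrow> nat \<Rightarrow> nat \<Rightarrow> 'k" where
  "bvec c k = (\<lambda>j. if j = k then c else 0)"

definition lin_ext :: "nat \<Rightarrow> (nat \<Rightarrow> nat \<Rightarrow> 'k::field) \<Rightarrow> (nat \<Rightarrow> 'k) \<Rightarrow> nat \<Rightarrow> 'k" where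
  "lin_ext d im v = (\<lambda>j. \<Sum>k<d. v k * im k j)"

definition word_act ::
    "nat \<Rightarrow> (gen \<Rightarrow> nat \<Rightarrow> nat \<Rightarrow> 'k::field) \<Rightarrow> gword \<Rightarrow> (nat \<Rightarrow> 'k) \<Rightarrow> nat \<Rightarrow> 'k" where
  "word_act d ims w = fold (\<lambda>g. lin_ext d (ims g)) (letters w)"

definition free_act ::
    "nat \<Rightarrow> (gen \<Rightarrow> nat \<Rightarrow> nat \<Rightarrow> 'k::field) \<Rightarrow> (nat \<Rightarrow> 'k) \<Rightarrow> 'k free_alg \<Rightarrow> nat \<Rightarrow> 'k" where
  "free_act d ims v f =
    (\<lambda>j. \<Sum>w\<in>Poly_Mapping.keys f. Poly_Mapping.lookup f w * word_act d ims w v j)"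

definition basis_module ::
    "nat \<Rightarrow> (gen \<Rightarrow> nat \<Rightarrow> nat \<Rightarrow> 'k::field) \<Rightarrow> ('k free_alg set, nat \<Rightarrow> 'k) rmodule" where
  "basis_module d ims =
    \<lparr>carrier = {v. \<forall>k\<ge>d. v k = 0}, monoid.mult = undefined, one = undefined,
     zero = (\<lambda>_. 0), add = (\<lambda>u v j. u j + v j),
     ract = (\<lambda>v A. free_act d ims v (SOME f. f \<in> A))\<rparr>"

fun V1_images :: "'k::field \<Rightarrow> 'k \<Rightarrow> nat \<Rightarrow> 'k \<Rightarrow> 'k \<Rightarrow> 'k \<Rightarrow> gen \<Rightarrow> nat \<Rightarrow> nat \<Rightarrow> 'k" where
  "V1_images p q l \<mu> lam \<gamma> GZ k = bvec (p ^ k * lam) k"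
| "V1_images p q l \<mu> lam \<gamma> GX k = (if k = l - 1 then bvec \<mu> 0 else bvec \<mu> (k + 1))"
| "V1_images p q l \<mu> lam \<gamma> GY k =
    (if k = 0 then bvec (inverse \<mu> * ((p * q * \<gamma> - lam) / (p * q - 1))) (l - 1)
     else bvec (inverse \<mu> * inverse q ^ k * ((p * q * \<gamma> - (p * q) ^ k * lam) / (p * q - 1))) (k - 1))"

definition V1 :: "'k::field \<Rightarrow> 'k \<Rightarrow> nat \<Rightarrow> 'k \<Rightarrow> 'k \<Rightarrow> 'k \<Rightarrow> ('k free_alg set, nat \<Rightarrow> 'k) rmodule" where
  "V1 p q l \<mu> lam \<gamma> = basis_module l (V1_images p q l \<mu> lam \<gamma>)"

fun V2_images :: "'k::field \<Rightarrow> 'k \<Rightarrow> nat \<Rightarrow> 'k \<Rightarrow> 'k \<Rightarrow> gen \<Rightarrow> nat \<Rightarrow> nat \<Rightarrow> 'k" where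
  "V2_images p q l \<mu> lam GZ k = bvec (inverse p ^ k * lam) k"
| "V2_images p q l \<mu> lam GY k = (if k = l - 1 then bvec \<mu> 0 else bvec \<mu> (k + 1))"
| "V2_images p q l \<mu> lam GX k =
    (if k = 0 then (\<lambda>_. 0) else bvec (inverse \<mu> * lam * pq_number p q k) (k - 1))"

definition V2 :: "'k::field \<Rightarrow> 'k \<Rightarrow> nat \<Rightarrow> 'k \<Rightarrow> 'k \<Rightarrow> ('k free_alg set, nat \<Rightarrow> 'k) rmodule" where
  "V2 p q l \<mu> lam = basis_module l (V2_images p q l \<mu> lam)"

fun V3_images :: "'k::field \<Rightarrow> 'k \<Rightarrow> 'k \<Rightarrow> gen \<Rightarrow> nat \<Rightarrow> nat \<Rightarrow> 'k" where
  "V3_images p q lam GZ k = bvec (inverse p ^ k * lam) k"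
| "V3_images p q lam GY k = (if k = mult_order (p * q) - 1 then (\<lambda>_. 0) else bvec 1 (k + 1))"
| "V3_images p q lam GX k =
    (if k = 0 then (\<lambda>_. 0) else bvec (lam * pq_number p q k) (k - 1))"

definition V3 :: "'k::field \<Rightarrow> 'k \<Rightarrow> 'k \<Rightarrow> ('k free_alg set, nat \<Rightarrow> 'k) rmodule" where
  "V3 p q lam = basis_module (mult_order (p * q)) (V3_images p q lam)"


section \<open>The relations hold, so these are right modules\<close>

text \<open>Linearity of the action of the free algebra.\<close>

lemma lin_ext_lincomb:
  "lin_ext d im (\<lambda>j. \<Sum>i\<in>I. c i * u i j) = (\<lambda>j. \<Sum>i\<in>I. c i * lin_ext d im (u i) j)"
  unfolding lin_ext_def
  by (rule ext) (simp add: sum_distrib_left sum_distrib_right mult.assoc, rule sum.swap)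

lemma word_act_lincomb:
  "word_act d ims w (\<lambda>j. \<Sum>i\<in>I. c i * u i j) = (\<lambda>j. \<Sum>i\<in>I. c i * word_act d ims w (u i) j)"
proof -
  have "fold (\<lambda>g. lin_ext d (ims g)) gs (\<lambda>j. \<Sum>i\<in>I. c i * u i j) =
      (\<lambda>j. \<Sum>i\<in>I. c i * fold (\<lambda>g. lin_ext d (ims g)) gs (u i) j)" for gs
    by (induction gs arbitrary: u) (simp_all add: lin_ext_lincomb)
  then show ?thesis by (simp add: word_act_def)
qed

lemma word_act_plus: "word_act d ims (u + w) v = word_act d ims w (word_act d ims u v)"
  by (simp add: word_act_def plus_gword_def)

lemma free_act_superset:
  assumes "finite K" "Poly_Mapping.keys f \<subseteq> K"
  shows "free_act d ims v f = (\<lambda>j. \<Sum>w\<in>K. Poly_Mapping.lookup f w * word_act d ims w v j)"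
  unfolding free_act_def using assms
  by (intro ext sum.mono_neutral_left) (auto simp: in_keys_iff)

lemma free_act_add: "free_act d ims v (f + g) = (\<lambda>j. free_act d ims v f j + free_act d ims v g j)"
proof -
  let ?K = "Poly_Mapping.keys f \<union> Poly_Mapping.keys g"
  have "free_act d ims v h = (\<lambda>j. \<Sum>w\<in>?K. Poly_Mapping.lookup h w * word_act d ims w v j)"
    if "h \<in> {f, g, f + g}" for h
    using that Poly_Mapping.keys_add[of f g] by (intro free_act_superset) auto
  then show ?thesis by (simp add: lookup_add distrib_right sum.distrib)
qed

lemma free_act_single: "free_act d ims v (Poly_Mapping.single w c) = (\<lambda>j. c * word_act d ims w v j)"
  by (subst free_act_superset[of "{w}"]) auto

lemma free_act_zero: "free_act d ims v 0 = (\<lambda>_. 0)"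
  by (simp add: free_act_def)

lemma free_act_uminus: "free_act d ims v (- f) = (\<lambda>j. - free_act d ims v f j)"
  by (simp add: free_act_def sum_negf)

lemma free_act_diff: "free_act d ims v (f - g) = (\<lambda>j. free_act d ims v f j - free_act d ims v g j)"
  using free_act_add[of d ims v f "- g"] by (simp add: free_act_uminus)

lemma free_act_one: "free_act d ims v 1 = v"
  by (simp add: free_act_single word_act_def zero_gword_def flip: single_one)

lemma free_act_sum: "finite K \<Longrightarrow> free_act d ims v (\<Sum>i\<in>K. h i) = (\<lambda>j. \<Sum>i\<in>K. free_act d ims v (h i) j)"
  by (induction K rule: finite_induct) (simp_all add: free_act_zero free_act_add)

lemma free_act_lincomb:
  "free_act d ims (\<lambda>j. \<Sum>i\<in>I. c i * u i j) f = (\<lambda>j. \<Sum>i\<in>I. c i * free_act d ims (u i) f j)"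
  unfolding free_act_def word_act_lincomb
  by (rule ext) (simp add: sum_distrib_left mult.left_commute, rule sum.swap)

lemma free_act_left_add:
  "free_act d ims (\<lambda>j. u j + v j) f = (\<lambda>j. free_act d ims u f j + free_act d ims v f j)"
  using free_act_lincomb[where I = "{False, True}" and c = "\<lambda>_. 1" and u = "\<lambda>b. if b then v else u"] by simp

lemma poly_mapping_sum_singles:
  "f = (\<Sum>w\<in>Poly_Mapping.keys f. Poly_Mapping.single w (Poly_Mapping.lookup f w))"
  by (rule poly_mapping_eqI)
     (auto simp: lookup_sum lookup_single when_def in_keys_iff sum.delta)

lemma free_act_mult: "free_act d ims v (f * g) = free_act d ims (free_act d ims v f) g"
proof -
  let ?l = "Poly_Mapping.lookup" and ?kf = "Poly_Mapping.keys f" and ?kg = "Poly_Mapping.keys g"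
  have "f * g = (\<Sum>u\<in>?kf. \<Sum>w\<in>?kg. Poly_Mapping.single (u + w) (?l f u * ?l g w))"
    by (subst poly_mapping_sum_singles[of f], subst poly_mapping_sum_singles[of g])
       (simp add: sum_product mult_single)
  then have "free_act d ims v (f * g) =
      (\<lambda>j. \<Sum>u\<in>?kf. \<Sum>w\<in>?kg. ?l f u * ?l g w * word_act d ims w (word_act d ims u v) j)"
    by (simp add: free_act_sum free_act_single word_act_plus)
  also have "\<dots> = free_act d ims (free_act d ims v f) g"
    unfolding free_act_def[of d ims v f] free_act_lincomb
    by (simp add: free_act_def sum_distrib_left mult.assoc)
  finally show ?thesis .
qed

lemma word_act_supp: "\<forall>k\<ge>d. v k = 0 \<Longrightarrow> (\<And>g k j. k < d \<Longrightarrow> d \<le> j \<Longrightarrow> ims g k j = 0) \<Longrightarrow>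
    \<forall>k\<ge>d. word_act d ims w v k = 0"
proof -
  assume v: "\<forall>k\<ge>d. v k = 0" and im: "\<And>g k j. k < d \<Longrightarrow> d \<le> j \<Longrightarrow> ims g k j = 0"
  have "\<forall>k\<ge>d. fold (\<lambda>g. lin_ext d (ims g)) gs v k = 0" for gs
    using v by (induction gs arbitrary: v) (auto simp: lin_ext_def im)
  then show ?thesis by (simp add: word_act_def)
qed

lemma free_act_supp: "\<forall>k\<ge>d. v k = 0 \<Longrightarrow> (\<And>g k j. k < d \<Longrightarrow> d \<le> j \<Longrightarrow> ims g k j = 0) \<Longrightarrow>
    \<forall>k\<ge>d. free_act d ims v f k = 0"
  using word_act_supp[of d v ims] by (simp add: free_act_def)

lemma ring_of_type_sel [simp]:
  "carrier ring_of_type_algebra = UNIV"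
  "a \<oplus>\<^bsub>ring_of_type_algebra\<^esub> b = a + b"
  "a \<otimes>\<^bsub>ring_of_type_algebra\<^esub> b = a * b"
  "\<zero>\<^bsub>ring_of_type_algebra\<^esub> = 0"
  "\<one>\<^bsub>ring_of_type_algebra\<^esub> = 1"
  by (simp_all add: ring_of_type_algebra_def)

lemma ring_of_type_ring: "ring (ring_of_type_algebra :: 'a::ring_1 ring)"
proof -
  have "\<exists>y. x + y = 0" for x :: 'a
    using add.right_inverse by blast
  then show ?thesis
    unfolding ring_of_type_algebra_def using add.right_inverse
    by unfold_locales (auto simp: algebra_simps Units_def)
qed

lemma rel_ideal_ideal: "ideal (rel_ideal p q) ring_of_type_algebra"
  unfolding rel_ideal_def by (rule ring.genideal_ideal[OF ring_of_type_ring]) simp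

lemma hclass_altdef: "hclass p q f = {i + f |i. i \<in> rel_ideal p q}"
  by (auto simp: hclass_def a_r_coset_def' )

lemma hclass_self: "f \<in> hclass p q f"
proof -
  have "0 \<in> rel_ideal p q"
    using additive_subgroup.zero_closed[OF ideal.axioms(1)[OF rel_ideal_ideal[of p q]]] by simp
  then show ?thesis by (auto simp: hclass_altdef)
qed

lemma carrier_hpq: "carrier (hpq p q) = range (hclass p q)"
  by (auto simp: hpq_def FactRing_def A_RCOSETS_def' hclass_def)

lemma hclass_ring_hom: "hclass p q \<in> ring_hom ring_of_type_algebra (hpq p q)"
  unfolding hclass_def[abs_def] hpq_def by (rule ideal.rcos_ring_hom[OF rel_ideal_ideal])

lemma hpq_ring: "ring (hpq p q)"
  unfolding hpq_def by (rule ideal.quotient_is_ring[OF rel_ideal_ideal])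

lemma hpq_add: "hclass p q f \<oplus>\<^bsub>hpq p q\<^esub> hclass p q g = hclass p q (f + g)"
  using ring_hom_add[OF hclass_ring_hom, of f g p q] by simp

lemma hpq_mult: "hclass p q f \<otimes>\<^bsub>hpq p q\<^esub> hclass p q g = hclass p q (f * g)"
  using ring_hom_mult[OF hclass_ring_hom, of f g p q] by simp

lemma hpq_one: "\<one>\<^bsub>hpq p q\<^esub> = hclass p q 1"
  using ring_hom_one[OF hclass_ring_hom, of p q] by simp

definition rep_ok :: "'k::field \<Rightarrow> 'k \<Rightarrow> nat \<Rightarrow> (gen \<Rightarrow> nat \<Rightarrow> nat \<Rightarrow> 'k) \<Rightarrow> bool" where
  "rep_ok p q d ims \<longleftrightarrow>
    (\<forall>g k j. k < d \<longrightarrow> d \<le> j \<longrightarrow> ims g k j = 0) \<and>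
    (\<forall>k<d. \<forall>r\<in>relators p q. free_act d ims (bvec 1 k) r = (\<lambda>_. 0))"

lemma bvec_expansion:
  assumes "\<forall>k\<ge>d. v k = 0"
  shows "v = (\<lambda>j. \<Sum>k<d. v k * bvec 1 k j)"
  using assms by (auto simp: bvec_def fun_eq_iff sum.delta not_less if_distrib cong: if_cong)

lemma rel_ideal_act:
  assumes ok: "rep_ok p q d ims" and v: "\<forall>k\<ge>d. v k = 0" and r: "r \<in> rel_ideal p q"
  shows "free_act d ims v r = (\<lambda>_. 0)"
proof -
  let ?F = "ring_of_type_algebra :: 'a free_alg ring"
  interpret F: ring ?F by (rule ring_of_type_ring)
  define J where "J = {f. \<forall>v. (\<forall>k\<ge>d. v k = 0) \<longrightarrow> free_act d ims v f = (\<lambda>_. 0)}"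
  have supp: "\<forall>k\<ge>d. free_act d ims v f k = 0" if "\<forall>k\<ge>d. v k = 0" for v f
    using free_act_supp that ok unfolding rep_ok_def by blast
  have zero_act: "free_act d ims (\<lambda>_. 0) f = (\<lambda>_. 0)" for f
    using free_act_lincomb[where I = "{}"] by simp
  have inv: "\<ominus>\<^bsub>?F\<^esub> f = - f" for f
    by (rule F.minus_equality) auto
  have "subgroup J (add_monoid ?F)"
  proof (rule F.add.subgroupI)
    show "J \<subseteq> carrier ?F" by simp
    show "J \<noteq> {}" using free_act_zero unfolding J_def by blast
    show "\<ominus>\<^bsub>?F\<^esub> f \<in> J" if "f \<in> J" for f
      using that unfolding inv by (simp add: J_def free_act_uminus)
    show "f \<oplus>\<^bsub>?F\<^esub> g \<in> J" if "f \<in> J" "g \<in> J" for f g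
      using that by (simp add: J_def free_act_add)
  qed
  then have "ideal J ?F"
    by (intro idealI F.ring_axioms) (auto simp: J_def free_act_mult zero_act supp)
  moreover have "relators p q \<subseteq> J"
  proof
    fix r assume r: "r \<in> relators p q"
    have "free_act d ims v r = (\<lambda>_. 0)" if "\<forall>k\<ge>d. v k = 0" for v
      using r ok by (subst bvec_expansion[OF that], subst free_act_lincomb) (simp add: rep_ok_def)
    then show "r \<in> J" by (simp add: J_def)
  qed
  ultimately have "rel_ideal p q \<subseteq> J"
    unfolding rel_ideal_def by (rule F.genideal_minimal)
  with r v show ?thesis unfolding J_def by blast
qed

lemma basis_module_act:
  assumes "rep_ok p q d ims" "\<forall>k\<ge>d. v k = 0"
  shows "v \<triangleleft>\<^bsub>basis_module d ims\<^esub> hclass p q f = free_act d ims v f"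
proof -
  have "(SOME g. g \<in> hclass p q f) \<in> hclass p q f"
    using hclass_self by (rule someI)
  then obtain i where "i \<in> rel_ideal p q" "(SOME g. g \<in> hclass p q f) = i + f"
    unfolding hclass_altdef by blast
  then show ?thesis
    using rel_ideal_act[OF assms] by (simp add: basis_module_def free_act_add)
qed

lemma basis_module_right_module:
  assumes ok: "rep_ok p q d ims"
  shows "right_module (hpq p q) (basis_module d ims)"
proof -
  have supp: "\<forall>k\<ge>d. free_act d ims v f k = 0" if "\<forall>k\<ge>d. v k = 0" for v f
    using free_act_supp that ok unfolding rep_ok_def by blast
  have M: "abelian_group (basis_module d ims)"
  proof (rule abelian_groupI)
    fix u assume u: "u \<in> carrier (basis_module d ims)"
    then show "\<exists>w\<in>carrier (basis_module d ims). w \<oplus>\<^bsub>basis_module d ims\<^esub> u = \<zero>\<^bsub>basis_module d ims\<^esub>"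
      by (intro bexI[of _ "\<lambda>j. - u j"]) (auto simp: basis_module_def)
  qed (auto simp: basis_module_def add.assoc add.commute)
  have c: "v \<in> carrier (basis_module d ims) \<longleftrightarrow> (\<forall>k\<ge>d. v k = 0)" for v
    by (simp add: basis_module_def)
  have a: "u \<oplus>\<^bsub>basis_module d ims\<^esub> v = (\<lambda>j. u j + v j)" for u v
    by (simp add: basis_module_def)
  note act = basis_module_act[OF ok]
  show ?thesis
    by (intro right_module.intro right_module_axioms.intro hpq_ring M)
       (auto simp: carrier_hpq c a act supp hpq_add hpq_mult hpq_one free_act_left_add
          free_act_add free_act_mult free_act_one)
qed

lemma lin_ext_bvec: "lin_ext d im (bvec c k) = (if k < d then (\<lambda>j. c * im k j) else (\<lambda>_. 0))"
proof (rule ext)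
  fix j
  have "(\<Sum>i<d. bvec c k i * im i j) = (\<Sum>i<d. if i = k then c * im k j else 0)"
    by (intro sum.cong) (auto simp: bvec_def)
  then show "lin_ext d im (bvec c k) j = (if k < d then (\<lambda>j. c * im k j) else (\<lambda>_. 0)) j"
    by (simp add: lin_ext_def sum.delta)
qed

lemma lin_ext_zero: "lin_ext d im (\<lambda>_. 0) = (\<lambda>_. 0)"
  by (simp add: lin_ext_def)

lemma bvec_scale: "(\<lambda>j. a * bvec c k j) = bvec (a * c) k"
  "(\<lambda>j. a * (b * bvec c k j)) = bvec (a * (b * c)) k"
  "(\<lambda>j. a * (b * bvec c k j) / d) = bvec (a * (b * c) / d) k"
  by (auto simp: bvec_def)

lemma free_act_gen: "free_act d ims v (fgen g) = lin_ext d (ims g) v"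
  by (simp add: fgen_def free_act_single word_act_def)

lemma free_act_const: "free_act d ims v (fconst c) = (\<lambda>j. c * v j)"
  by (simp add: fconst_def free_act_single word_act_def zero_gword_def)

lemma rep_okI:
  assumes "\<And>g k j. k < d \<Longrightarrow> d \<le> j \<Longrightarrow> ims g k j = 0"
    and "\<And>k. k < d \<Longrightarrow> lin_ext d (ims GX) (ims GZ k) = (\<lambda>j. inverse p * lin_ext d (ims GZ) (ims GX k) j)"
    and "\<And>k. k < d \<Longrightarrow> lin_ext d (ims GY) (ims GZ k) = (\<lambda>j. p * lin_ext d (ims GZ) (ims GY k) j)"
    and "\<And>k. k < d \<Longrightarrow> lin_ext d (ims GX) (ims GY k) =
           (\<lambda>j. q * lin_ext d (ims GY) (ims GX k) j + ims GZ k j)"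
  shows "rep_ok p q d ims"
proof -
  have lc: "lin_ext d im (\<lambda>j. c * u j) = (\<lambda>j. c * lin_ext d im u j)"
    for im :: "nat \<Rightarrow> nat \<Rightarrow> 'a" and c u
    using lin_ext_lincomb[where I = "{()}" and c = "\<lambda>_. c" and u = "\<lambda>_. u"] by simp
  show ?thesis
    unfolding rep_ok_def relators_def using assms
    by (auto simp: free_act_diff free_act_mult free_act_gen free_act_const lin_ext_bvec lc)
qed

lemma mult_order_props:
  assumes "0 < k" "a ^ k = 1"
  shows "0 < mult_order a" "a ^ mult_order a = 1"
  using LeastI[of "\<lambda>k. 0 < k \<and> a ^ k = 1" k] assms by (auto simp: mult_order_def)

lemma pq_number_0 [simp]: "pq_number p q 0 = 0"
  by (simp add: pq_number_def)

lemma pq_number_eq_0: "p \<noteq> 0 \<Longrightarrow> (p * q) ^ d = 1 \<Longrightarrow> pq_number p q d = 0"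
  by (simp add: pq_number_def power_mult_distrib field_simps)

lemma pq_number_Suc:
  assumes "p \<noteq> 0" "p * q \<noteq> 1"
  shows "pq_number p q (Suc k) = q * pq_number p q k + inverse p ^ k"
proof -
  have "q - inverse p \<noteq> 0" using assms by (auto simp: field_simps)
  then have "pq_number p q (Suc k) * (q - inverse p) =
      (q * pq_number p q k + inverse p ^ k) * (q - inverse p)"
    by (simp add: pq_number_def distrib_right) (simp add: algebra_simps)
  with \<open>q - inverse p \<noteq> 0\<close> show ?thesis by simp
qed

lemma bvec_zero: "bvec 0 k = (\<lambda>_. 0)"
  by (auto simp: bvec_def)

lemma bvec_add:
  "(\<lambda>j. bvec a k j + bvec b k j) = bvec (a + b) k"
  "(\<lambda>j. c * bvec a k j + bvec b k j) = bvec (c * a + b) k"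
  "(\<lambda>j. c * (d * bvec a k j) + bvec b k j) = bvec (c * (d * a) + b) k"
  by (auto simp: bvec_def)

lemma bvec_eqI:
  "a = b \<Longrightarrow> bvec a k = bvec b k"
  "a = 0 \<Longrightarrow> (\<lambda>_. 0) = bvec a k"
  by (simp_all add: bvec_zero)

lemma V1_right_module:
  assumes "p \<noteq> 0" "q \<noteq> 0" "p * q \<noteq> 1" "p ^ l = 1" "q ^ l = 1" "0 < l" "\<mu> \<noteq> 0"
  shows "right_module (hpq p q) (V1 p q l \<mu> lam \<gamma>)"
  unfolding V1_def
proof (intro basis_module_right_module rep_okI)
  fix g k j assume "k < l" "l \<le> j"
  then show "V1_images p q l \<mu> lam \<gamma> g k j = 0"
    by (cases g) (auto simp: bvec_def)
next
  fix k assume k: "k < l"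
  let ?I = "V1_images p q l \<mu> lam \<gamma>"
  have pl: "p * p ^ (l - Suc 0) = 1" "q * q ^ (l - Suc 0) = 1"
    using assms by (simp_all flip: power_Suc)
  then have pl': "p ^ (l - Suc 0) = inverse p" "q ^ (l - Suc 0) = inverse q"
    by (metis inverse_unique)+
  have ne: "p * q - 1 \<noteq> 0" using assms by simp
  have l: "l \<noteq> Suc 0" using assms by auto
  show "lin_ext l (?I GX) (?I GZ k) = (\<lambda>j. inverse p * lin_ext l (?I GZ) (?I GX k) j)"
    using k assms pl' by (auto simp: lin_ext_bvec bvec_scale intro!: bvec_eqI)
  show "lin_ext l (?I GY) (?I GZ k) = (\<lambda>j. p * lin_ext l (?I GZ) (?I GY k) j)"
    using k assms pl'
    by (cases k) (auto simp: lin_ext_bvec bvec_scale intro!: bvec_eqI)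
  define c where "c k = inverse q ^ k * ((p * q * \<gamma> - (p * q) ^ k * lam) / (p * q - 1))" for k
  have GY: "?I GY k = bvec (inverse \<mu> * c k) (if k = 0 then l - 1 else k - 1)" for k
    by (simp add: c_def mult.assoc)
  have cl: "c l = c 0"
    using assms by (simp add: c_def power_mult_distrib power_inverse)
  have c_Suc: "c k = q * c (Suc k) + p ^ k * lam"
  proof -
    define a where "a = (p * q) ^ k * lam"
    have a: "inverse q ^ k * a = p ^ k * lam"
      using assms by (simp add: a_def power_mult_distrib power_inverse)
    have "(p * q * \<gamma> - a) / (p * q - 1) = (p * q * \<gamma> - p * q * a) / (p * q - 1) + a"
    proof -
      have "p * q * \<gamma> - a = (p * q * \<gamma> - p * q * a) + a * (p * q - 1)"
        by (simp add: algebra_simps)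
      then show ?thesis
        using nonzero_mult_div_cancel_right[OF ne, of a] by (simp only: add_divide_distrib)
    qed
    then have "c k = inverse q ^ k * ((p * q * \<gamma> - p * q * a) / (p * q - 1)) + inverse q ^ k * a"
      unfolding c_def a_def by (simp only: distrib_left)
    also have "inverse q ^ k * ((p * q * \<gamma> - p * q * a) / (p * q - 1)) = q * c (Suc k)"
      using assms by (simp add: c_def a_def mult.assoc)
    finally show ?thesis using a by simp
  qed
  have "lin_ext l (?I GX) (?I GY k) = bvec (c k) k"
    unfolding GY using k l assms by (auto simp: lin_ext_bvec bvec_scale intro!: bvec_eqI)
  moreover have "lin_ext l (?I GY) (?I GX k) = bvec (c (Suc k)) k"
  proof (cases "k = l - 1")
    case True
    then have "l = Suc k" using k by simp
    then show ?thesis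
      using cl assms GY[of 0] by (simp add: lin_ext_bvec bvec_scale flip: mult.assoc
        del: V1_images.simps(3))
  next
    case False
    then have "Suc k < l" using k by simp
    with False show ?thesis
      using assms by (simp add: lin_ext_bvec GY bvec_scale flip: mult.assoc
        del: V1_images.simps(3))
  qed
  ultimately show "lin_ext l (?I GX) (?I GY k) =
      (\<lambda>j. q * lin_ext l (?I GY) (?I GX k) j + ?I GZ k j)"
    using c_Suc by (simp add: bvec_add)
qed

lemma V2_right_module:
  assumes "p \<noteq> 0" "q \<noteq> 0" "p * q \<noteq> 1" "p ^ l = 1" "q ^ l = 1" "0 < l" "\<mu> \<noteq> 0"
  shows "right_module (hpq p q) (V2 p q l \<mu> lam)"
  unfolding V2_def
proof (intro basis_module_right_module rep_okI)
  fix g k j assume "k < l" "l \<le> j"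
  then show "V2_images p q l \<mu> lam g k j = 0"
    by (cases g) (auto simp: bvec_def)
next
  fix k assume k: "k < l"
  let ?I = "V2_images p q l \<mu> lam"
  have pl: "p * p ^ (l - Suc 0) = 1"
    using assms by (simp_all flip: power_Suc)
  then have pl': "p ^ (l - Suc 0) = inverse p"
    by (metis inverse_unique)
  have l: "l \<noteq> Suc 0" using assms by auto
  have z: "pq_number p q l = 0"
    using assms by (intro pq_number_eq_0) (simp_all add: power_mult_distrib)
  note S = pq_number_Suc[OF assms(1,3)]
  show "lin_ext l (?I GX) (?I GZ k) = (\<lambda>j. inverse p * lin_ext l (?I GZ) (?I GX k) j)"
    using k assms
    by (cases k) (auto simp: lin_ext_bvec lin_ext_zero bvec_zero bvec_scale intro!: bvec_eqI)
  show "lin_ext l (?I GY) (?I GZ k) = (\<lambda>j. p * lin_ext l (?I GZ) (?I GY k) j)"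
    using k assms pl' by (auto simp: lin_ext_bvec bvec_scale power_inverse intro!: bvec_eqI)
  show "lin_ext l (?I GX) (?I GY k) = (\<lambda>j. q * lin_ext l (?I GY) (?I GX k) j + ?I GZ k j)"
  proof (cases "k = l - 1")
    case True
    with k have lk: "l = Suc k" by simp
    have "inverse p ^ k = - (q * pq_number p q k)"
      using z S[of k] lk by (simp add: eq_neg_iff_add_eq_0 add.commute)
    with lk l assms(7) show ?thesis
      by (cases k) (auto simp: lin_ext_bvec lin_ext_zero bvec_zero bvec_scale bvec_add intro!: bvec_eqI)
  next
    case False
    with k have k': "Suc k < l" by simp
    with assms(7) show ?thesis
      by (cases k; auto simp: lin_ext_bvec lin_ext_zero bvec_zero bvec_scale bvec_add S intro!: bvec_eqI;
          simp add: algebra_simps)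
  qed
qed

lemma V3_right_module:
  assumes "p \<noteq> 0" "q \<noteq> 0" "p * q \<noteq> 1" "(p * q) ^ k0 = 1" "0 < k0"
  shows "right_module (hpq p q) (V3 p q lam)"
  unfolding V3_def
proof (intro basis_module_right_module rep_okI)
  fix g k j assume "k < mult_order (p * q)" "mult_order (p * q) \<le> j"
  then show "V3_images p q lam g k j = 0"
    by (cases g) (auto simp: bvec_def)
next
  fix k assume k: "k < mult_order (p * q)"
  let ?I = "V3_images p q lam" and ?N = "mult_order (p * q)"
  have N: "0 < ?N" "(p * q) ^ ?N = 1"
    using mult_order_props assms by blast+
  have l: "?N \<noteq> Suc 0" using N assms by (metis power_one_right One_nat_def)
  have z: "pq_number p q ?N = 0"
    using assms N by (intro pq_number_eq_0) simp_all
  note S = pq_number_Suc[OF assms(1,3)]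
  show "lin_ext ?N (?I GX) (?I GZ k) = (\<lambda>j. inverse p * lin_ext ?N (?I GZ) (?I GX k) j)"
    using k assms
    by (cases k) (auto simp: lin_ext_bvec lin_ext_zero bvec_zero bvec_scale intro!: bvec_eqI)
  show "lin_ext ?N (?I GY) (?I GZ k) = (\<lambda>j. p * lin_ext ?N (?I GZ) (?I GY k) j)"
    using k assms
    by (auto simp: lin_ext_bvec lin_ext_zero bvec_zero bvec_scale power_inverse intro!: bvec_eqI)
  show "lin_ext ?N (?I GX) (?I GY k) = (\<lambda>j. q * lin_ext ?N (?I GY) (?I GX k) j + ?I GZ k j)"
  proof (cases "k = ?N - 1")
    case True
    with k have lk: "?N = Suc k" by simp
    have "inverse p ^ k = - (q * pq_number p q k)"
      using z S[of k] lk by (simp add: eq_neg_iff_add_eq_0 add.commute)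
    with lk l show ?thesis
      by (cases k) (auto simp: lin_ext_bvec lin_ext_zero bvec_zero bvec_scale bvec_add intro!: bvec_eqI)
  next
    case False
    with k have k': "Suc k < ?N" by simp
    then show ?thesis
      by (cases k; auto simp: lin_ext_bvec lin_ext_zero bvec_zero bvec_scale bvec_add S intro!: bvec_eqI;
          simp add: algebra_simps)
  qed
qed

end

(* Via f \<mapsto> w0 f for a nonzero w0, the simple module is a quotient of the free algebra by a right
   ideal; a linear projection along this ideal identifies it with a subspace S of the free algebra,
   on which x, y, z act by operators RX, RY, RZ.

   S is finite-dimensional: x^l, y^l, z^l are central, so S is finitely generated over k[x^l, y^l, z^l],
   and every element of this commutative algebra acts on S by zero or surjectively.  If S is finitely
   generated over k[u_0, ..., u_r] and u_0 acts nontrivially, Nakayama's lemma gives 1 + u_0 h = 0 on S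
   for some polynomial h.  This is a nontrivial relation between the u_i, so by Nagata's substitution
   u_0 is integral over r other elements that generate the algebra together with it.  By induction on
   the number of variables S is finitely generated over k.

   Hence commuting operators on S have common eigenvectors, and central ones are scalars.  If x is
   injective, start with a common eigenvector of z and theta and apply powers of x; otherwise start
   with an eigenvector of z killed by x and apply powers of y.  The vectors obtained are independent,
   as they belong to distinct joint eigenvalues of z and theta, and they span S by simplicity. *)

theory Submission
  imports Defs
begin

section \<open>Nakayama's lemma and Nagata's substitution\<close>

text \<open>Finite dimension is the main obstacle: k may be countable, so a dimension count as in
  Dixmier's form of Schur's lemma does not supply eigenvalues. Zariski's lemma is therefore proved
  for modules. Its relations hold only as operators on S, so integrality is always meant modulo the
  annihilator of S. The element theta acts as (q - 1/p) xy + z. Applying x multiplies the eigenvalue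
  of z by p and that of theta by 1/q; applying y multiplies them by 1/p and q. For k < l the pairs
  (p^k, q^-k) are distinct, which explains dimension l. In V1, lam and gamma are the eigenvalues of
  z and theta at v_0, \<open>\<mu>\<close> is an l-th root of the scalar x^l, and the formula for y
  results from solving theta = (q - 1/p) xy + z for xy. In V3 the dimension is ord(pq), since [k]
  vanishes exactly when (pq)^k = 1. The model inside the free algebra serves to have a type with a
  group structure, on which linear algebra can be done; the carrier of the module is only a set with
  operations in a record.\<close>

definition subring_set :: "'a::comm_ring_1 set \<Rightarrow> bool" where
  "subring_set B \<longleftrightarrow> 1 \<in> B \<and> (\<forall>a\<in>B. \<forall>b\<in>B. a - b \<in> B \<and> a * b \<in> B)"

lemma subring_set_closed:
  assumes "subring_set B"
  shows "1 \<in> B" "0 \<in> B"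
    "a \<in> B \<Longrightarrow> b \<in> B \<Longrightarrow> a - b \<in> B" "a \<in> B \<Longrightarrow> b \<in> B \<Longrightarrow> a * b \<in> B"
    "a \<in> B \<Longrightarrow> - a \<in> B" "a \<in> B \<Longrightarrow> b \<in> B \<Longrightarrow> a + b \<in> B"
proof -
  show 1: "1 \<in> B" and d: "\<And>a b. a \<in> B \<Longrightarrow> b \<in> B \<Longrightarrow> a - b \<in> B"
    and "a \<in> B \<Longrightarrow> b \<in> B \<Longrightarrow> a * b \<in> B"
    using assms by (auto simp: subring_set_def)
  show 0: "0 \<in> B" using d[OF 1 1] by simp
  show n: "\<And>a. a \<in> B \<Longrightarrow> - a \<in> B" using d[OF 0] by simp
  show "a \<in> B \<Longrightarrow> b \<in> B \<Longrightarrow> a + b \<in> B" using d[OF _ n, of a b] by simp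
qed

locale ring_action = Modules.module scale
  for scale :: "'a::comm_ring_1 \<Rightarrow> 'b::ab_group_add \<Rightarrow> 'b" (infixr \<open>*s\<close> 75)
begin

text \<open>Coefficients are restricted to a subset of the acting ring because the induction on the
  number of variables passes to other subalgebras of one fixed ring.\<close>

inductive_set bspan :: "'a set \<Rightarrow> 'b set \<Rightarrow> 'b set" for B G where
  zero: "0 \<in> bspan B G"
| step: "b \<in> B \<Longrightarrow> g \<in> G \<Longrightarrow> u \<in> bspan B G \<Longrightarrow> b *s g + u \<in> bspan B G"

lemma bspan_base: "b \<in> B \<Longrightarrow> g \<in> G \<Longrightarrow> b *s g \<in> bspan B G"
  using bspan.step[OF _ _ bspan.zero] by simp

lemma bspan_add: "u \<in> bspan B G \<Longrightarrow> w \<in> bspan B G \<Longrightarrow> u + w \<in> bspan B G"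
  by (induction rule: bspan.induct) (auto simp: add.assoc intro: bspan.step)

lemma bspan_mult:
  assumes "subring_set B" "a \<in> B" "u \<in> bspan B G"
  shows "a *s u \<in> bspan B G"
  using assms(3)
  by induction (auto simp: scale_right_distrib intro: bspan.intros subring_set_closed(4) assms)

lemma bspan_mono: "G \<subseteq> H \<Longrightarrow> bspan B G \<subseteq> bspan B H"
proof
  fix u assume "G \<subseteq> H" "u \<in> bspan B G"
  show "u \<in> bspan B H" using \<open>u \<in> bspan B G\<close>
    by induction (use \<open>G \<subseteq> H\<close> in \<open>auto intro: bspan.intros\<close>)
qed

lemma bspan_insert:
  assumes B: "subring_set B" and "u \<in> bspan B (insert m G)"
  obtains b u' where "b \<in> B" "u' \<in> bspan B G" "u = b *s m + u'"
proof -
  note c = subring_set_closed[OF B]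
  from assms(2) have "\<exists>b\<in>B. \<exists>u'\<in>bspan B G. u = b *s m + u'"
  proof induction
    case zero
    show ?case using c(2) bspan.zero by (intro bexI[of _ 0]) auto
  next
    case (step b g u)
    then obtain b' u' where u: "b' \<in> B" "u' \<in> bspan B G" "u = b' *s m + u'" by blast
    show ?case
    proof (cases "g = m")
      case True
      then show ?thesis using u step(1) c(6)
        by (intro bexI[of _ "b + b'"] bexI[of _ u']) (auto simp: algebra_simps)
    next
      case False
      then show ?thesis using u step(1,2)
        by (intro bexI[of _ b'] bexI[of _ "b *s g + u'"] bspan.step) (auto simp: add.left_commute)
    qed
  qed
  with that show ?thesis by blast
qed

text \<open>Generators are discarded one at a time; the invariant is that some multiplier 1 + g a
  maps S into the span of the remaining ones. To discard m, write m = g m' with m' in S. Expanding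
  (1 + g a) m' = b m + u and multiplying by g gives (1 + g (a - b)) m = g u, so one more factor
  removes m. With no generators left, the multiplier kills S.\<close>

lemma nakayama:
  assumes B: "subring_set B" and g: "g \<in> B" and G: "finite G" "G \<subseteq> S" "S \<subseteq> bspan B G"
    and S: "\<And>b s. b \<in> B \<Longrightarrow> s \<in> S \<Longrightarrow> b *s s \<in> S" and surj: "S \<subseteq> (*s) g ` S"
  shows "\<exists>a\<in>B. \<forall>s\<in>S. (1 + g * a) *s s = 0"
proof -
  note c = subring_set_closed[OF B]
  have "\<exists>a\<in>B. \<forall>s\<in>S. (1 + g * a) *s s \<in> bspan B G"
    using G(3) c(2) by (intro bexI[of _ 0]) auto
  with G(1,2) have "\<exists>a\<in>B. \<forall>s\<in>S. (1 + g * a) *s s \<in> bspan B {}"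
  proof (induction G rule: finite_induct)
    case (insert m G)
    then obtain a where a: "a \<in> B" "\<And>s. s \<in> S \<Longrightarrow> (1 + g * a) *s s \<in> bspan B (insert m G)"
      by blast
    from insert.prems surj obtain m' where m': "m' \<in> S" "m = g *s m'" by auto
    obtain b u where b: "b \<in> B" "u \<in> bspan B G" "(1 + g * a) *s m' = b *s m + u"
      by (rule bspan_insert[OF B a(2)[OF m'(1)]])
    have "(1 + g * a) *s m = g *s ((1 + g * a) *s m')"
      by (simp add: m' mult.commute)
    also have "\<dots> = (g * b) *s m + g *s u"
      by (simp only: b scale_right_distrib scale_scale)
    finally have m: "(1 + g * (a - b)) *s m = g *s u"
      by (simp add: algebra_simps)
    \<comment> \<open>The product of the two multipliers is again 1 modulo g; this identity displays
      the new witness.\<close>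
    have r: "1 + g * (a + (a - b) * (1 + g * a)) = (1 + g * (a - b)) * (1 + g * a)"
      by (simp add: algebra_simps)
    show ?case
    proof (rule insert.IH)
      show "\<exists>a\<in>B. \<forall>s\<in>S. (1 + g * a) *s s \<in> bspan B G"
      proof (intro bexI[of _ "a + (a - b) * (1 + g * a)"] ballI)
        show "a + (a - b) * (1 + g * a) \<in> B" by (intro c g a b)
      next
        fix s assume s: "s \<in> S"
        obtain b' u' where b': "b' \<in> B" "u' \<in> bspan B G" "(1 + g * a) *s s = b' *s m + u'"
          by (rule bspan_insert[OF B a(2)[OF s]])
        have "(1 + g * (a + (a - b) * (1 + g * a))) *s s = (1 + g * (a - b)) *s ((1 + g * a) *s s)"
          unfolding r by simp
        also have "\<dots> = b' *s ((1 + g * (a - b)) *s m) + (1 + g * (a - b)) *s u'"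
          unfolding b' by (simp only: scale_right_distrib scale_scale mult.commute)
        also have "\<dots> \<in> bspan B G"
          unfolding m by (intro bspan_add bspan_mult[OF B] c b b' g a)
        finally show "(1 + g * (a + (a - b) * (1 + g * a))) *s s \<in> bspan B G" .
      qed
    qed (use insert.prems in auto)
  qed auto
  moreover have "bspan B {} = {0}"
    by (auto elim: bspan.cases intro: bspan.zero)
  ultimately show ?thesis by auto
qed

end

section \<open>Elements of bounded degree in t over a subring\<close>

interpretation regular: ring_action "(*) :: 'a::comm_ring_1 \<Rightarrow> 'a \<Rightarrow> 'a"
  by standard (simp_all add: algebra_simps)

declare regular.scale_scale [simp del] \<comment> \<open>loops with \<open>mult.assoc\<close>\<close>

text \<open>Values at t of polynomials of degree below n over C. Since t may be algebraic over C,
  this is a filtration by existence of a representation; the degree of an element is not well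
  defined.\<close>

definition low_degree :: "'a::comm_ring_1 set \<Rightarrow> 'a \<Rightarrow> nat \<Rightarrow> 'a set" where
  "low_degree C t n = regular.bspan C ((\<lambda>i. t ^ i) ` {..<n})"

lemma low_degree_power: "subring_set C \<Longrightarrow> i < n \<Longrightarrow> t ^ i \<in> low_degree C t n"
  unfolding low_degree_def
  using regular.bspan_base[OF subring_set_closed(1), of C "t ^ i" "(\<lambda>i. t ^ i) ` {..<n}"] by simp

lemma low_degree_const: "c \<in> C \<Longrightarrow> 0 < n \<Longrightarrow> c \<in> low_degree C t n"
  unfolding low_degree_def
  using regular.bspan_base[of c C "t ^ 0" "(\<lambda>i. t ^ i) ` {..<n}"] imageI[of 0 "{..<n}" "\<lambda>i. t ^ i"]
  by simp

lemma low_degree_mono: "m \<le> n \<Longrightarrow> low_degree C t m \<subseteq> low_degree C t n"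
  unfolding low_degree_def by (intro regular.bspan_mono) auto

lemma low_degree_add: "x \<in> low_degree C t n \<Longrightarrow> y \<in> low_degree C t n \<Longrightarrow> x + y \<in> low_degree C t n"
  unfolding low_degree_def by (rule regular.bspan_add)

lemma low_degree_zero: "0 \<in> low_degree C t n"
  unfolding low_degree_def by (rule regular.bspan.zero)

lemma low_degree_sum: "(\<And>i. i \<in> I \<Longrightarrow> f i \<in> low_degree C t n) \<Longrightarrow> sum f I \<in> low_degree C t n"
  by (induction I rule: infinite_finite_induct) (auto intro: low_degree_add low_degree_zero)

lemma low_degree_scale:
  "subring_set C \<Longrightarrow> c \<in> C \<Longrightarrow> x \<in> low_degree C t n \<Longrightarrow> c * x \<in> low_degree C t n"
  unfolding low_degree_def by (rule regular.bspan_mult)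

lemma low_degree_power_mult:
  assumes "x \<in> low_degree C t n"
  shows "t ^ m * x \<in> low_degree C t (m + n)"
  using assms unfolding low_degree_def
proof induction
  case (step c g u)
  then obtain i where i: "i < n" "g = t ^ i" by blast
  have "m + i \<in> {..<m + n}" using i by simp
  then have "c * t ^ (m + i) + t ^ m * u \<in> regular.bspan C ((\<lambda>i. t ^ i) ` {..<m + n})"
    by (intro regular.bspan.step step imageI)
  moreover have "t ^ m * (c * g + u) = c * t ^ (m + i) + t ^ m * u"
    by (simp add: i power_add distrib_left mult.left_commute)
  ultimately show ?case by simp
qed (auto intro: regular.bspan.zero)

lemma low_degree_mult:
  assumes C: "subring_set C" and y: "y \<in> low_degree C t n" and "x \<in> low_degree C t m"
  shows "x * y \<in> low_degree C t (m + n)"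
  using assms(3) unfolding low_degree_def[of C t m]
proof induction
  case (step c g u)
  then obtain i where i: "i < m" "g = t ^ i" by blast
  have "c * (t ^ i * y) \<in> low_degree C t (i + n)"
    by (intro low_degree_scale C step low_degree_power_mult y)
  moreover have "i + n \<le> m + n" using i by simp
  ultimately have "c * (t ^ i * y) \<in> low_degree C t (m + n)"
    using low_degree_mono by blast
  from low_degree_add[OF this step(4)] show ?case
    by (simp only: i distrib_right mult.assoc)
qed (simp add: low_degree_zero)

text \<open>Once such an x is known to act as zero, this is an equation of integral dependence for t
  of degree n.\<close>

definition monic_in :: "'a::comm_ring_1 set \<Rightarrow> 'a \<Rightarrow> nat \<Rightarrow> 'a \<Rightarrow> bool" where
  "monic_in C t n x \<longleftrightarrow> x - t ^ n \<in> low_degree C t n"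

lemma monic_in_mult:
  assumes C: "subring_set C" and x: "monic_in C t m x" and y: "monic_in C t n y"
  shows "monic_in C t (m + n) (x * y)"
proof -
  have "(x - t ^ m) * (y - t ^ n) \<in> low_degree C t (m + n)"
    using x y by (intro low_degree_mult C) (simp_all add: monic_in_def)
  moreover have "t ^ m * (y - t ^ n) \<in> low_degree C t (m + n)"
    using y by (intro low_degree_power_mult) (simp add: monic_in_def)
  moreover have "t ^ n * (x - t ^ m) \<in> low_degree C t (m + n)"
    using x low_degree_power_mult[of "x - t ^ m" C t m n]
    by (simp add: monic_in_def add.commute)
  moreover have "x * y - t ^ (m + n) =
      (x - t ^ m) * (y - t ^ n) + t ^ m * (y - t ^ n) + t ^ n * (x - t ^ m)"
    by (simp add: algebra_simps power_add)
  ultimately show ?thesis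
    unfolding monic_in_def by (simp only: low_degree_add)
qed

lemma monic_in_one: "monic_in C t 0 1"
  by (simp add: monic_in_def low_degree_zero)

lemma monic_in_power:
  assumes "subring_set C" "monic_in C t m x"
  shows "monic_in C t (m * k) (x ^ k)"
proof (induction k)
  case (Suc k)
  then show ?case using monic_in_mult[OF assms(1,2) Suc] by simp
qed (simp add: monic_in_one)

lemma monic_in_prod:
  assumes "subring_set C" "finite I" "\<And>i. i \<in> I \<Longrightarrow> monic_in C t (w i) (x i)"
  shows "monic_in C t (sum w I) (prod x I)"
  using assms(2,3)
  by (induction I rule: finite_induct)
     (simp_all add: monic_in_mult assms(1) monic_in_one)

text \<open>Uniqueness of base b digits: reduction modulo b gives the lowest digit, and division by
  b leaves the same problem for the others.\<close>

lemma digit_sum_inj: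
  fixes \<alpha> \<beta> :: "nat \<Rightarrow> nat"
  assumes "\<And>i. i < r \<Longrightarrow> \<alpha> i < b" "\<And>i. i < r \<Longrightarrow> \<beta> i < b"
    and "(\<Sum>i<r. b ^ i * \<alpha> i) = (\<Sum>i<r. b ^ i * \<beta> i)" "i < r"
  shows "\<alpha> i = \<beta> i"
  using assms
proof (induction r arbitrary: \<alpha> \<beta> i)
  case (Suc r)
  have s: "(\<Sum>i<Suc r. b ^ i * \<gamma> i) = \<gamma> 0 + b * (\<Sum>i<r. b ^ i * \<gamma> (Suc i))" for \<gamma> :: "nat \<Rightarrow> nat"
    by (subst sum.lessThan_Suc_shift) (simp add: sum_distrib_left mult.assoc)
  have a0: "\<alpha> 0 < b" "\<beta> 0 < b" using Suc.prems by auto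
  have eq: "\<alpha> 0 + b * (\<Sum>i<r. b ^ i * \<alpha> (Suc i)) = \<beta> 0 + b * (\<Sum>i<r. b ^ i * \<beta> (Suc i))"
    using Suc.prems(3) unfolding s .
  have e0: "\<alpha> 0 = \<beta> 0"
    using arg_cong[OF eq, of "\<lambda>n. n mod b"] a0 by simp
  with eq a0 have "(\<Sum>i<r. b ^ i * \<alpha> (Suc i)) = (\<Sum>i<r. b ^ i * \<beta> (Suc i))" by simp
  from Suc.IH[OF _ _ this] Suc.prems have "\<alpha> (Suc i) = \<beta> (Suc i)" if "i < r" for i
    using that by auto
  with e0 Suc.prems(4) show ?case by (cases i) auto
qed simp

section \<open>Finitely generated subalgebras, monomials and Nagata's substitution\<close>

locale scalar_map =
  fixes \<iota> :: "'k::field \<Rightarrow> 'a::comm_ring_1"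
  assumes \<iota>_add: "\<iota> (c + d) = \<iota> c + \<iota> d" and \<iota>_mult: "\<iota> (c * d) = \<iota> c * \<iota> d"
    and \<iota>_one: "\<iota> 1 = 1"
begin

sublocale sv: Vector_Spaces.vector_space "\<lambda>c a. \<iota> c * a"
  by (intro Vector_Spaces.vector_space.intro)
     (simp_all add: \<iota>_add \<iota>_mult \<iota>_one distrib_left distrib_right mult.assoc)

declare sv.scale_scale [simp del]

inductive_set alg :: "(nat \<Rightarrow> 'a) \<Rightarrow> nat \<Rightarrow> 'a set" for U r where
  const: "\<iota> c \<in> alg U r"
| var: "i < r \<Longrightarrow> U i \<in> alg U r"
| add: "x \<in> alg U r \<Longrightarrow> y \<in> alg U r \<Longrightarrow> x + y \<in> alg U r"
| mult: "x \<in> alg U r \<Longrightarrow> y \<in> alg U r \<Longrightarrow> x * y \<in> alg U r"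

lemma subring_alg: "subring_set (alg U r)"
proof -
  have "\<iota> (- 1) * y = - y" for y
    using sv.scale_minus_left[of 1 y] by (simp add: \<iota>_one)
  then have "x - y \<in> alg U r" if "x \<in> alg U r" "y \<in> alg U r" for x y
    using alg.add[OF that(1) alg.mult[OF alg.const that(2), of "- 1"]] by simp
  then show ?thesis
    using alg.const[of 1 U r] by (auto simp: subring_set_def \<iota>_one intro: alg.mult)
qed

definition mono :: "(nat \<Rightarrow> 'a) \<Rightarrow> nat \<Rightarrow> (nat \<Rightarrow> nat) \<Rightarrow> 'a" where
  "mono U r \<alpha> = (\<Prod>i<r. U i ^ \<alpha> i)"

text \<open>Vanishing from r on makes exponent vectors equal as functions as soon as they agree
  below r.\<close>

definition exponents :: "nat \<Rightarrow> (nat \<Rightarrow> nat) set" where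
  "exponents r = {\<alpha>. \<forall>i\<ge>r. \<alpha> i = 0}"

lemma mono_add: "mono U r (\<lambda>i. \<alpha> i + \<beta> i) = mono U r \<alpha> * mono U r \<beta>"
  by (simp add: mono_def power_add prod.distrib)

lemma alg_subset_span: "x \<in> alg U r \<Longrightarrow> x \<in> sv.span (mono U r ` exponents r)"
proof (induction rule: alg.induct)
  case (const c)
  have "1 \<in> mono U r ` exponents r"
    by (intro image_eqI[of _ _ "\<lambda>_. 0"]) (auto simp: mono_def exponents_def)
  from sv.span_scale[OF sv.span_base[OF this], of c] show ?case by simp
next
  case (var i)
  have "mono U r (\<lambda>j. if j = i then 1 else 0) = (\<Prod>j<r. if j = i then U i else 1)"
    unfolding mono_def by (intro prod.cong) auto
  then have "U i \<in> mono U r ` exponents r"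
    using var by (intro image_eqI[of _ _ "\<lambda>j. if j = i then 1 else 0"]) (auto simp: exponents_def)
  then show ?case by (rule sv.span_base)
next
  case (add x y)
  then show ?case by (intro sv.span_add)
next
  case (mult x y)
  have 1: "mono U r \<alpha> * z \<in> sv.span (mono U r ` exponents r)"
    if "\<alpha> \<in> exponents r" "z \<in> sv.span (mono U r ` exponents r)" for \<alpha> z
    using that(2)
  proof (induction rule: sv.span_induct_alt)
    case base
    show ?case by (simp add: sv.span_zero)
  next
    case (step c x y)
    then obtain \<beta> where \<beta>: "\<beta> \<in> exponents r" "x = mono U r \<beta>" by blast
    have "mono U r (\<lambda>i. \<alpha> i + \<beta> i) \<in> mono U r ` exponents r"
      using \<beta> that(1) by (intro imageI) (auto simp: exponents_def)
    from sv.span_add[OF sv.span_scale[OF sv.span_base[OF this]] step(2), of c]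
    show ?case by (simp add: mono_add \<beta> algebra_simps)
  qed
  show ?case using mult.IH(1)
  proof (induction rule: sv.span_induct_alt)
    case base
    show ?case by (simp add: sv.span_zero)
  next
    case (step c x' z)
    then obtain \<alpha> where \<alpha>: "\<alpha> \<in> exponents r" "x' = mono U r \<alpha>" by blast
    from sv.span_add[OF sv.span_scale[OF 1[OF \<alpha>(1) mult.IH(2)]] step(2), of c]
    show ?case by (simp add: \<alpha> algebra_simps)
  qed
qed

text \<open>A span representation is indexed by ring elements, and different exponent vectors may
  give the same element. One exponent vector is chosen for each element that occurs. Zero
  coefficients are dropped so that the leading one can later be inverted.\<close>

lemma alg_expansion:
  assumes "x \<in> alg U r"
  obtains A c where "finite A" "A \<subseteq> exponents r" "\<And>\<alpha>. \<alpha> \<in> A \<Longrightarrow> c \<alpha> \<noteq> 0"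
    "x = (\<Sum>\<alpha>\<in>A. \<iota> (c \<alpha>) * mono U r \<alpha>)"
proof -
  obtain T d where T: "finite T" "T \<subseteq> mono U r ` exponents r" "x = (\<Sum>a\<in>T. \<iota> (d a) * a)"
    using alg_subset_span[OF assms] unfolding sv.span_explicit by blast
  obtain A where A: "A \<subseteq> exponents r" "inj_on (mono U r) A" "T = mono U r ` A"
    using T(2) by (meson subset_image_inj)
  have fA: "finite A" using T(1) A by (simp add: finite_image_iff)
  define A' where "A' = {\<alpha>\<in>A. d (mono U r \<alpha>) \<noteq> 0}"
  have "x = (\<Sum>\<alpha>\<in>A. \<iota> (d (mono U r \<alpha>)) * mono U r \<alpha>)"
    unfolding T(3) A(3) by (subst sum.reindex[OF A(2)]) simp
  also have "\<dots> = (\<Sum>\<alpha>\<in>A'. \<iota> (d (mono U r \<alpha>)) * mono U r \<alpha>)"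
    using fA by (intro sum.mono_neutral_right) (auto simp: A'_def)
  finally have x: "x = (\<Sum>\<alpha>\<in>A'. \<iota> (d (mono U r \<alpha>)) * mono U r \<alpha>)" .
  show ?thesis
  proof (rule that[OF _ _ _ x])
    show "finite A'" "A' \<subseteq> exponents r" using fA A(1) by (auto simp: A'_def)
  qed (simp add: A'_def)
qed

text \<open>Nagata's substitution \<open>u\<^sub>i = u'\<^sub>i + u\<^sub>0 ^ b ^ i\<close>: for \<open>b\<close> larger than all exponents, distinct
  monomials have distinct degrees in \<open>u\<^sub>0\<close>.\<close>

lemma nagata:
  assumes A: "finite A" "A \<noteq> {}" "A \<subseteq> exponents (Suc r)" and c: "\<And>\<alpha>. \<alpha> \<in> A \<Longrightarrow> c \<alpha> \<noteq> 0"
  obtains U' w n d where "\<And>i. U (Suc i) = U' i + U 0 ^ w i"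
    "monic_in (alg U' r) (U 0) n (\<iota> d * (\<Sum>\<alpha>\<in>A. \<iota> (c \<alpha>) * mono U (Suc r) \<alpha>))"
proof -
  have "finite (\<Union>\<alpha>\<in>A. \<alpha> ` {..<Suc r})" using A(1) by auto
  then obtain b where b: "\<And>\<alpha> i. \<alpha> \<in> A \<Longrightarrow> i < Suc r \<Longrightarrow> \<alpha> i < b"
    unfolding finite_nat_set_iff_bounded by blast
  then have b0: "0 < b" using A(2) by (metis all_not_in_conv gr0I not_less0 zero_less_Suc)
  define t where "t = U 0"
  \<comment> \<open>Index shift: \<open>U' i\<close> replaces \<open>U (Suc i)\<close>, so the power
    of t subtracted is b^(i+1).\<close>
  define U' where "U' = (\<lambda>i. U (Suc i) - t ^ (b ^ Suc i))"
  let ?C = "alg U' r"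
  note C = subring_alg[of U' r]
  \<comment> \<open>The degree in t of a monomial after the substitution: \<open>U i\<close> is
    monic of degree b^i, including \<open>U 0\<close> = t itself. The entries of the exponent vector
    are the base b digits of its weight.\<close>
  define wt where "wt \<alpha> = (\<Sum>i<Suc r. b ^ i * \<alpha> i)" for \<alpha> :: "nat \<Rightarrow> nat"
  have inj: "\<alpha> = \<beta>" if "\<alpha> \<in> A" "\<beta> \<in> A" "wt \<alpha> = wt \<beta>" for \<alpha> \<beta>
  proof
    fix i
    show "\<alpha> i = \<beta> i"
    proof (cases "i < Suc r")
      case True
      then show ?thesis
        using digit_sum_inj[of "Suc r" \<alpha> b \<beta> i] b that unfolding wt_def by blast
    next
      case False
      then have "\<alpha> i = 0" "\<beta> i = 0" using that(1,2) A(3) unfolding exponents_def by auto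
      then show ?thesis by simp
    qed
  qed
  have U: "monic_in ?C t (b ^ i) (U i)" if "i < Suc r" for i
  proof (cases i)
    case 0
    then show ?thesis by (simp add: monic_in_def t_def low_degree_zero)
  next
    case (Suc j)
    have "U' j \<in> low_degree ?C t (b ^ i)"
      using that Suc b0 by (intro low_degree_const alg.var) auto
    then show ?thesis by (simp add: monic_in_def U'_def Suc)
  qed
  have m: "monic_in ?C t (wt \<alpha>) (mono U (Suc r) \<alpha>)" for \<alpha>
    unfolding wt_def mono_def
    by (rule monic_in_prod[OF C]) (auto intro: monic_in_power[OF C] U)
  \<comment> \<open>The exponent of largest weight; as weights are distinct, all other terms have
    strictly smaller degree, and dividing by its coefficient makes the sum monic.\<close>
  obtain \<alpha> where \<alpha>: "\<alpha> \<in> A" "\<And>\<beta>. \<beta> \<in> A \<Longrightarrow> wt \<beta> \<le> wt \<alpha>"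
    using obtains_MAX[OF A(1,2), of wt] A(1) by (metis Max_ge finite_imageI imageI)
  define d where "d = inverse (c \<alpha>)"
  have d: "d * c \<alpha> = 1" using c[OF \<alpha>(1)] by (simp add: d_def)
  have low: "\<iota> (d * c \<beta>) * mono U (Suc r) \<beta> \<in> low_degree ?C t (wt \<alpha>)" if "\<beta> \<in> A - {\<alpha>}" for \<beta>
  proof -
    have "wt \<beta> < wt \<alpha>" using \<alpha>(2)[of \<beta>] inj[of \<beta> \<alpha>] that \<alpha>(1) by force
    then have "t ^ wt \<beta> \<in> low_degree ?C t (wt \<alpha>)"
      and "mono U (Suc r) \<beta> - t ^ wt \<beta> \<in> low_degree ?C t (wt \<alpha>)"
      using low_degree_power[OF C] m[of \<beta>] low_degree_mono[of "wt \<beta>" "wt \<alpha>" ?C t]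
      unfolding monic_in_def by auto
    from low_degree_add[OF this] have "mono U (Suc r) \<beta> \<in> low_degree ?C t (wt \<alpha>)" by simp
    then show ?thesis by (intro low_degree_scale C alg.const)
  qed
  have "\<iota> d * (\<Sum>\<alpha>\<in>A. \<iota> (c \<alpha>) * mono U (Suc r) \<alpha>) =
      (\<Sum>\<beta>\<in>A. \<iota> (d * c \<beta>) * mono U (Suc r) \<beta>)"
    by (simp add: sum_distrib_left \<iota>_mult mult.assoc)
  also have "\<dots> = mono U (Suc r) \<alpha> + (\<Sum>\<beta>\<in>A - {\<alpha>}. \<iota> (d * c \<beta>) * mono U (Suc r) \<beta>)"
    by (subst sum.remove[OF A(1) \<alpha>(1)]) (simp add: d \<iota>_one)
  finally have "\<iota> d * (\<Sum>\<alpha>\<in>A. \<iota> (c \<alpha>) * mono U (Suc r) \<alpha>) - t ^ wt \<alpha> =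
      (mono U (Suc r) \<alpha> - t ^ wt \<alpha>) + (\<Sum>\<beta>\<in>A - {\<alpha>}. \<iota> (d * c \<beta>) * mono U (Suc r) \<beta>)"
    by simp
  also have "\<dots> \<in> low_degree ?C t (wt \<alpha>)"
    using m[of \<alpha>] low by (intro low_degree_add low_degree_sum) (auto simp: monic_in_def)
  finally have "monic_in ?C t (wt \<alpha>) (\<iota> d * (\<Sum>\<alpha>\<in>A. \<iota> (c \<alpha>) * mono U (Suc r) \<alpha>))"
    by (simp add: monic_in_def)
  then show ?thesis
    using that[of U' "\<lambda>i. b ^ Suc i" "wt \<alpha>" d] by (simp add: U'_def t_def)
qed

end

section \<open>Integrality modulo the annihilator and elimination of a variable\<close>

locale alg_action = ring_action scale + scalar_map \<iota>
  for scale :: "'a::comm_ring_1 \<Rightarrow> 'b::ab_group_add \<Rightarrow> 'b" (infixr \<open>*s\<close> 75) and \<iota> :: "'k::field \<Rightarrow> 'a"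
begin

text \<open>Only the effect on S is compared, because the equation satisfied by t is known only as
  an identity of operators on S.\<close>

definition low_mod :: "'a set \<Rightarrow> 'a \<Rightarrow> nat \<Rightarrow> 'b set \<Rightarrow> 'a set" where
  "low_mod C t n S = {x. \<exists>e\<in>low_degree C t n. \<forall>s\<in>S. (x - e) *s s = 0}"

lemma low_modI: "e \<in> low_degree C t n \<Longrightarrow> (\<And>s. s \<in> S \<Longrightarrow> x *s s = e *s s) \<Longrightarrow> x \<in> low_mod C t n S"
  by (auto simp: low_mod_def algebra_simps)

lemma low_modE:
  assumes "x \<in> low_mod C t n S"
  obtains e where "e \<in> low_degree C t n" "\<And>s. s \<in> S \<Longrightarrow> x *s s = e *s s"
  using assms by (auto simp: low_mod_def algebra_simps)

lemma low_mod_add: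
  assumes "x \<in> low_mod C t n S" "y \<in> low_mod C t n S"
  shows "x + y \<in> low_mod C t n S"
proof -
  obtain e where e: "e \<in> low_degree C t n" "\<And>s. s \<in> S \<Longrightarrow> x *s s = e *s s"
    by (rule low_modE[OF assms(1)]) blast
  obtain f where f: "f \<in> low_degree C t n" "\<And>s. s \<in> S \<Longrightarrow> y *s s = f *s s"
    by (rule low_modE[OF assms(2)]) blast
  show ?thesis
    by (rule low_modI[OF low_degree_add[OF e(1) f(1)]]) (simp add: algebra_simps e f)
qed

lemma low_mod_scale:
  assumes C: "subring_set C" and c: "c \<in> C" and "x \<in> low_mod C t n S"
  shows "c * x \<in> low_mod C t n S"
proof -
  obtain e where e: "e \<in> low_degree C t n" "\<And>s. s \<in> S \<Longrightarrow> x *s s = e *s s"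
    by (rule low_modE[OF assms(3)]) blast
  show ?thesis
    by (rule low_modI[OF low_degree_scale[OF C c e(1)]]) (simp add: e flip: scale_scale)
qed

text \<open>Multiplication by t raises each power by one; the only power leaving the range is t^n,
  and the hypothesis rewrites it.\<close>

lemma low_mod_power_mult:
  assumes C: "subring_set C" and t: "t ^ n \<in> low_mod C t n S" and x: "x \<in> low_mod C t n S"
  shows "t * x \<in> low_mod C t n S"
proof -
  have "t * e \<in> low_mod C t n S" if "e \<in> low_degree C t n" for e
    using that unfolding low_degree_def
  proof induction
    case zero
    show ?case by (rule low_modI[of 0]) (simp_all add: low_degree_zero)
  next
    case (step c g u)
    then obtain i where i: "i < n" "g = t ^ i" by blast
    have "t ^ Suc i \<in> low_mod C t n S"
    proof (cases "Suc i = n")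
      case False
      with i have "Suc i < n" by simp
      then show ?thesis by (intro low_modI[OF low_degree_power[OF C]]) auto
    qed (simp add: t del: power_Suc)
    from low_mod_add[OF low_mod_scale[OF C step(1) this] step(4)]
    show ?case by (simp add: i distrib_left mult.left_commute)
  qed
  moreover obtain e where e: "e \<in> low_degree C t n" "\<And>s. s \<in> S \<Longrightarrow> x *s s = e *s s"
    by (rule low_modE[OF x]) blast
  ultimately obtain f where f: "f \<in> low_degree C t n" "\<And>s. s \<in> S \<Longrightarrow> (t * e) *s s = f *s s"
    using low_modE by blast
  show ?thesis
    by (rule low_modI[OF f(1)]) (metis e(2) f(2) scale_scale)
qed

text \<open>Over C = \<open>alg U' r\<close> the old algebra is generated by t, as
  \<open>U (Suc i)\<close> is \<open>U' i\<close> plus a power of t. Since t is integral of degree n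
  on S, every old coefficient acts as a C-combination of 1, t, ..., t^(n-1). Hence the finitely many
  elements t^i g with i < n generate S over C.\<close>

lemma fg_over_fewer_variables:
  assumes G: "finite G" "G \<subseteq> S" "S \<subseteq> bspan (alg U (Suc r)) G"
    and S: "\<And>a s. s \<in> S \<Longrightarrow> a *s s \<in> S"
    and U: "\<And>i. U (Suc i) = U' i + U 0 ^ w i"
    and t: "U 0 ^ n \<in> low_mod (alg U' r) (U 0) n S"
  shows "\<exists>G'. finite G' \<and> G' \<subseteq> S \<and> S \<subseteq> bspan (alg U' r) G'"
proof -
  let ?C = "alg U' r" and ?t = "U 0"
  note C = subring_alg[of U' r]
  let ?W = "low_mod ?C ?t n S"
  have power: "?t ^ i * x \<in> ?W" if "x \<in> ?W" for i x
    using that by (induction i) (simp_all add: mult.assoc low_mod_power_mult[OF C t])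
  have closed: "b * x \<in> ?W" if "b \<in> alg U (Suc r)" "x \<in> ?W" for b x
    using that
  proof (induction b arbitrary: x rule: alg.induct)
    case (const c)
    then show ?case by (intro low_mod_scale[OF C] alg.const)
  next
    case (var i)
    show ?case
    proof (cases i)
      case 0
      then show ?thesis using power[OF var(2), of 1] by simp
    next
      case (Suc j)
      then have "U' j * x \<in> ?W" using var by (intro low_mod_scale[OF C] alg.var) auto
      from low_mod_add[OF this power[OF var(2), of "w j"]]
      show ?thesis by (simp add: Suc U distrib_right)
    qed
  next
    case (add b b')
    then show ?case by (simp add: distrib_right low_mod_add)
  next
    case (mult b b')
    then show ?case by (simp add: mult.assoc)
  qed
  have one: "1 \<in> ?W"
  proof (cases "n = 0")
    \<comment> \<open>For n = 0 the set of low degree elements is {0}, so 1 is not in it; but then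
      the hypothesis on t^0 is the claim.\<close>
    case True
    then show ?thesis using t by simp
  next
    case False
    then show ?thesis using low_degree_power[OF C, of 0 n ?t] by (intro low_modI[of 1]) auto
  qed
  define G' where "G' = (\<lambda>(i, g). ?t ^ i *s g) ` ({..<n} \<times> G)"
  have low: "e *s g \<in> bspan ?C G'" if "e \<in> low_degree ?C ?t n" "g \<in> G" for e g
    using that(1) unfolding low_degree_def
  proof induction
    case zero
    show ?case by (simp add: bspan.zero)
  next
    case (step c x u)
    then obtain i where i: "i < n" "x = ?t ^ i" by blast
    have "?t ^ i *s g \<in> G'" using i that(2) by (force simp: G'_def)
    from bspan.step[OF step(1) this step(4)] show ?case by (simp add: i algebra_simps)
  qed
  have "s \<in> bspan ?C G'" if "s \<in> S" for s
  proof -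
    from that G(3) have "s \<in> bspan (alg U (Suc r)) G" by blast
    then show ?thesis
    proof induction
      case zero
      show ?case by (rule bspan.zero)
    next
      case (step b g u)
      obtain e where e: "e \<in> low_degree ?C ?t n" "\<And>s. s \<in> S \<Longrightarrow> b *s s = e *s s"
        using low_modE[OF closed[OF step(1) one]] by auto
      have "g \<in> S" using step(2) G(2) by blast
      then have "b *s g = e *s g" by (rule e(2))
      then show ?case using bspan_add[OF low[OF e(1) step(2)] step(4)] by simp
    qed
  qed
  moreover have "finite G'" "G' \<subseteq> S"
    using G(1,2) S by (auto simp: G'_def)
  ultimately show ?thesis by blast
qed

text \<open>If t = \<open>U 0\<close> kills S, it is trivially integral there. Otherwise t is
  surjective on S, and Nakayama's lemma yields 1 + t h = 0 on S. As a formal polynomial this has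
  constant term 1, so it is nontrivial whatever h is, and Nagata's substitution turns it into an
  integral equation for t.\<close>

lemma fg_step:
  assumes G: "finite G" "G \<subseteq> S" "S \<subseteq> bspan (alg U (Suc r)) G"
    and S: "\<And>a s. s \<in> S \<Longrightarrow> a *s s \<in> S"
    and dich: "\<And>a. (\<forall>s\<in>S. a *s s = 0) \<or> S \<subseteq> (*s) a ` S"
  shows "\<exists>U' G'. finite G' \<and> G' \<subseteq> S \<and> S \<subseteq> bspan (alg U' r) G'"
proof (cases "\<forall>s\<in>S. U 0 *s s = 0")
  case True
  \<comment> \<open>Here t acts as 0, so n = 1 works; subtracting t^1 from the other variables only
    serves to fit the shape of the substitution.\<close>
  then have "U 0 ^ 1 \<in> low_mod (alg (\<lambda>i. U (Suc i) - U 0 ^ 1) r) (U 0) 1 S"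
    by (intro low_modI[OF low_degree_zero]) simp
  from fg_over_fewer_variables[OF G S _ this, of "\<lambda>_. 1"] show ?thesis by auto
next
  case False
  let ?t = "U 0" and ?B = "alg U (Suc r)"
  from False dich[of ?t] have surj: "S \<subseteq> (*s) ?t ` S" by blast
  obtain h where h: "h \<in> ?B" "\<And>s. s \<in> S \<Longrightarrow> (1 + ?t * h) *s s = 0"
    using nakayama[OF subring_alg alg.var[of 0 "Suc r" U] G S surj] by auto
  obtain A c where A: "finite A" "A \<subseteq> exponents (Suc r)" "\<And>\<alpha>. \<alpha> \<in> A \<Longrightarrow> c \<alpha> \<noteq> 0"
    "h = (\<Sum>\<alpha>\<in>A. \<iota> (c \<alpha>) * mono U (Suc r) \<alpha>)"
    by (rule alg_expansion[OF h(1)]) blast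
  \<comment> \<open>Multiplication by t shifts exponents by \<open>up\<close>. The zero exponent is
    not in the image of \<open>up\<close>, so the constant term 1 meets no other term of t h, and
    all coefficients \<open>c'\<close> are nonzero on \<open>A'\<close>.\<close>
  define up where "up \<alpha> = \<alpha>(0 := Suc (\<alpha> 0))" for \<alpha> :: "nat \<Rightarrow> nat"
  define c' where "c' \<beta> = (if \<beta> 0 = 0 then 1 else c (\<beta>(0 := \<beta> 0 - 1)))" for \<beta> :: "nat \<Rightarrow> nat"
  define A' where "A' = insert (\<lambda>_. 0) (up ` A)"
  have c'_up: "c' (up \<alpha>) = c \<alpha>" for \<alpha> by (simp add: c'_def up_def)
  have up_inj: "inj_on up A"
    by (auto simp: inj_on_def up_def fun_eq_iff split: if_splits)
  have mono_up: "mono U (Suc r) (up \<alpha>) = ?t * mono U (Suc r) \<alpha>" for \<alpha>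
    by (simp add: mono_def prod.lessThan_Suc_shift up_def mult.assoc del: prod.lessThan_Suc)
  have "(\<lambda>_. 0) \<notin> up ` A" by (auto simp: up_def dest: fun_cong[of _ _ 0])
  then have "(\<Sum>\<beta>\<in>A'. \<iota> (c' \<beta>) * mono U (Suc r) \<beta>) = 1 + (\<Sum>\<beta>\<in>up ` A. \<iota> (c' \<beta>) * mono U (Suc r) \<beta>)"
    using A(1) by (simp add: A'_def c'_def mono_def \<iota>_one)
  also have "\<dots> = 1 + ?t * h"
    by (simp add: sum.reindex[OF up_inj] c'_up mono_up A(4) sum_distrib_left mult.left_commute)
  finally have rel: "(\<Sum>\<beta>\<in>A'. \<iota> (c' \<beta>) * mono U (Suc r) \<beta>) = 1 + ?t * h" .
  have A': "finite A'" "A' \<noteq> {}" "A' \<subseteq> exponents (Suc r)"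
    using A(1,2) by (auto simp: A'_def exponents_def up_def)
  have c': "c' \<beta> \<noteq> 0" if "\<beta> \<in> A'" for \<beta>
    using A(3) that by (auto simp: A'_def up_def c'_def)
  obtain U' w n d where U': "\<And>i. U (Suc i) = U' i + ?t ^ w i"
    "monic_in (alg U' r) ?t n (\<iota> d * (1 + ?t * h))"
    by (rule nagata[where c = c' and U = U, OF A' c', unfolded rel]) blast+
  define e where "e = \<iota> d * (1 + ?t * h) - ?t ^ n"
  have e: "e \<in> low_degree (alg U' r) ?t n" using U'(2) by (simp add: e_def monic_in_def)
  \<comment> \<open>The monic element is a scalar multiple of 1 + t h, which acts as zero on S, so
    t^n acts as minus its lower part.\<close>
  have "?t ^ n *s s = (- 1 * e) *s s" if "s \<in> S" for s
    using h(2)[OF that] by (simp add: e_def scale_left_diff_distrib flip: scale_scale)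
  moreover have "- 1 * e \<in> low_degree (alg U' r) ?t n"
    using subring_set_closed[OF subring_alg] by (intro low_degree_scale e subring_alg) blast
  ultimately have "?t ^ n \<in> low_mod (alg U' r) ?t n S" by (intro low_modI)
  from fg_over_fewer_variables[OF G S U'(1) this] show ?thesis by blast
qed

text \<open>Zariski's lemma for modules. The dichotomy is required for all ring elements, not just
  for the current variables, so it survives every change of variables; with no variables left the
  algebra consists of scalars.\<close>

theorem fg_imp_finite_dim:
  assumes "finite G" "G \<subseteq> S" "S \<subseteq> bspan (alg U r) G"
    and "\<And>a s. s \<in> S \<Longrightarrow> a *s s \<in> S"
    and "\<And>a. (\<forall>s\<in>S. a *s s = 0) \<or> S \<subseteq> (*s) a ` S"
  shows "\<exists>G'. finite G' \<and> S \<subseteq> bspan (range \<iota>) G'"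
  using assms(1-3)
proof (induction r arbitrary: U G)
  case 0
  have "x \<in> range \<iota>" if "x \<in> alg U 0" for x
    using that by induction (auto simp flip: \<iota>_add \<iota>_mult)
  moreover have "x \<in> alg U 0" if "x \<in> range \<iota>" for x
    using that alg.const by auto
  ultimately have "alg U 0 = range \<iota>" by blast
  with 0 show ?case by metis
next
  case (Suc r)
  from fg_step[OF Suc.prems assms(4,5)] Suc.IH show ?case by blast
qed

end

section \<open>Eigenvectors\<close>

text \<open>The module structure over the polynomial ring in which the variable acts as T. The old
  action is an explicit argument so that the construction can be iterated for several
  variables.\<close>

definition poly_act :: "('a::comm_ring_1 \<Rightarrow> 'b::ab_group_add \<Rightarrow> 'b) \<Rightarrow> ('b \<Rightarrow> 'b) \<Rightarrow> 'a poly \<Rightarrow> 'b \<Rightarrow> 'b" where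
  "poly_act scale T f w = (\<Sum>i\<le>degree f. scale (coeff f i) ((T ^^ i) w))"

context ring_action
begin

text \<open>Linearity over the acting ring. For an iterated polynomial action this includes
  commuting with the operators already adjoined.\<close>

definition commuting :: "('b \<Rightarrow> 'b) \<Rightarrow> bool" where
  "commuting T \<longleftrightarrow> (\<forall>u w. T (u + w) = T u + T w) \<and> (\<forall>a u. T (a *s u) = a *s T u)"

lemma commutingD:
  assumes "commuting T"
  shows "T (u + w) = T u + T w" "T (a *s u) = a *s T u" "T 0 = 0" "T (- u) = - T u" "T (u - w) = T u - T w"
    "T (sum f I) = (\<Sum>i\<in>I. T (f i))"
proof -
  show *: "T (u + w) = T u + T w" "T (a *s u) = a *s T u" for u w a
    using assms by (auto simp: commuting_def)
  interpret additive T by standard (rule *)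
  show "T 0 = 0" "T (- u) = - T u" "T (u - w) = T u - T w" "T (sum f I) = (\<Sum>i\<in>I. T (f i))"
    by (rule zero minus diff sum)+
qed

lemma commuting_funpow: "commuting T \<Longrightarrow> commuting (T ^^ i)"
  by (induction i) (auto simp: commuting_def)

lemma poly_act_bound:
  assumes "degree f \<le> n"
  shows "poly_act scale T f w = (\<Sum>i\<le>n. coeff f i *s (T ^^ i) w)"
  unfolding poly_act_def using assms
  by (intro sum.mono_neutral_left) (auto simp: coeff_eq_0)

lemma poly_act_pCons: "poly_act scale T (pCons a f) w = a *s w + poly_act scale T f (T w)"
proof -
  have "poly_act scale T (pCons a f) w = (\<Sum>i\<le>Suc (degree f). coeff (pCons a f) i *s (T ^^ i) w)"
    by (rule poly_act_bound) (simp add: degree_pCons_le)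
  also have "\<dots> = a *s w + (\<Sum>i\<le>degree f. coeff f i *s (T ^^ i) (T w))"
    by (subst sum.atMost_Suc_shift) (simp add: funpow_swap1)
  finally show ?thesis by (simp add: poly_act_def)
qed

lemma poly_act_0: "poly_act scale T 0 w = 0"
  by (simp add: poly_act_def)

lemma poly_act_const: "poly_act scale T [:a:] w = a *s w"
  by (simp add: poly_act_def)

lemma poly_act_var: "poly_act scale T [:0, 1:] w = T w"
  by (simp add: poly_act_pCons poly_act_0)

lemma poly_act_commute:
  assumes "commuting D" "\<And>u. D (T u) = T (D u)"
  shows "D (poly_act scale T f w) = poly_act scale T f (D w)"
proof -
  have "D ((T ^^ i) w) = (T ^^ i) (D w)" for i
    by (induction i) (simp_all add: assms(2))
  then show ?thesis by (simp add: poly_act_def commutingD[OF assms(1)])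
qed

lemma poly_act_closed:
  assumes "subspace V" "\<And>u. u \<in> V \<Longrightarrow> T u \<in> V" "w \<in> V"
  shows "poly_act scale T f w \<in> V"
proof -
  have "(T ^^ i) w \<in> V" for i by (induction i) (simp_all add: assms)
  then show ?thesis
    unfolding poly_act_def by (intro subspace_sum subspace_scale assms)
qed

lemma ring_action_poly_act:
  assumes T: "commuting T"
  shows "ring_action (poly_act scale T)"
proof -
  note Ti = commutingD[OF commuting_funpow[OF T]]
  have add: "poly_act scale T (f + g) w = poly_act scale T f w + poly_act scale T g w" for f g w
  proof -
    let ?n = "max (degree f) (degree g)"
    have "degree (f + g) \<le> ?n" by (rule degree_add_le_max)
    then show ?thesis
      by (simp add: poly_act_bound[of _ ?n] scale_left_distrib sum.distrib)
  qed
  have smult: "poly_act scale T (smult a f) w = a *s poly_act scale T f w" for a f w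
    by (subst poly_act_bound[OF degree_smult_le]) (simp add: poly_act_def scale_sum_right)
  have "poly_act scale T f (poly_act scale T g w) = poly_act scale T (f * g) w" for f g w
  proof (induction f arbitrary: w)
    case (pCons a f)
    then show ?case
      by (simp add: poly_act_pCons add smult poly_act_commute[OF T])
  qed (simp add: poly_act_0)
  moreover have "poly_act scale T f (u + w) = poly_act scale T f u + poly_act scale T f w" for f u w
    by (simp add: poly_act_def Ti scale_right_distrib sum.distrib)
  ultimately show ?thesis
    using add by (intro ring_action.intro Modules.module.intro) (auto simp: poly_act_const one_pCons)
qed

end

lemma (in Vector_Spaces.vector_space) ring_action: "ring_action scale"
  by (intro ring_action.intro) unfold_locales

context Vector_Spaces.vector_space
begin

interpretation ring_action scale by (rule ring_action)

text \<open>The card G + 1 iterates of w lie in a span of card G vectors, so they satisfy a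
  nontrivial linear relation, whose coefficients form f.\<close>

lemma annihilating_poly:
  assumes G: "finite G" "\<And>i. (T ^^ i) w \<in> span G"
  obtains f where "f \<noteq> 0" "poly_act scale T f w = 0"
proof -
  let ?I = "{..card G}" and ?t = "\<lambda>i. (T ^^ i) w"
  have "\<exists>u. (\<exists>i\<in>?I. u i \<noteq> 0) \<and> (\<Sum>i\<in>?I. u i *s ?t i) = 0"
  \<comment> \<open>Linear dependence is a property of sets; if two iterates coincide, their
    difference is the required relation.\<close>
  proof (cases "inj_on ?t ?I")
    case True
    have "\<not> independent (?t ` ?I)"
    proof
      assume "independent (?t ` ?I)"
      then have "card (?t ` ?I) \<le> card G"
        using independent_span_bound[OF G(1)] G(2) by blast
      then show False by (simp add: card_image[OF True])
    qed
    then obtain u where u: "\<exists>v\<in>?t ` ?I. u v \<noteq> 0" "(\<Sum>v\<in>?t ` ?I. u v *s v) = 0"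
      by (auto simp: dependent_finite)
    then show ?thesis
      by (intro exI[of _ "\<lambda>i. u (?t i)"]) (auto simp: sum.reindex[OF True])
  next
    case False
    then obtain i j where ij: "i \<in> ?I" "j \<in> ?I" "i \<noteq> j" "?t i = ?t j"
      by (auto simp: inj_on_def)
    define u where "u k = (if k = i then 1 else 0) - (if k = j then 1 else 0 :: 'a)" for k
    have "(\<Sum>k\<in>?I. u k *s ?t k) = ?t i - ?t j"
      using ij by (simp add: u_def scale_left_diff_distrib sum_subtractf if_distrib[of "\<lambda>c. c *s _"] sum.delta cong: if_cong)
    with ij show ?thesis by (intro exI[of _ u]) (auto simp: u_def)
  qed
  then obtain u where u: "\<exists>i\<in>?I. u i \<noteq> 0" "(\<Sum>i\<in>?I. u i *s ?t i) = 0" by blast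
  define f where "f = (\<Sum>i\<in>?I. monom (u i) i)"
  have f: "coeff f i = (if i \<le> card G then u i else 0)" for i
    by (simp add: f_def coeff_sum)
  then have "degree f \<le> card G" by (intro degree_le) auto
  then have "poly_act scale T f w = 0"
    using u(2) by (simp add: poly_act_bound f)
  moreover have "f \<noteq> 0" using u(1) f by (metis atMost_iff coeff_0)
  ultimately show ?thesis using that by blast
qed

end

text \<open>Among nonzero polynomials killing some nonzero vector of V take f of least degree,
  killing w. It is not constant, so it has a root c and f = (X - c) g. By minimality g does not kill
  w, and g applied to w is an eigenvector for c.\<close>

lemma eigenvector_exists:
  fixes scale :: "'k::alg_closed_field \<Rightarrow> 'b::ab_group_add \<Rightarrow> 'b"
  assumes "Vector_Spaces.vector_space scale"
    and T: "ring_action.commuting scale T"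
    and V: "Modules.module.subspace scale V" "V \<noteq> {0}" "\<And>u. u \<in> V \<Longrightarrow> T u \<in> V"
    and G: "finite G" "V \<subseteq> Modules.module.span scale G"
  obtains c v where "v \<in> V" "v \<noteq> 0" "T v = scale c v"
proof -
  interpret Vector_Spaces.vector_space scale by fact
  interpret ring_action scale by (rule ring_action)
  interpret P: ring_action "poly_act scale T" by (rule ring_action_poly_act[OF T])
  have "0 \<in> V" using V(1) by (rule subspace_0)
  with V(2) obtain w where w: "w \<in> V" "w \<noteq> 0" by blast
  have "(T ^^ i) w \<in> V" for i by (induction i) (simp_all add: w V)
  then obtain f where f: "f \<noteq> 0" "poly_act scale T f w = 0"
    using annihilating_poly[of G T w] G by blast
  define Q where "Q f \<longleftrightarrow> f \<noteq> 0 \<and> (\<exists>w\<in>V. w \<noteq> 0 \<and> poly_act scale T f w = 0)" for f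
  from f w have "Q f" unfolding Q_def by blast
  then obtain f where "Q f" and min: "\<And>g. Q g \<Longrightarrow> degree f \<le> degree g"
    using arg_min_nat_lemma[of Q f degree] by blast
  then obtain w where w: "f \<noteq> 0" "w \<in> V" "w \<noteq> 0" "poly_act scale T f w = 0"
    unfolding Q_def by blast
  have "degree f \<noteq> 0"
  proof
    assume "degree f = 0"
    then obtain a where "f = [:a:]" by (metis degree_eq_zeroE)
    with w show False by (simp add: poly_act_const)
  qed
  then obtain c where "poly f c = 0" using alg_closed_imp_poly_has_root by blast
  then obtain g where g: "f = [:- c, 1:] * g" by (metis dvdE poly_eq_0_iff_dvd)
  define v where "v = poly_act scale T g w"
  have vV: "v \<in> V" unfolding v_def by (rule poly_act_closed) (use V w in auto)
  have "g \<noteq> 0" using g w(1) by auto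
  then have "degree f = Suc (degree g)" unfolding g by (subst degree_mult_eq) auto
  then have "\<not> Q g" using min[of g] by auto
  then have "v \<noteq> 0" using \<open>g \<noteq> 0\<close> w(2,3) by (auto simp: Q_def v_def)
  moreover have "poly_act scale T [:- c, 1:] v = 0"
    using w(4) unfolding g v_def by simp
  then have "T v = scale c v"
    by (simp add: poly_act_pCons poly_act_0 poly_act_const)
  ultimately show ?thesis using that vV by blast
qed

section \<open>Simple modules as operators on a vector space\<close>

text \<open>For right modules products compose in reverse: zx acts as \<open>RX\<close> after
  \<open>RZ\<close>. The relations hold on the whole type; only stability, simplicity and
  injectivity refer to S. The divisibility assumption characterises l as the least common multiple
  of the orders of p and q.\<close>

locale simple_hmodule = ring_action scale + Vector_Spaces.vector_space scale
  for scale :: "'k::alg_closed_field \<Rightarrow> 'b::ab_group_add \<Rightarrow> 'b" (infixr \<open>*s\<close> 75) +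
  fixes p q :: 'k and RX RY RZ :: "'b \<Rightarrow> 'b" and S :: "'b set" and l :: nat
  assumes RX: "ring_action.commuting scale RX" and RY: "ring_action.commuting scale RY"
    and RZ: "ring_action.commuting scale RZ"
    and XZ: "RX (RZ w) = inverse p *s RZ (RX w)"
    and YZ: "RY (RZ w) = p *s RZ (RY w)"
    and XY: "RX (RY w) = q *s RY (RX w) + RZ w"
    and S: "subspace S" "S \<noteq> {0}"
    and closed: "w \<in> S \<Longrightarrow> RX w \<in> S" "w \<in> S \<Longrightarrow> RY w \<in> S" "w \<in> S \<Longrightarrow> RZ w \<in> S"
    and simple: "subspace V \<Longrightarrow> V \<subseteq> S \<Longrightarrow> (\<And>w. w \<in> V \<Longrightarrow> RX w \<in> V \<and> RY w \<in> V \<and> RZ w \<in> V) \<Longrightarrow>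
      V = {0} \<or> V = S"
    and pq: "p \<noteq> 0" "q \<noteq> 0" "p * q \<noteq> 1"
    and l: "0 < l" "p ^ l = 1" "q ^ l = 1" and l_dvd: "p ^ i = 1 \<Longrightarrow> q ^ i = 1 \<Longrightarrow> l dvd i"
    and Z_inj: "w \<in> S \<Longrightarrow> RZ w = 0 \<Longrightarrow> w = 0"
begin

definition \<Theta> :: "'b \<Rightarrow> 'b" where
  "\<Theta> w = RX (RY w) - inverse p *s RY (RX w)"

lemmas lin = commutingD[OF RX] commutingD[OF RY] commutingD[OF RZ]

lemma lin_funpow:
  "(RX ^^ n) (u + w) = (RX ^^ n) u + (RX ^^ n) w" "(RX ^^ n) (a *s u) = a *s (RX ^^ n) u"
  "(RY ^^ n) (u + w) = (RY ^^ n) u + (RY ^^ n) w" "(RY ^^ n) (a *s u) = a *s (RY ^^ n) u"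
  "(RZ ^^ n) (u + w) = (RZ ^^ n) u + (RZ ^^ n) w" "(RZ ^^ n) (a *s u) = a *s (RZ ^^ n) u"
  "(RX ^^ n) 0 = 0" "(RY ^^ n) 0 = 0" "(RZ ^^ n) 0 = 0"
  by (rule commutingD[OF commuting_funpow[OF RX]] commutingD[OF commuting_funpow[OF RY]]
      commutingD[OF commuting_funpow[OF RZ]])+

lemma closed_funpow: "w \<in> S \<Longrightarrow> (RX ^^ n) w \<in> S" "w \<in> S \<Longrightarrow> (RY ^^ n) w \<in> S" "w \<in> S \<Longrightarrow> (RZ ^^ n) w \<in> S"
  by (induction n) (simp_all add: closed)

section \<open>Commutation rules and central powers\<close>

lemma XnZ: "(RX ^^ n) (RZ w) = inverse p ^ n *s RZ ((RX ^^ n) w)"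
  by (induction n) (simp_all add: XZ lin mult.commute)

lemma XZn: "RX ((RZ ^^ n) w) = inverse p ^ n *s (RZ ^^ n) (RX w)"
  by (induction n) (simp_all add: XZ lin mult.commute)

lemma YnZ: "(RY ^^ n) (RZ w) = p ^ n *s RZ ((RY ^^ n) w)"
  by (induction n) (simp_all add: YZ lin mult.commute)

lemma YZn: "RY ((RZ ^^ n) w) = p ^ n *s (RZ ^^ n) (RY w)"
  by (induction n) (simp_all add: YZ lin mult.commute)

text \<open>In the algebra: y x^(n+1) = q^(n+1) x^(n+1) y + [n+1] x^n z. The recursion [n+1] = q [n]
  + p^-n matches the two terms of yx = q xy + z: the factor q from exchanging y and x, the power of
  1/p from moving z past the powers of x.\<close>

lemma XnY: "(RX ^^ Suc n) (RY w) = q ^ Suc n *s RY ((RX ^^ Suc n) w) + pq_number p q (Suc n) *s RZ ((RX ^^ n) w)"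
proof (induction n arbitrary: w)
  case 0
  show ?case using pq by (simp add: XY pq_number_Suc)
next
  case (Suc n)
  have "(RX ^^ Suc (Suc n)) (RY w) = (RX ^^ Suc n) (q *s RY (RX w) + RZ w)"
    by (simp only: funpow_Suc_right[of "Suc n"] comp_apply XY)
  also have "\<dots> = q *s (RX ^^ Suc n) (RY (RX w)) + (RX ^^ Suc n) (RZ w)"
    by (simp only: lin_funpow)
  also have "\<dots> = q *s (q ^ Suc n *s RY ((RX ^^ Suc n) (RX w)) + pq_number p q (Suc n) *s RZ ((RX ^^ n) (RX w)))
      + inverse p ^ Suc n *s RZ ((RX ^^ Suc n) w)"
    by (simp only: Suc XnZ)
  also have "\<dots> = q ^ Suc (Suc n) *s RY ((RX ^^ Suc (Suc n)) w)
      + (q * pq_number p q (Suc n) + inverse p ^ Suc n) *s RZ ((RX ^^ Suc n) w)"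
    by (simp add: funpow_swap1 scale_right_distrib scale_left_distrib)
  finally show ?case using pq_number_Suc[OF pq(1,3), of "Suc n"] by simp
qed

lemma XYn: "RX ((RY ^^ Suc n) w) = q ^ Suc n *s (RY ^^ Suc n) (RX w) + pq_number p q (Suc n) *s (RY ^^ n) (RZ w)"
proof (induction n)
  case 0
  show ?case using pq by (simp add: XY pq_number_Suc)
next
  case (Suc n)
  have "RX ((RY ^^ Suc (Suc n)) w) = q *s RY (RX ((RY ^^ Suc n) w)) + RZ ((RY ^^ Suc n) w)"
    by (simp add: XY)
  also have "RZ ((RY ^^ Suc n) w) = inverse p ^ Suc n *s (RY ^^ Suc n) (RZ w)"
    using pq(1) by (simp only: YnZ scale_scale flip: power_mult_distrib) simp
  also have "q *s RY (RX ((RY ^^ Suc n) w)) =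
     q ^ Suc (Suc n) *s (RY ^^ Suc (Suc n)) (RX w) + (q * pq_number p q (Suc n)) *s (RY ^^ Suc n) (RZ w)"
    unfolding Suc by (simp add: lin scale_right_distrib)
  finally show ?case
    using pq_number_Suc[OF pq(1,3), of "Suc n"] by (simp add: scale_left_distrib)
qed

text \<open>From (pq)^l = 1 the bracket [l] vanishes, which removes the correction term in the rules
  for x^l and y^l; the remaining factors are l-th powers of p, 1/p and q.\<close>

lemma powers_central:
  "(RX ^^ l) (RY w) = RY ((RX ^^ l) w)" "(RX ^^ l) (RZ w) = RZ ((RX ^^ l) w)"
  "RX ((RY ^^ l) w) = (RY ^^ l) (RX w)" "(RY ^^ l) (RZ w) = RZ ((RY ^^ l) w)"
  "RX ((RZ ^^ l) w) = (RZ ^^ l) (RX w)" "RY ((RZ ^^ l) w) = (RZ ^^ l) (RY w)"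
proof -
  obtain n where n: "l = Suc n" using l(1) gr0_implies_Suc by blast
  have "pq_number p q l = 0"
    using l pq by (intro pq_number_eq_0) (simp_all add: power_mult_distrib)
  then show "(RX ^^ l) (RY w) = RY ((RX ^^ l) w)" "RX ((RY ^^ l) w) = (RY ^^ l) (RX w)"
    using XnY[of n w] XYn[of n w] l(3) by (simp_all add: n del: power_Suc funpow.simps)
qed (simp_all add: XnZ XZn YnZ YZn l power_inverse)

lemma powers_commute: "RX ((RX ^^ n) w) = (RX ^^ n) (RX w)" "RY ((RY ^^ n) w) = (RY ^^ n) (RY w)"
  "RZ ((RZ ^^ n) w) = (RZ ^^ n) (RZ w)"
  by (simp_all add: funpow_swap1)

section \<open>Action of the central powers and finite dimension\<close>

lemma commute_funpow: "(\<And>u. D (T u) = T (D u)) \<Longrightarrow> D ((T ^^ n) w) = (T ^^ n) (D w)"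
  by (induction n) simp_all

text \<open>The polynomial ring in three variables acts through the central elements
  \<open>x\<^sup>l, y\<^sup>l, z\<^sup>l\<close>.\<close>

definition cact :: "'k poly poly poly \<Rightarrow> 'b \<Rightarrow> 'b" where
  "cact = poly_act (poly_act (poly_act scale (RX ^^ l)) (RY ^^ l)) (RZ ^^ l)"

text \<open>The claims share one tower of three polynomial actions: each new operator has to be
  linear over the polynomial ring built so far before its variable can be adjoined. The innermost
  variable is x^l, the outermost z^l.\<close>

lemma cact_action: "alg_action cact (\<lambda>c. [:[:[:c:]:]:])"
  and cact_commute:
    "\<lbrakk>commuting D; \<And>w. D ((RX ^^ l) w) = (RX ^^ l) (D w); \<And>w. D ((RY ^^ l) w) = (RY ^^ l) (D w);
      \<And>w. D ((RZ ^^ l) w) = (RZ ^^ l) (D w)\<rbrakk> \<Longrightarrow> D (cact a w) = cact a (D w)"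
  and cact_closed: "w \<in> S \<Longrightarrow> cact a w \<in> S"
  and cact_simps: "cact [:[:[:c:]:]:] w = c *s w" "cact [:[:[:0, 1:]:]:] w = (RX ^^ l) w"
    "cact [:[:0, 1:]:] w = (RY ^^ l) w" "cact [:0, 1:] w = (RZ ^^ l) w"
proof -
  let ?a1 = "poly_act scale (RX ^^ l)"
  interpret A1: ring_action ?a1
    by (rule ring_action_poly_act) (rule commuting_funpow[OF RX])
  have c1: "A1.commuting D" if "commuting D" "\<And>w. D ((RX ^^ l) w) = (RX ^^ l) (D w)" for D
    using commutingD(1)[OF that(1)] poly_act_commute[where T = "RX ^^ l", OF that] by (auto simp: A1.commuting_def)
  have Y1: "A1.commuting (RY ^^ l)"
    using commute_funpow[of "RY ^^ l" RX l] powers_central(3) by (intro c1 commuting_funpow[OF RY]) simp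
  let ?a2 = "poly_act ?a1 (RY ^^ l)"
  interpret A2: ring_action ?a2
    by (rule A1.ring_action_poly_act) (rule Y1)
  have c2: "A2.commuting D" if "commuting D" "\<And>w. D ((RX ^^ l) w) = (RX ^^ l) (D w)"
      "\<And>w. D ((RY ^^ l) w) = (RY ^^ l) (D w)" for D
    using commutingD(1)[OF that(1)] A1.poly_act_commute[where T = "RY ^^ l", OF c1[OF that(1,2)] that(3)]
    by (auto simp: A2.commuting_def)
  have Z2: "A2.commuting (RZ ^^ l)"
  proof (rule c2[OF commuting_funpow[OF RZ]])
    show "(RZ ^^ l) ((RX ^^ l) w) = (RX ^^ l) ((RZ ^^ l) w)" for w
      by (rule commute_funpow) (simp add: powers_central)
    show "(RZ ^^ l) ((RY ^^ l) w) = (RY ^^ l) ((RZ ^^ l) w)" for w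
      by (rule commute_funpow) (simp add: powers_central)
  qed
  interpret A3: ring_action cact
    unfolding cact_def by (rule A2.ring_action_poly_act) (rule Z2)
  show "alg_action cact (\<lambda>c. [:[:[:c:]:]:])"
    by (intro alg_action.intro A3.ring_action_axioms scalar_map.intro) (simp_all add: one_pCons)
  show "D (cact a w) = cact a (D w)"
    if "commuting D" "\<And>w. D ((RX ^^ l) w) = (RX ^^ l) (D w)"
      "\<And>w. D ((RY ^^ l) w) = (RY ^^ l) (D w)" "\<And>w. D ((RZ ^^ l) w) = (RZ ^^ l) (D w)"
    unfolding cact_def by (rule A2.poly_act_commute[where T = "RZ ^^ l", OF c2[OF that(1-3)] that(4)])
  have S1: "A1.subspace S"
    using S(1) poly_act_closed[OF S(1) closed_funpow(1)]
    by (auto simp: A1.subspace_def subspace_def)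
  then have S2: "A2.subspace S"
    using A1.poly_act_closed[OF S1 closed_funpow(2)]
    by (auto simp: A1.subspace_def A2.subspace_def)
  show "w \<in> S \<Longrightarrow> cact a w \<in> S"
    unfolding cact_def using A2.poly_act_closed[OF S2 closed_funpow(3)] .
  show "cact [:[:[:c:]:]:] w = c *s w" "cact [:[:[:0, 1:]:]:] w = (RX ^^ l) w"
    "cact [:[:0, 1:]:] w = (RY ^^ l) w" "cact [:0, 1:] w = (RZ ^^ l) w"
    by (simp_all add: cact_def poly_act_const poly_act_var A1.poly_act_const A1.poly_act_var
        A2.poly_act_const A2.poly_act_var)
qed

lemma cact_central: "RX (cact a w) = cact a (RX w)" "RY (cact a w) = cact a (RY w)" "RZ (cact a w) = cact a (RZ w)"
  by (rule cact_commute; simp add: RX RY RZ powers_central powers_commute)+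

text \<open>The ordered monomials w x^i y^j z^k with exponents below l generate, over the central
  powers, a nonzero submodule, which is S by simplicity. The image of a central element is a
  submodule as well, which gives the dichotomy.\<close>

lemma finite_dim: "\<exists>G. finite G \<and> S \<subseteq> span G"
proof -
  interpret A: alg_action cact "\<lambda>c. [:[:[:c:]:]:]" by (rule cact_action)
  define U :: "nat \<Rightarrow> 'k poly poly poly"
    where "U i = (if i = 0 then [:[:[:0, 1:]:]:] else if i = 1 then [:[:0, 1:]:] else [:0, 1:])" for i
  have U: "U 0 \<in> A.alg U 3" "U 1 \<in> A.alg U 3" "U 2 \<in> A.alg U 3"
    by (rule A.alg.var; simp)+
  obtain w where w: "w \<in> S" "w \<noteq> 0" using S subspace_0 by blast
  \<comment> \<open>With z applied last, the operator of z only raises k and that of y passes z^k at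
    the cost of a scalar; only x needs the bracket formula.\<close>
  define e where "e i j k = (RZ ^^ k) ((RY ^^ j) ((RX ^^ i) w))" for i j k
  define G where "G = (\<lambda>(i, j, k). e i j k) ` ({..<l} \<times> {..<l} \<times> {..<l})"
  let ?W = "A.bspan (A.alg U 3) G"
  note C = A.subring_alg[of U 3]
  have eS: "e i j k \<in> S" for i j k
    unfolding e_def by (intro closed_funpow w)
  \<comment> \<open>Any exponent of at least l is lowered by l, since the l-th power can be pulled
    out as a central coefficient.\<close>
  have e: "e i j k \<in> ?W" for i j k
  proof (induction "i + j + k" arbitrary: i j k rule: less_induct)
    case less
    consider "l \<le> i" | "l \<le> j" | "l \<le> k" | "i < l" "j < l" "k < l" by linarith
    then show ?case
    proof cases
      case 1
      then have "(RX ^^ i) w = (RX ^^ l) ((RX ^^ (i - l)) w)"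
        by (simp flip: funpow_add[unfolded comp_def, THEN fun_cong])
      then have "e i j k = (RX ^^ l) (e (i - l) j k)"
        unfolding e_def
        by (simp add: commute_funpow[of "RX ^^ l" RY] commute_funpow[of "RX ^^ l" RZ] powers_central)
      then have "e i j k = cact (U 0) (e (i - l) j k)" by (simp add: U_def cact_simps)
      moreover have "e (i - l) j k \<in> ?W" using 1 l(1) by (intro less) simp
      ultimately show ?thesis using A.bspan_mult[OF C U(1)] by simp
    next
      case 2
      then have "(RY ^^ j) u = (RY ^^ l) ((RY ^^ (j - l)) u)" for u
        by (simp flip: funpow_add[unfolded comp_def, THEN fun_cong])
      then have "e i j k = (RY ^^ l) (e i (j - l) k)"
        unfolding e_def by (simp add: commute_funpow[of "RY ^^ l" RZ] powers_central)
      then have "e i j k = cact (U 1) (e i (j - l) k)" by (simp add: U_def cact_simps)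
      moreover have "e i (j - l) k \<in> ?W" using 2 l(1) by (intro less) simp
      ultimately show ?thesis using A.bspan_mult[OF C U(2)] by simp
    next
      case 3
      then have "e i j k = (RZ ^^ l) (e i j (k - l))"
        unfolding e_def by (simp flip: funpow_add[unfolded comp_def, THEN fun_cong])
      then have "e i j k = cact (U 2) (e i j (k - l))" by (simp add: U_def cact_simps)
      moreover have "e i j (k - l) \<in> ?W" using 3 l(1) by (intro less) simp
      ultimately show ?thesis using A.bspan_mult[OF C U(3)] by simp
    next
      case 4
      then have "e i j k \<in> G" unfolding G_def by force
      then show ?thesis using A.bspan_base[OF subring_set_closed(1)[OF C]] by fastforce
    qed
  qed
  have scal: "c *s u \<in> ?W" if "u \<in> ?W" for c u
    using A.bspan_mult[OF C A.alg.const that] by (simp add: cact_simps)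
  have Ze: "RZ (e i j k) \<in> ?W" for i j k
    using e[of i j "Suc k"] by (simp add: e_def)
  have Ye: "RY (e i j k) \<in> ?W" for i j k
    using scal[OF e[of i "Suc j" k]] by (simp add: e_def YZn)
  have Xe: "RX (e i j k) \<in> ?W" for i j k
  proof (cases j)
    case 0
    then show ?thesis
      using scal[OF e[of "Suc i" 0 k]] by (simp add: e_def XZn)
  next
    case (Suc j')
    \<comment> \<open>Moving x left past y^j z^k leaves a term with z inserted before y^(j-1);
      moving that z to the right costs p^(j-1).\<close>
    have "RX (e i j k) = (inverse p ^ k * q ^ j) *s e (Suc i) j k +
        (inverse p ^ k * pq_number p q j * p ^ j') *s e i j' (Suc k)"
      unfolding e_def Suc
      by (simp only: XZn XYn YnZ lin_funpow scale_right_distrib scale_scale)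
         (simp add: funpow_swap1 mult.assoc)
    then show ?thesis by (simp only: A.bspan_add scal e)
  qed
  have stable: "D u \<in> ?W" if D: "commuting D" "\<And>a w. D (cact a w) = cact a (D w)"
      and De: "\<And>i j k. D (e i j k) \<in> ?W" and "u \<in> ?W" for D u
    using that(4)
  proof induction
    case zero
    show ?case by (simp add: commutingD(3)[OF D(1)] A.bspan.zero)
  next
    case (step b g u)
    from step(2) obtain i j k where "g = e i j k" unfolding G_def by auto
    then have "cact b (D g) \<in> ?W" by (intro A.bspan_mult[OF C step(1)]) (simp add: De)
    from A.bspan_add[OF this step(4)] show ?case by (simp add: commutingD(1)[OF D(1)] D(2))
  qed
  have "?W = {0} \<or> ?W = S"
  proof (rule simple)
    show "subspace ?W" by (intro subspaceI A.bspan.zero A.bspan_add scal)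
    show "RX u \<in> ?W \<and> RY u \<in> ?W \<and> RZ u \<in> ?W" if "u \<in> ?W" for u
      using stable[OF RX cact_central(1) Xe that] stable[OF RY cact_central(2) Ye that]
        stable[OF RZ cact_central(3) Ze that] by blast
    show "?W \<subseteq> S"
    proof
      fix u assume "u \<in> ?W"
      then show "u \<in> S"
      proof induction
        case (step b g u)
        then have "g \<in> S" using eS by (auto simp: G_def)
        with step(4) show ?case by (intro subspace_add[OF S(1)] cact_closed)
      qed (rule subspace_0[OF S(1)])
    qed
  qed
  moreover have "w \<in> ?W" using e[of 0 0 0] by (simp add: e_def)
  ultimately have W: "S \<subseteq> ?W" using w by auto
  have dich: "(\<forall>s\<in>S. cact a s = 0) \<or> S \<subseteq> cact a ` S" for a
  proof -
    have "cact a ` S = {0} \<or> cact a ` S = S"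
    proof (rule simple)
      show "subspace (cact a ` S)"
      proof (rule subspaceI)
        show "0 \<in> cact a ` S" using subspace_0[OF S(1)] A.scale_zero_right[of a] by force
        show "x + y \<in> cact a ` S" if "x \<in> cact a ` S" "y \<in> cact a ` S" for x y
          using that subspace_add[OF S(1)] by (force simp flip: A.scale_right_distrib)
        show "c *s x \<in> cact a ` S" if "x \<in> cact a ` S" for c x
        proof -
          have "c *s cact a u = cact a (c *s u)" for u
            using A.scale_left_commute[of "[:[:[:c:]:]:]" a u] by (simp only: cact_simps)
          then show ?thesis using that subspace_scale[OF S(1)] by auto
        qed
      qed
      show "cact a ` S \<subseteq> S" using cact_closed by auto
      show "RX u \<in> cact a ` S \<and> RY u \<in> cact a ` S \<and> RZ u \<in> cact a ` S" if "u \<in> cact a ` S" for u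
        using that closed by (auto simp: cact_central)
    qed
    then show ?thesis by auto
  qed
  have "finite G" "G \<subseteq> S" using eS by (auto simp: G_def)
  from A.fg_imp_finite_dim[OF this W cact_closed dich] obtain G' where
    G': "finite G'" "S \<subseteq> A.bspan (range (\<lambda>c. [:[:[:c:]:]:])) G'" by blast
  have "u \<in> span G'" if "u \<in> A.bspan (range (\<lambda>c. [:[:[:c:]:]:])) G'" for u
    using that
  proof induction
    case (step b g u)
    then show ?case
      by (auto simp: cact_simps intro!: span_add span_scale intro: span_base)
  qed (rule span_zero)
  with G' show ?thesis by blast
qed

section \<open>Eigenvectors in S and Schur's lemma\<close>

lemma eigenvector:
  assumes "commuting T" "subspace V" "V \<noteq> {0}" "V \<subseteq> S" "\<And>u. u \<in> V \<Longrightarrow> T u \<in> V"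
  shows "\<exists>c. \<exists>v\<in>V. v \<noteq> 0 \<and> T v = c *s v"
proof -
  obtain G where G: "finite G" "S \<subseteq> span G" using finite_dim by blast
  with assms(4) have V: "V \<subseteq> span G" by blast
  show ?thesis
    by (rule eigenvector_exists[OF vector_space_axioms assms(1-3) _ G(1) V])
       (use assms(5) in blast)+
qed

text \<open>Schur's lemma: T has an eigenvector in S, and the whole eigenspace is a nonzero
  submodule because T commutes with the generators.\<close>

lemma central_scalar:
  assumes T: "commuting T" "\<And>w. w \<in> S \<Longrightarrow> T w \<in> S"
    and c: "\<And>w. RX (T w) = T (RX w)" "\<And>w. RY (T w) = T (RY w)" "\<And>w. RZ (T w) = T (RZ w)"
  obtains c where "\<And>w. w \<in> S \<Longrightarrow> T w = c *s w"
proof -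
  obtain c v where v: "v \<in> S" "v \<noteq> 0" "T v = c *s v"
    using eigenvector[OF T(1) S subset_refl] T(2) by metis
  let ?V = "{w \<in> S. T w = c *s w}"
  have "?V = {0} \<or> ?V = S"
  proof (rule simple)
    show "subspace ?V"
      using S(1) by (auto simp: subspace_def commutingD[OF T(1)] scale_right_distrib mult.commute)
    show "RX w \<in> ?V \<and> RY w \<in> ?V \<and> RZ w \<in> ?V" if "w \<in> ?V" for w
      using that closed by (simp add: lin flip: c)
  qed auto
  with v that show ?thesis by blast
qed

section \<open>Bases with prescribed action, and the element theta\<close>

definition gen_act :: "gen \<Rightarrow> 'b \<Rightarrow> 'b" where
  "gen_act g = (case g of GX \<Rightarrow> RX | GY \<Rightarrow> RY | GZ \<Rightarrow> RZ)"

text \<open>The coordinate map starts from the carrier of \<open>basis_module\<close>, so that it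
  directly provides the isomorphism.\<close>

definition is_basis_for :: "nat \<Rightarrow> (gen \<Rightarrow> nat \<Rightarrow> nat \<Rightarrow> 'k) \<Rightarrow> (nat \<Rightarrow> 'b) \<Rightarrow> bool" where
  "is_basis_for d ims v \<longleftrightarrow>
    (\<forall>g. \<forall>k<d. gen_act g (v k) = (\<Sum>j<d. ims g k j *s v j)) \<and>
    bij_betw (\<lambda>c. \<Sum>j<d. c j *s v j) {c. \<forall>k\<ge>d. c k = 0} S"

lemma gen_act_commuting: "commuting (gen_act g)"
  using RX RY RZ by (cases g) (simp_all add: gen_act_def)

lemma sum_bvec: "(\<Sum>j<d. bvec c k j *s v j) = (if k < d then c *s v k else 0)"
  by (simp add: bvec_def if_distrib[of "\<lambda>c. c *s _"] sum.delta cong: if_cong)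

text \<open>Obtained by substituting yx = q xy + z. As q differs from 1/p, the actions of theta and
  z determine that of xy.\<close>

lemma \<Theta>_eq: "\<Theta> w = (q - inverse p) *s RY (RX w) + RZ w"
  by (simp add: \<Theta>_def XY scale_left_diff_distrib)

lemma \<Theta>_linear: "\<Theta> (u + w) = \<Theta> u + \<Theta> w" "\<Theta> (a *s u) = a *s \<Theta> u"
  by (simp_all add: \<Theta>_def lin scale_right_distrib scale_right_diff_distrib mult.commute)

lemma \<Theta>_commuting: "commuting \<Theta>"
  using \<Theta>_linear by (simp add: commuting_def)

lemma \<Theta>_closed: "w \<in> S \<Longrightarrow> \<Theta> w \<in> S"
  by (simp add: \<Theta>_def subspace_diff subspace_scale S closed)

text \<open>Like z, theta commutes with x and y up to a scalar, so powers of x or y send joint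
  eigenvectors of z and theta to joint eigenvectors or to 0.\<close>

lemma \<Theta>_RX: "\<Theta> (RX w) = inverse q *s RX (\<Theta> w)"
proof -
  have "RX (\<Theta> w) = q *s \<Theta> (RX w)"
    using pq by (simp add: \<Theta>_eq lin XY XZ scale_right_distrib algebra_simps)
  then show ?thesis using pq by simp
qed

lemma \<Theta>_RY: "\<Theta> (RY w) = q *s RY (\<Theta> w)"
  using pq by (simp add: \<Theta>_eq lin XY YZ scale_right_distrib algebra_simps)

lemma \<Theta>_RZ: "\<Theta> (RZ w) = RZ (\<Theta> w)"
  using pq by (simp add: \<Theta>_eq lin XZ YZ)

text \<open>A nonzero kernel of the coordinate map is stable under \<open>z\<close> and \<open>\<theta>\<close>, hence it would
  contain a vector with a single nonzero coordinate.\<close>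

lemma is_basis_forI:
  assumes d: "0 < d" and v: "\<And>k. k < d \<Longrightarrow> v k \<in> S" "\<And>k. k < d \<Longrightarrow> v k \<noteq> 0"
    and act: "\<And>g k. k < d \<Longrightarrow> gen_act g (v k) = (\<Sum>j<d. ims g k j *s v j)"
    and eigen: "\<And>k. k < d \<Longrightarrow> RZ (v k) = a k *s v k" "\<And>k. k < d \<Longrightarrow> \<Theta> (v k) = b k *s v k"
    and distinct: "\<And>i j. i < j \<Longrightarrow> j < d \<Longrightarrow> a i = a j \<Longrightarrow> b i = b j \<Longrightarrow> False"
  shows "is_basis_for d ims v"
proof -
  define h where "h c = (\<Sum>j<d. c j *s v j)" for c
  let ?C = "{c. \<forall>k\<ge>d. c k = 0} :: (nat \<Rightarrow> 'k) set"
  have h_diff: "h (\<lambda>j. c j - e j) = h c - h e" and h_add: "h (\<lambda>j. c j + e j) = h c + h e"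
    and h_scale: "h (\<lambda>j. x * c j) = x *s h c" for c e x
    by (simp_all add: h_def scale_left_diff_distrib scale_left_distrib sum_subtractf sum.distrib scale_sum_right)
  \<comment> \<open>On coordinates D - x is diagonal with entries f j - x, and it preserves the
    kernel of the coordinate map.\<close>
  have diag: "h (\<lambda>j. (f j - x) * c j) = 0"
    if "h c = 0" "commuting D" "\<And>k. k < d \<Longrightarrow> D (v k) = f k *s v k" for D f x c
  proof -
    have "D (h c) = h (\<lambda>j. f j * c j)"
      unfolding h_def commutingD(6)[OF that(2)]
      by (intro sum.cong) (simp_all add: commutingD(2)[OF that(2)] that(3) mult.commute)
    then show ?thesis
      using h_diff[of "\<lambda>j. f j * c j" "\<lambda>j. x * c j"] that(1)
      by (simp add: left_diff_distrib h_scale commutingD(3)[OF that(2)])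
  qed
  have ker: "\<forall>j<d. c j = 0" if "h c = 0" for c
    using that
  proof (induction "card {j. j < d \<and> c j \<noteq> 0}" arbitrary: c rule: less_induct)
    case less
    show ?case
    proof (rule ccontr)
      assume "\<not> (\<forall>j<d. c j = 0)"
      then obtain i where i: "i < d" "c i \<noteq> 0" by blast
      have only: "c j = 0" if j: "j < d" "j \<noteq> i" for j
      proof (rule ccontr)
        assume cj: "c j \<noteq> 0"
        have "a i \<noteq> a j \<or> b i \<noteq> b j"
          using distinct[of i j] distinct[of j i] i j by (metis nat_neq_iff)
        then obtain f D where f: "f j \<noteq> f i" "commuting D" "\<And>k. k < d \<Longrightarrow> D (v k) = f k *s v k"
          using eigen RZ \<Theta>_commuting by metis
        \<comment> \<open>Subtracting the eigenvalue at i erases coordinate i and keeps coordinate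
          j, so a shorter kernel vector arises that is still nonzero.\<close>
        let ?c = "\<lambda>j. (f j - f i) * c j"
        have "{j. j < d \<and> ?c j \<noteq> 0} \<subset> {j. j < d \<and> c j \<noteq> 0}" using i by auto
        then have "card {j. j < d \<and> ?c j \<noteq> 0} < card {j. j < d \<and> c j \<noteq> 0}"
          by (intro psubset_card_mono) auto
        from less(1)[OF this diag[OF less(2) f(2,3)]] j cj f(1) show False by auto
      qed
      have "h c = (\<Sum>j<d. if j = i then c i *s v i else 0)"
        unfolding h_def using only by (intro sum.cong) auto
      with i less(2) v(2)[OF i(1)] show False by (simp add: sum.delta)
    qed
  qed
  have "inj_on h ?C"
  proof (rule inj_onI)
    fix c e assume "c \<in> ?C" "e \<in> ?C" "h c = h e"
    then have "\<forall>j<d. c j - e j = 0" using ker[of "\<lambda>j. c j - e j"] by (simp add: h_diff)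
    with \<open>c \<in> ?C\<close> \<open>e \<in> ?C\<close> show "c = e" by (auto simp: fun_eq_iff not_less) (metis not_less)
  qed
  moreover have "h ` ?C = S"
  proof -
    have hact: "gen_act g (h c) = h (lin_ext d (ims g) c)" for g c
    proof -
      have "gen_act g (h c) = (\<Sum>k<d. \<Sum>j<d. (c k * ims g k j) *s v j)"
        by (simp add: h_def commutingD[OF gen_act_commuting] act scale_sum_right)
      also have "\<dots> = h (lin_ext d (ims g) c)"
        unfolding h_def lin_ext_def by (subst sum.swap) (simp add: scale_sum_left)
      finally show ?thesis .
    qed
    \<comment> \<open>The map h ignores coordinates from d on, so every value is attained on
      truncated coordinates.\<close>
    have trunc: "h c \<in> h ` ?C" for c
      by (rule image_eqI[of _ _ "\<lambda>j. if j < d then c j else 0"]) (auto simp: h_def)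
    have "h ` ?C = {0} \<or> h ` ?C = S"
    proof (rule simple)
      show "subspace (h ` ?C)"
        using trunc[of "\<lambda>_. 0"] by (intro subspaceI) (auto simp: h_def[of "\<lambda>_. 0"] trunc simp flip: h_add h_scale)
      show "h ` ?C \<subseteq> S"
        unfolding h_def using v(1) by (auto intro!: subspace_sum subspace_scale S)
      show "RX u \<in> h ` ?C \<and> RY u \<in> h ` ?C \<and> RZ u \<in> h ` ?C" if "u \<in> h ` ?C" for u
        using that hact[of GX] hact[of GY] hact[of GZ] trunc by (auto simp: gen_act_def)
    qed
    moreover have "h (bvec 1 0) = v 0" using d by (simp add: h_def sum_bvec)
    ultimately show ?thesis using v(2)[OF d] trunc[of "bvec 1 0"] by auto
  qed
  ultimately show ?thesis
    using act by (auto simp: is_basis_for_def bij_betw_def h_def[abs_def])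
qed

section \<open>The three families of simple modules\<close>

lemma powers_distinct:
  assumes "i < j" "j < l" "p ^ i = p ^ j" "q ^ i = q ^ j"
  shows False
proof -
  have "p ^ (j - i) = 1" "q ^ (j - i) = 1"
    using assms pq by (simp_all add: power_diff)
  then have "l dvd j - i" by (rule l_dvd)
  with assms(1,2) show False by (auto dest: dvd_imp_le)
qed

lemma RZ_eigen_nonzero: "v \<in> S \<Longrightarrow> v \<noteq> 0 \<Longrightarrow> RZ v = c *s v \<Longrightarrow> c \<noteq> 0"
  using Z_inj[of v] by auto

text \<open>The scalar is written as an l-th power so that rescaling the k-th vector by
  \<open>\<mu>\<close> to the power -k makes the l-th vector equal to the 0-th.\<close>

lemma central_root:
  assumes "commuting T" "\<And>w. w \<in> S \<Longrightarrow> T w \<in> S"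
    and "\<And>w. RX (T w) = T (RX w)" "\<And>w. RY (T w) = T (RY w)" "\<And>w. RZ (T w) = T (RZ w)"
    and inj: "\<And>w. w \<in> S \<Longrightarrow> T w = 0 \<Longrightarrow> w = 0"
  obtains \<mu> where "\<mu> \<noteq> 0" "\<And>w. w \<in> S \<Longrightarrow> T w = \<mu> ^ l *s w"
proof -
  obtain c where c: "\<And>w. w \<in> S \<Longrightarrow> T w = c *s w"
    using central_scalar[OF assms(1-5)] by blast
  obtain \<mu> where \<mu>: "\<mu> ^ l = c" using nth_root_exists[OF l(1)] by blast
  obtain w where "w \<in> S" "w \<noteq> 0" using S subspace_0 by blast
  with inj c have "c \<noteq> 0" by force
  with \<mu> l(1) have "\<mu> \<noteq> 0" by auto
  with that \<mu> c show ?thesis by blast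
qed

text \<open>The basis is the rescaled orbit under x of a joint eigenvector of z and theta.
  Injectivity of x keeps its vectors nonzero, and injectivity of z and theta makes lam and gamma
  nonzero.\<close>

theorem x_torsionfree_case:
  assumes RX_inj: "\<And>w. w \<in> S \<Longrightarrow> RX w = 0 \<Longrightarrow> w = 0" and \<Theta>_inj: "\<And>w. w \<in> S \<Longrightarrow> \<Theta> w = 0 \<Longrightarrow> w = 0"
  shows "\<exists>\<mu> lam \<gamma> v. \<mu> \<noteq> 0 \<and> lam \<noteq> 0 \<and> \<gamma> \<noteq> 0 \<and> is_basis_for l (V1_images p q l \<mu> lam \<gamma>) v"
proof -
  have Xn_inj: "w = 0" if "w \<in> S" "(RX ^^ n) w = 0" for n w
    using that(2)
  proof (induction n)
    case (Suc n)
    then show ?case using RX_inj[OF closed_funpow(1)[OF that(1), of n]] by simp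
  qed simp
  obtain \<mu> where \<mu>: "\<mu> \<noteq> 0" "\<And>w. w \<in> S \<Longrightarrow> (RX ^^ l) w = \<mu> ^ l *s w"
    by (rule central_root[OF commuting_funpow[OF RX] closed_funpow(1) _ _ _ Xn_inj, of l])
       (auto simp: powers_central powers_commute)
  obtain lam u where u: "u \<in> S" "u \<noteq> 0" "RZ u = lam *s u"
    using eigenvector[OF RZ S subset_refl] closed(3) by metis
  \<comment> \<open>theta commutes with z, so it acts on this eigenspace and has an eigenvector
    there.\<close>
  let ?V = "{w \<in> S. RZ w = lam *s w}"
  have "subspace ?V"
    using S(1) by (auto simp: subspace_def lin scale_right_distrib mult.commute)
  moreover have "?V \<noteq> {0}" using u by blast
  moreover have "\<Theta> w \<in> ?V" if "w \<in> ?V" for w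
    using that by (simp add: \<Theta>_closed \<Theta>_linear flip: \<Theta>_RZ)
  ultimately have "\<exists>c. \<exists>v\<in>?V. v \<noteq> 0 \<and> \<Theta> v = c *s v"
    by (intro eigenvector \<Theta>_commuting) auto
  then obtain \<gamma> w where w: "w \<in> ?V" "w \<noteq> 0" "\<Theta> w = \<gamma> *s w" by blast
  then have w': "w \<in> S" "RZ w = lam *s w" by auto
  have nz: "lam \<noteq> 0" "\<gamma> \<noteq> 0"
    using RZ_eigen_nonzero[OF w'(1) w(2) w'(2)] \<Theta>_inj[OF w'(1)] w(2,3) by auto
  define v where "v k = inverse \<mu> ^ k *s (RX ^^ k) w" for k
  have vS: "v k \<in> S" for k
    unfolding v_def by (intro subspace_scale S closed_funpow w')
  have v0: "v k \<noteq> 0" for k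
    using Xn_inj[OF w'(1), of k] w(2) \<mu>(1) by (auto simp: v_def)
  have vl: "v l = v 0"
    using \<mu> w' by (simp add: v_def flip: power_mult_distrib)
  have vX: "RX (v k) = \<mu> *s v (Suc k)" for k
    using \<mu>(1) by (simp add: v_def lin)
  have ZX: "RZ (RX u) = p *s RX (RZ u)" for u
    using pq by (simp add: XZ)
  have vZ: "RZ (v k) = (p ^ k * lam) *s v k" for k
  proof -
    have "RZ ((RX ^^ k) w) = (p ^ k * lam) *s (RX ^^ k) w"
      by (induction k) (simp_all add: w' ZX lin mult.assoc)
    then show ?thesis by (simp add: v_def lin mult.commute)
  qed
  have v\<Theta>: "\<Theta> (v k) = (inverse q ^ k * \<gamma>) *s v k" for k
  proof -
    have "\<Theta> ((RX ^^ k) w) = (inverse q ^ k * \<gamma>) *s (RX ^^ k) w"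
      by (induction k) (simp_all add: w \<Theta>_RX lin mult.assoc)
    then show ?thesis by (simp add: v_def \<Theta>_linear mult.commute)
  qed
  have ne: "p * q - 1 \<noteq> 0" "q - inverse p \<noteq> 0" using pq by (auto simp: field_simps)
  have vY: "RY (v (Suc k)) =
      (inverse \<mu> * inverse q ^ Suc k * ((p * q * \<gamma> - (p * q) ^ Suc k * lam) / (p * q - 1))) *s v k" for k
  proof -
    define A where "A = inverse q ^ k * \<gamma>"
    define B where "B = p ^ k * lam"
    define K where "K = (q - inverse p) * \<mu>"
    have K: "K \<noteq> 0" using ne \<mu>(1) by (simp add: K_def)
    \<comment> \<open>Solving theta = (q - 1/p) xy + z on v k, where x has already led to v (k+1),
      isolates the action of y.\<close>
    have "K *s RY (v (Suc k)) = \<Theta> (v k) - RZ (v k)"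
      by (simp add: \<Theta>_eq vX lin K_def)
    also have "\<dots> = (A - B) *s v k"
      by (simp add: v\<Theta> vZ A_def B_def scale_left_diff_distrib)
    finally have "inverse K *s (K *s RY (v (Suc k))) = inverse K *s ((A - B) *s v k)"
      by (rule arg_cong)
    then have "RY (v (Suc k)) = (inverse ((q - inverse p) * \<mu>) * (A - B)) *s v k"
      using K by (simp add: K_def[symmetric])
    moreover have "inverse ((q - inverse p) * \<mu>) * (A - B) =
        inverse \<mu> * inverse q ^ Suc k * ((p * q * \<gamma> - (p * q) ^ Suc k * lam) / (p * q - 1))"
    proof -
      have "inverse q ^ Suc k * (p * q * \<gamma> - (p * q) ^ Suc k * lam) = p * (A - B)"
        using pq by (simp add: A_def B_def power_mult_distrib power_inverse right_diff_distrib)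
          (simp add: field_simps)
      moreover have "inverse (q - inverse p) = p / (p * q - 1)"
        using pq ne by (simp add: field_simps)
      moreover have "inverse \<mu> * E * (M / D) = inverse \<mu> * (E * M) / D" for E M D :: 'k
        by simp
      ultimately show ?thesis by (simp only: inverse_mult_distrib) (simp add: mult_ac)
    qed
    ultimately show ?thesis by simp
  qed
  have "is_basis_for l (V1_images p q l \<mu> lam \<gamma>) v"
  proof (rule is_basis_forI[where a = "\<lambda>k. p ^ k * lam" and b = "\<lambda>k. inverse q ^ k * \<gamma>"])
    show "gen_act g (v k) = (\<Sum>j<l. V1_images p q l \<mu> lam \<gamma> g k j *s v j)" if k: "k < l" for g k
    proof (cases g)
      case GX
      show ?thesis
      proof (cases "k = l - 1")
        case True
        then have "Suc k = l" using k by simp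
        then show ?thesis using GX True l vX[of k] vl by (simp add: gen_act_def sum_bvec)
      next
        case False
        then have "Suc k < l" using k by simp
        then show ?thesis using GX False vX[of k] by (simp add: gen_act_def sum_bvec)
      qed
    next
      case GY
      show ?thesis
      proof (cases k)
        case 0
        \<comment> \<open>The general formula at index l, using v l = v 0 and that the l-th powers
          of q and pq are 1.\<close>
        have "RY (v 0) = (inverse \<mu> * ((p * q * \<gamma> - lam) / (p * q - 1))) *s v (l - 1)"
          using vY[of "l - 1"] l vl by (simp add: power_mult_distrib power_inverse del: power_Suc)
        then show ?thesis using GY 0 l by (simp add: gen_act_def sum_bvec)
      next
        case (Suc j)
        then show ?thesis using GY k vY[of j] by (simp add: gen_act_def sum_bvec del: power_Suc)
      qed
    qed (simp add: gen_act_def sum_bvec k vZ)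
    show False if "i < j" "j < l" "p ^ i * lam = p ^ j * lam" "inverse q ^ i * \<gamma> = inverse q ^ j * \<gamma>"
      for i j using powers_distinct[of i j] that nz by (simp add: power_inverse)
  qed (use l vS v0 vZ v\<Theta> in auto)
  with \<mu>(1) nz show ?thesis by blast
qed

text \<open>The last nonzero vector among the w x^i is killed by x. The kernel of x in S is stable
  under z because x and z commute up to a scalar, so it contains an eigenvector of z.\<close>

lemma x_torsion_eigenvector:
  assumes "w \<in> S" "w \<noteq> 0" "(RX ^^ i) w = 0"
  obtains lam v where "v \<in> S" "v \<noteq> 0" "RX v = 0" "RZ v = lam *s v" "lam \<noteq> 0"
proof -
  have "\<exists>u\<in>S. u \<noteq> 0 \<and> RX u = 0"
    using assms(3)
  proof (induction i)
    case (Suc i)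
    then show ?case using closed_funpow(1)[OF assms(1)] by (cases "(RX ^^ i) w = 0") auto
  qed (use assms in simp)
  let ?V = "{w \<in> S. RX w = 0}"
  have "subspace ?V" using S(1) by (auto simp: subspace_def lin)
  moreover have "?V \<noteq> {0}" using \<open>\<exists>u\<in>S. u \<noteq> 0 \<and> RX u = 0\<close> by blast
  moreover have "RZ w \<in> ?V" if "w \<in> ?V" for w using that by (simp add: closed XZ lin)
  ultimately have "\<exists>c. \<exists>v\<in>?V. v \<noteq> 0 \<and> RZ v = c *s v"
    by (intro eigenvector RZ) auto
  then obtain lam v where "v \<in> ?V" "v \<noteq> 0" "RZ v = lam *s v" by blast
  with RZ_eigen_nonzero that show ?thesis by blast
qed

text \<open>As x kills v, theta and z agree on v, so both have eigenvalue lam there. The last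
  formula is the rule for y^(k+1) x with its first term gone.\<close>

lemma lowest_weight_vector:
  assumes v: "RX v = 0" "RZ v = lam *s v"
  shows "RZ ((RY ^^ k) v) = (inverse p ^ k * lam) *s (RY ^^ k) v"
    and "\<Theta> ((RY ^^ k) v) = (q ^ k * lam) *s (RY ^^ k) v"
    and "RX ((RY ^^ Suc k) v) = (lam * pq_number p q (Suc k)) *s (RY ^^ k) v"
proof -
  have ZY: "RZ (RY u) = inverse p *s RY (RZ u)" for u
    using pq by (simp add: YZ)
  show "RZ ((RY ^^ k) v) = (inverse p ^ k * lam) *s (RY ^^ k) v"
    by (induction k) (simp_all add: v ZY lin mult.assoc)
  show "\<Theta> ((RY ^^ k) v) = (q ^ k * lam) *s (RY ^^ k) v"
    by (induction k) (simp_all add: v \<Theta>_RY \<Theta>_eq[of v] lin mult.assoc)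
  show "RX ((RY ^^ Suc k) v) = (lam * pq_number p q (Suc k)) *s (RY ^^ k) v"
    by (simp only: XYn v lin_funpow scale_zero_right scale_scale add_0_left mult.commute)
qed

text \<open>The orbit under y of a vector killed by x closes up after l steps, since y^l is a
  nonzero scalar. V2 has one parameter fewer than V1 because theta and z share their eigenvalue at
  the starting vector.\<close>

theorem x_torsion_y_torsionfree_case:
  assumes "w \<in> S" "w \<noteq> 0" "(RX ^^ i) w = 0" and RY_inj: "\<And>w. w \<in> S \<Longrightarrow> RY w = 0 \<Longrightarrow> w = 0"
  shows "\<exists>\<mu> lam v. \<mu> \<noteq> 0 \<and> lam \<noteq> 0 \<and> is_basis_for l (V2_images p q l \<mu> lam) v"
proof -
  have Yn_inj: "w = 0" if "w \<in> S" "(RY ^^ n) w = 0" for n w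
    using that(2)
  proof (induction n)
    case (Suc n)
    then show ?case using RY_inj[OF closed_funpow(2)[OF that(1), of n]] by simp
  qed simp
  obtain \<mu> where \<mu>: "\<mu> \<noteq> 0" "\<And>w. w \<in> S \<Longrightarrow> (RY ^^ l) w = \<mu> ^ l *s w"
    by (rule central_root[OF commuting_funpow[OF RY] closed_funpow(2) _ _ _ Yn_inj, of l])
       (auto simp: powers_central powers_commute)
  obtain lam u where u: "u \<in> S" "u \<noteq> 0" "RX u = 0" "RZ u = lam *s u" "lam \<noteq> 0"
    using x_torsion_eigenvector[OF assms(1-3)] by blast
  note low = lowest_weight_vector[OF u(3,4)]
  define v where "v k = inverse \<mu> ^ k *s (RY ^^ k) u" for k
  have vS: "v k \<in> S" for k
    unfolding v_def by (intro subspace_scale S closed_funpow u)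
  have v0: "v k \<noteq> 0" for k
    using Yn_inj[OF u(1), of k] u(2) \<mu>(1) by (auto simp: v_def)
  have vl: "v l = v 0"
    using \<mu> u by (simp add: v_def flip: power_mult_distrib)
  have vY: "RY (v k) = \<mu> *s v (Suc k)" for k
    using \<mu>(1) by (simp add: v_def lin)
  have vZ: "RZ (v k) = (inverse p ^ k * lam) *s v k" for k
    by (simp add: v_def lin low mult.commute)
  have v\<Theta>: "\<Theta> (v k) = (q ^ k * lam) *s v k" for k
    by (simp add: v_def \<Theta>_linear low mult.commute)
  have vX: "RX (v (Suc k)) = (inverse \<mu> * lam * pq_number p q (Suc k)) *s v k" for k
    unfolding v_def lin low by (simp add: mult_ac)
  have "is_basis_for l (V2_images p q l \<mu> lam) v"
  proof (rule is_basis_forI[where a = "\<lambda>k. inverse p ^ k * lam" and b = "\<lambda>k. q ^ k * lam"])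
    show "gen_act g (v k) = (\<Sum>j<l. V2_images p q l \<mu> lam g k j *s v j)" if k: "k < l" for g k
    proof (cases g)
      case GY
      show ?thesis
      proof (cases "k = l - 1")
        case True
        then have "Suc k = l" using k by simp
        then show ?thesis using GY True l vY[of k] vl by (simp add: gen_act_def sum_bvec)
      next
        case False
        then have "Suc k < l" using k by simp
        then show ?thesis using GY False vY[of k] by (simp add: gen_act_def sum_bvec)
      qed
    next
      case GX
      then show ?thesis
        using k vX u(3) by (cases k) (simp_all add: gen_act_def sum_bvec v_def[of 0])
    qed (simp add: gen_act_def sum_bvec k vZ)
    show False if "i < j" "j < l" "inverse p ^ i * lam = inverse p ^ j * lam" "q ^ i * lam = q ^ j * lam"
      for i j using powers_distinct[of i j] that u(5) by (simp add: power_inverse)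
  qed (use l vS v0 vZ v\<Theta> in auto)
  with \<mu>(1) u(5) show ?thesis by blast
qed

text \<open>Let d be least with v y^d = 0. Applying x to v y^d gives [d] = 0, so (pq)^d = 1 and
  ord(pq) is at most d. Conversely [N] = 0 for N = ord(pq), so the vectors v y^k with k at least N
  span a submodule; were it nonzero, it would contain v, contradicting nilpotency of y on v.\<close>

theorem x_torsion_y_torsion_case:
  assumes "w \<in> S" "w \<noteq> 0" "(RX ^^ i) w = 0" and tors: "\<And>w. w \<in> S \<Longrightarrow> \<exists>j. (RY ^^ j) w = 0"
  shows "\<exists>lam v. lam \<noteq> 0 \<and> is_basis_for (mult_order (p * q)) (V3_images p q lam) v"
proof -
  let ?N = "mult_order (p * q)"
  have "(p * q) ^ l = 1" using l by (simp add: power_mult_distrib)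
  note N = mult_order_props[OF l(1) this]
  have N_le: "?N \<le> k" if "0 < k" "(p * q) ^ k = 1" for k
    using that unfolding mult_order_def by (intro Least_le) simp
  obtain lam v where v: "v \<in> S" "v \<noteq> 0" "RX v = 0" "RZ v = lam *s v" "lam \<noteq> 0"
    using x_torsion_eigenvector[OF assms(1-3)] by blast
  note low = lowest_weight_vector[OF v(3,4)]
  define d where "d = (LEAST j. (RY ^^ j) v = 0)"
  have d0: "(RY ^^ d) v = 0" unfolding d_def using tors[OF v(1)] by (rule LeastI_ex)
  have d_min: "(RY ^^ k) v \<noteq> 0" if "k < d" for k
    using not_less_Least that unfolding d_def by blast
  obtain d' where d': "d = Suc d'" using d0 v(2) by (cases d) auto
  have "(lam * pq_number p q d) *s (RY ^^ d') v = 0"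
    using low(3)[of d'] d0 d' by (simp add: lin del: funpow.simps)
  then have "pq_number p q d = 0" using d_min[of d'] v(5) d' by auto
  then have "q ^ d = inverse p ^ d" using pq by (auto simp: pq_number_def field_simps)
  then have "(p * q) ^ d = 1" using pq by (simp add: power_mult_distrib power_inverse)
  then have Nd: "?N \<le> d" using N_le d' by blast
  obtain N' where N': "?N = Suc N'" using N(1) gr0_implies_Suc by blast
  have "(RY ^^ ?N) v = 0"
  proof (rule ccontr)
    assume nz: "(RY ^^ ?N) v \<noteq> 0"
    \<comment> \<open>Stability under x could fail only at k = N, where the vector v y^(N-1) outside
      the spanning family appears with coefficient lam [N] = 0.\<close>
    let ?V = "span ((\<lambda>k. (RY ^^ k) v) ` {?N..})"
    have ind: "D u \<in> ?V" if "commuting D" "\<And>k. ?N \<le> k \<Longrightarrow> D ((RY ^^ k) v) \<in> ?V" "u \<in> ?V" for D u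
      using that(3)
    proof (induction rule: span_induct_alt)
      case base
      show ?case by (simp add: commutingD(3)[OF that(1)] span_zero)
    next
      case (step c x y)
      then show ?case
        using that(2) by (auto simp: commutingD[OF that(1)] intro!: span_add span_scale)
    qed
    have base: "(RY ^^ k) v \<in> ?V" if "?N \<le> k" for k
      using that by (intro span_base) auto
    have "?V = {0} \<or> ?V = S"
    proof (rule simple)
      show "?V \<subseteq> S" using closed_funpow(2)[OF v(1)] by (intro span_minimal S) auto
      show "RX u \<in> ?V \<and> RY u \<in> ?V \<and> RZ u \<in> ?V" if "u \<in> ?V" for u
      proof -
        have VY: "RY ((RY ^^ k) v) \<in> ?V" if "?N \<le> k" for k
          using base[of "Suc k"] that by simp
        have VZ: "RZ ((RY ^^ k) v) \<in> ?V" if "?N \<le> k" for k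
          unfolding low by (intro span_scale base that)
        have VX: "RX ((RY ^^ k) v) \<in> ?V" if k: "?N \<le> k" for k
        proof (cases "k = ?N")
          case True
          have "pq_number p q ?N = 0" using pq N by (intro pq_number_eq_0)
          then show ?thesis
            using low(3)[of N'] by (simp add: True N' span_zero del: funpow.simps)
        next
          case False
          with k obtain k' where "k = Suc k'" "?N \<le> k'" by (cases k) auto
          then show ?thesis using low(3)[of k'] by (simp add: span_scale base del: funpow.simps)
        qed
        show ?thesis
          using ind[OF RX VX that] ind[OF RY VY that] ind[OF RZ VZ that] by blast
      qed
    qed simp
    moreover have "?V \<noteq> {0}" using base[of ?N] nz by auto
    ultimately have "v \<in> ?V" using v(1) by blast
    then have "(RY ^^ d') v = 0"
    proof (induction rule: span_induct_alt)
      case (step c x y)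
      then obtain k where k: "?N \<le> k" "x = (RY ^^ k) v" by auto
      \<comment> \<open>Since k is at least 1, d - 1 further factors y reach exponent d: y^(d-1)
        kills the span, but not v.\<close>
      have "d' + k = (k - 1) + d" using k N(1) by (simp add: d')
      then have "(RY ^^ d') x = (RY ^^ (k - 1)) ((RY ^^ d) v)"
        using k by (metis comp_apply funpow_add)
      then have "(RY ^^ d') x = 0" by (simp add: d0 lin_funpow)
      with step show ?case by (simp add: lin_funpow)
    qed (simp add: lin_funpow)
    then show False using d_min[of d'] d' by simp
  qed
  then have dN: "d = ?N" using Nd d_min[of ?N] by (cases "?N < d") auto
  have "is_basis_for ?N (V3_images p q lam) (\<lambda>k. (RY ^^ k) v)"
  proof (rule is_basis_forI[where a = "\<lambda>k. inverse p ^ k * lam" and b = "\<lambda>k. q ^ k * lam"])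
    show "gen_act g ((RY ^^ k) v) = (\<Sum>j<?N. V3_images p q lam g k j *s (RY ^^ j) v)" if k: "k < ?N" for g k
    proof (cases g)
      case GY
      show ?thesis
      proof (cases "k = ?N - 1")
        case True
        then have "Suc k = ?N" using k by simp
        then have "RY ((RY ^^ k) v) = 0" using d0 dN by (metis comp_apply funpow.simps(2))
        then show ?thesis using GY True by (simp add: gen_act_def)
      next
        case False
        then have "Suc k < ?N" using k by simp
        then show ?thesis using GY False by (simp add: gen_act_def sum_bvec)
      qed
    next
      case GX
      show ?thesis
      proof (cases k)
        case 0
        then show ?thesis using GX v(3) by (simp add: gen_act_def)
      next
        case (Suc j)
        then show ?thesis using GX k low(3)[of j]
          by (simp add: gen_act_def sum_bvec del: funpow.simps)
      qed
    qed (simp add: gen_act_def sum_bvec k low)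
    show False if ij: "i < j" "j < ?N" "inverse p ^ i * lam = inverse p ^ j * lam" "q ^ i * lam = q ^ j * lam"
      for i j
    proof -
      have "p ^ i = p ^ j" "q ^ i = q ^ j" using ij v(5) by (simp_all add: power_inverse)
      then have "(p * q) ^ (j - i) = 1" using ij(1) pq by (simp add: power_mult_distrib power_diff)
      from N_le[OF _ this] ij(1,2) show False by simp
    qed
  qed (use N(1) dN d_min low closed_funpow(2)[OF v(1)] in auto)
  with v(5) show ?thesis by blast
qed

end

section \<open>Passing from modules to operators\<close>

definition fscale :: "'k::field \<Rightarrow> 'k free_alg \<Rightarrow> 'k free_alg" where
  "fscale c f = fconst c * f"

lemma fscale_single: "fscale c (Poly_Mapping.single w a) = Poly_Mapping.single w (c * a)"
  by (simp add: fscale_def fconst_def mult_single)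

lemma fconst_commute: "fconst c * f = f * fconst c"
proof -
  have "fconst c * Poly_Mapping.single w a = Poly_Mapping.single w a * fconst c" for w a
    by (simp add: fconst_def mult_single mult.commute)
  then show ?thesis
    by (subst (1 2) poly_mapping_sum_singles) (simp add: sum_distrib_left sum_distrib_right)
qed

lemma fscale_mult: "fscale c f * g = fscale c (f * g)" "f * fscale c g = fscale c (f * g)"
  by (simp_all add: fscale_def mult.assoc) (metis fconst_commute mult.assoc)

lemma vector_space_fscale: "Vector_Spaces.vector_space fscale"
proof
  show "fscale (a + b) f = fscale a f + fscale b f" for a b :: 'a and f
    by (simp add: fscale_def fconst_def single_add distrib_right)
  show "fscale a (fscale b f) = fscale (a * b) f" for a b :: 'a and f
    by (simp add: fscale_def fconst_def mult_single flip: mult.assoc)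
  show "fscale 1 f = f" for f :: "'a free_alg"
    by (simp add: fscale_def fconst_def single_one)
qed (simp add: fscale_def distrib_left)

text \<open>A linear retraction g onto I exists, being a left inverse of the inclusion; the
  projection along I is u - g u.\<close>

lemma (in Vector_Spaces.vector_space) complement_projection:
  assumes I: "subspace I"
  obtains \<pi> where "\<And>u w. \<pi> (u + w) = \<pi> u + \<pi> w" "\<And>c u. \<pi> (scale c u) = scale c (\<pi> u)"
    "\<And>u. \<pi> u = 0 \<longleftrightarrow> u \<in> I" "\<And>u. \<pi> (\<pi> u) = \<pi> u"
proof -
  interpret vector_space_pair scale scale by unfold_locales
  obtain g where g: "range g \<subseteq> I" "Vector_Spaces.linear scale scale g" "\<forall>v\<in>I. g v = v"
    using linear_exists_left_inverse_on[OF local.linear_id I] by auto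
  interpret g: Vector_Spaces.linear scale scale g by (rule g(2))
  show ?thesis
  proof (rule that[of "\<lambda>u. u - g u"])
    show "u - g u = 0 \<longleftrightarrow> u \<in> I" for u using g(1,3) by auto
    show "u - g u - g (u - g u) = u - g u" for u
      using g(1,3) by (simp add: g.diff image_subset_iff)
  qed (simp_all add: g.add g.scale scale_right_diff_distrib)
qed

lemma hclass_ideal: "r \<in> rel_ideal p q \<Longrightarrow> hclass p q r = hclass p q 0"
proof -
  interpret F: ring "ring_of_type_algebra :: 'a free_alg ring" by (rule ring_of_type_ring)
  interpret I: ideal "rel_ideal p q" "ring_of_type_algebra" by (rule rel_ideal_ideal)
  have "hclass p q r = rel_ideal p q" if "r \<in> rel_ideal p q" for r
    unfolding hclass_def using that by (intro F.a_coset_join2 I.a_subgroup) simp_all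
  moreover have "0 \<in> rel_ideal p q" using I.zero_closed by simp
  ultimately show "r \<in> rel_ideal p q \<Longrightarrow> hclass p q r = hclass p q 0" by simp
qed

lemma hclass_power: "hclass p q a [^]\<^bsub>hpq p q\<^esub> (i::nat) = hclass p q (a ^ i)"
proof -
  interpret ring "hpq p q" by (rule hpq_ring)
  show ?thesis by (induction i) (simp_all add: hpq_one hpq_mult power_commutes)
qed

lemma hclass_minus: "hclass p q f \<ominus>\<^bsub>hpq p q\<^esub> hclass p q g = hclass p q (f - g)"
proof -
  interpret ring "hpq p q" by (rule hpq_ring)
  have c: "hclass p q f \<in> carrier (hpq p q)" for f by (simp add: carrier_hpq)
  have "hclass p q 0 \<oplus>\<^bsub>hpq p q\<^esub> hclass p q 0 = hclass p q 0" by (simp add: hpq_add)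
  then have "hclass p q 0 = \<zero>\<^bsub>hpq p q\<^esub>" using c by (metis add.r_cancel_one')
  then have "\<ominus>\<^bsub>hpq p q\<^esub> hclass p q g = hclass p q (- g)"
    by (intro minus_equality) (simp_all add: hpq_add c)
  then show ?thesis by (simp add: a_minus_def hpq_add)
qed

section \<open>A simple module as a quotient of the free algebra\<close>

locale hpq_simple_module =
  fixes p q :: "'k::alg_closed_field" and N :: "('k free_alg set, 'v) rmodule" and w0 :: 'v
  assumes simple_module: "simple_right_module (hpq p q) N"
    and w0: "w0 \<in> carrier N" "w0 \<noteq> \<zero>\<^bsub>N\<^esub>"
begin

sublocale right_module "hpq p q" N
  using simple_module by (simp add: simple_right_module_def)

sublocale fs: Vector_Spaces.vector_space fscale
  by (rule vector_space_fscale)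

lemma hclass_carrier [simp]: "hclass p q f \<in> carrier (hpq p q)"
  by (simp add: carrier_hpq)

definition \<psi> :: "'k free_alg \<Rightarrow> 'v" where
  "\<psi> f = w0 \<triangleleft>\<^bsub>N\<^esub> hclass p q f"

lemma \<psi>_closed [simp]: "\<psi> f \<in> carrier N"
  by (simp add: \<psi>_def ract_closed w0)

lemma \<psi>_add: "\<psi> (f + g) = \<psi> f \<oplus>\<^bsub>N\<^esub> \<psi> g"
  by (simp add: \<psi>_def ract_add_right w0 flip: hpq_add)

lemma \<psi>_mult: "\<psi> (f * g) = \<psi> f \<triangleleft>\<^bsub>N\<^esub> hclass p q g"
  by (simp add: \<psi>_def ract_mult w0 flip: hpq_mult)

lemma \<psi>_zero: "\<psi> 0 = \<zero>\<^bsub>N\<^esub>"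
  using \<psi>_add[of 0 0] by (metis M.add.r_cancel_one' \<psi>_closed add_0_left)

lemma \<psi>_one: "\<psi> 1 = w0"
  using ract_one[OF w0(1)] by (simp add: \<psi>_def hpq_one)

lemma \<psi>_minus: "\<psi> (- f) = \<ominus>\<^bsub>N\<^esub> \<psi> f"
  using \<psi>_add[of "- f" f] by (intro M.minus_equality[symmetric]) (simp_all add: \<psi>_zero)

lemma \<psi>_eq_iff: "\<psi> f = \<psi> g \<longleftrightarrow> \<psi> (f - g) = \<zero>\<^bsub>N\<^esub>"
proof -
  have "\<psi> (f - g) = \<psi> f \<oplus>\<^bsub>N\<^esub> \<ominus>\<^bsub>N\<^esub> \<psi> g"
    using \<psi>_add[of f "- g"] by (simp add: \<psi>_minus)
  then show ?thesis
    using M.minus_equality[of "\<psi> f" "\<ominus>\<^bsub>N\<^esub> \<psi> g"] M.r_neg[of "\<psi> g"] by auto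
qed

lemma zero_ract: "\<zero>\<^bsub>N\<^esub> \<triangleleft>\<^bsub>N\<^esub> hclass p q f = \<zero>\<^bsub>N\<^esub>"
  using \<psi>_mult[of 0 f] by (simp add: \<psi>_zero)

lemma \<psi>_relator: "r \<in> relators p q \<Longrightarrow> \<psi> (f * r) = \<zero>\<^bsub>N\<^esub>"
proof -
  assume "r \<in> relators p q"
  then have "r \<in> rel_ideal p q"
    using ring.genideal_self[OF ring_of_type_ring, of "relators p q"] by (auto simp: rel_ideal_def)
  then have "\<psi> (f * r) = \<psi> (f * 0)" by (simp only: \<psi>_mult hclass_ideal)
  then show ?thesis by (simp add: \<psi>_zero)
qed

text \<open>V need not be a right ideal of the free algebra; stability modulo the kernel of
  \<open>\<psi>\<close> suffices, which is what a complement of that kernel can offer.\<close>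

lemma submodule_image:
  assumes V: "fs.subspace V" and act: "\<And>u f. u \<in> V \<Longrightarrow> \<exists>u'\<in>V. \<psi> (u * f) = \<psi> u'"
  shows "\<psi> ` V = {\<zero>\<^bsub>N\<^esub>} \<or> \<psi> ` V = carrier N"
proof -
  have "subgroup (\<psi> ` V) (add_monoid N)"
  proof (rule M.add.subgroupI)
    show "\<psi> ` V \<noteq> {}" using fs.subspace_0[OF V] by blast
    show "\<ominus>\<^bsub>N\<^esub> a \<in> \<psi> ` V" if "a \<in> \<psi> ` V" for a
      using that fs.subspace_neg[OF V] by (auto simp flip: \<psi>_minus)
    show "a \<oplus>\<^bsub>N\<^esub> b \<in> \<psi> ` V" if "a \<in> \<psi> ` V" "b \<in> \<psi> ` V" for a b
      using that fs.subspace_add[OF V] by (auto simp flip: \<psi>_add)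
  qed auto
  moreover have "w \<triangleleft>\<^bsub>N\<^esub> a \<in> \<psi> ` V" if "w \<in> \<psi> ` V" "a \<in> carrier (hpq p q)" for w a
    using that act by (fastforce simp: carrier_hpq simp flip: \<psi>_mult)
  ultimately have "right_submodule (hpq p q) N (\<psi> ` V)"
    by (simp add: right_submodule_def)
  then show ?thesis using simple_module by (auto simp: simple_right_module_def)
qed

lemma \<psi>_surj: "range \<psi> = carrier N"
proof -
  have "range \<psi> = {\<zero>\<^bsub>N\<^esub>} \<or> range \<psi> = carrier N"
    by (rule submodule_image) (auto simp: fs.subspace_UNIV)
  then show ?thesis using \<psi>_one w0(2) by (metis rangeI singletonD)
qed

lemma kernel_subspace: "fs.subspace {f. \<psi> f = \<zero>\<^bsub>N\<^esub>}"
proof (rule fs.subspaceI)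
  show "fscale c f \<in> {f. \<psi> f = \<zero>\<^bsub>N\<^esub>}" if "f \<in> {f. \<psi> f = \<zero>\<^bsub>N\<^esub>}" for c f
    using that \<psi>_mult[of f "fconst c"] by (simp add: fscale_def fconst_commute zero_ract)
qed (auto simp: \<psi>_zero \<psi>_add)

end

section \<open>The model of the module on a complement of the kernel\<close>

locale hpq_module_projection = hpq_simple_module p q N w0
  for p q :: "'k::alg_closed_field" and N :: "('k free_alg set, 'v) rmodule" and w0 +
  fixes \<pi> :: "'k free_alg \<Rightarrow> 'k free_alg"
  assumes \<pi>_add: "\<pi> (u + w) = \<pi> u + \<pi> w" and \<pi>_scale: "\<pi> (fscale c u) = fscale c (\<pi> u)"
    and \<pi>_ker: "\<pi> u = 0 \<longleftrightarrow> \<psi> u = \<zero>\<^bsub>N\<^esub>" and \<pi>_idem: "\<pi> (\<pi> u) = \<pi> u"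
begin

lemma \<pi>_diff: "\<pi> (u - w) = \<pi> u - \<pi> w"
  using \<pi>_add[of "u - w" w] by (simp add: algebra_simps)

lemma \<pi>_zero: "\<pi> 0 = 0"
  using \<pi>_diff[of 0 0] by simp

lemma \<pi>_sum: "\<pi> (sum f I) = (\<Sum>i\<in>I. \<pi> (f i))"
  by (induction I rule: infinite_finite_induct) (simp_all add: \<pi>_zero \<pi>_add)

lemma \<pi>_eq_iff: "\<pi> u = \<pi> w \<longleftrightarrow> \<psi> u = \<psi> w"
  using \<pi>_ker[of "u - w"] by (simp add: \<pi>_diff \<psi>_eq_iff)

lemma \<psi>_\<pi>: "\<psi> (\<pi> u) = \<psi> u"
  using \<pi>_eq_iff[of "\<pi> u" u] by (simp add: \<pi>_idem)

text \<open>The kernel of the projection is a right ideal, so projecting before a right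
  multiplication changes nothing. Hence \<open>right_mult\<close> turns products into
  compositions.\<close>

lemma \<pi>_mult: "\<pi> (\<pi> u * f) = \<pi> (u * f)"
  by (simp add: \<pi>_eq_iff \<psi>_mult \<psi>_\<pi>)

lemma \<pi>_range: "u \<in> range \<pi> \<Longrightarrow> \<pi> u = u"
  using \<pi>_idem by auto

lemma \<pi>_word:
  assumes "\<And>u g. u \<in> V \<Longrightarrow> \<pi> (u * fgen g) \<in> V" "u \<in> V" "\<pi> u \<in> V"
  shows "\<pi> (u * Poly_Mapping.single (Word gs) 1) \<in> V"
  using assms(2,3)
proof (induction gs arbitrary: u)
  case Nil
  have "Poly_Mapping.single (Word []) 1 = (1 :: 'k free_alg)"
    by (simp add: zero_gword_def flip: single_one)
  with Nil show ?case by simp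
next
  case (Cons g gs)
  have "Poly_Mapping.single (Word (g # gs)) 1 = fgen g * (Poly_Mapping.single (Word gs) 1 :: 'k free_alg)"
    by (simp add: fgen_def mult_single plus_gword_def)
  then have "\<pi> (u * Poly_Mapping.single (Word (g # gs)) 1) =
      \<pi> (\<pi> (u * fgen g) * Poly_Mapping.single (Word gs) 1)"
    by (simp add: \<pi>_mult mult.assoc)
  then show ?case using Cons.IH[of "\<pi> (u * fgen g)"] assms(1)[OF Cons.prems(1)]
    by (simp add: \<pi>_idem)
qed

lemma \<pi>_expansion:
  "\<pi> (u * f) = (\<Sum>w\<in>Poly_Mapping.keys f. fscale (Poly_Mapping.lookup f w) (\<pi> (u * Poly_Mapping.single w 1)))"
proof -
  have "f = (\<Sum>w\<in>Poly_Mapping.keys f. fscale (Poly_Mapping.lookup f w) (Poly_Mapping.single w 1))"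
    by (subst poly_mapping_sum_singles) (simp add: fscale_single)
  then have "\<pi> (u * f) = \<pi> (u * (\<Sum>w\<in>Poly_Mapping.keys f. fscale (Poly_Mapping.lookup f w) (Poly_Mapping.single w 1)))"
    by simp
  then show ?thesis
    by (simp add: sum_distrib_left \<pi>_sum fscale_mult \<pi>_scale)
qed

lemma \<pi>_relator: "r \<in> relators p q \<Longrightarrow> \<pi> (u * r) = 0"
  by (simp add: \<pi>_ker \<psi>_relator)

definition right_mult :: "'k free_alg \<Rightarrow> 'k free_alg \<Rightarrow> 'k free_alg" where
  "right_mult f u = \<pi> (u * f)"

text \<open>Stability under the generators extends to words letter by letter and then by linearity
  to the free algebra, so V corresponds to a submodule of N.\<close>

lemma simple_range:
  assumes V: "fs.subspace V" "V \<subseteq> range \<pi>" "\<And>u g. u \<in> V \<Longrightarrow> right_mult (fgen g) u \<in> V"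
  shows "V = {0} \<or> V = range \<pi>"
proof -
  have fixed: "\<pi> u = u" if "u \<in> V" for u using V(2) that \<pi>_range by blast
  have stable: "\<pi> (u * f) \<in> V" if u: "u \<in> V" for u f
    unfolding \<pi>_expansion[of u f]
  proof (intro fs.subspace_sum fs.subspace_scale V(1))
    fix w :: gword
    show "\<pi> (u * Poly_Mapping.single w 1) \<in> V"
      using \<pi>_word[of V u "letters w"] V(3) u by (simp add: fixed right_mult_def)
  qed
  have "\<psi> ` V = {\<zero>\<^bsub>N\<^esub>} \<or> \<psi> ` V = carrier N"
  proof (rule submodule_image[OF V(1)])
    show "\<exists>u'\<in>V. \<psi> (u * f) = \<psi> u'" if "u \<in> V" for u f
      using stable[OF that, of f] by (intro bexI[of _ "\<pi> (u * f)"]) (simp_all add: \<psi>_\<pi>)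
  qed
  then show ?thesis
  proof
    assume "\<psi> ` V = {\<zero>\<^bsub>N\<^esub>}"
    then have "u = 0" if "u \<in> V" for u using \<pi>_ker[of u] fixed[OF that] that by auto
    then show ?thesis using fs.subspace_0[OF V(1)] by auto
  next
    assume img: "\<psi> ` V = carrier N"
    have "\<pi> u \<in> V" for u
    proof -
      obtain v where "v \<in> V" "\<psi> u = \<psi> v" using img \<psi>_closed[of u] by (metis imageE)
      then show ?thesis using \<pi>_eq_iff[of u v] fixed by simp
    qed
    then show ?thesis using V(2) by auto
  qed
qed

lemma right_mult_power: "u \<in> range \<pi> \<Longrightarrow> (right_mult f ^^ i) u = \<pi> (u * f ^ i)"
proof (induction i)
  case 0
  then show ?case using \<pi>_range[of u] by simp
next
  case (Suc i)
  have "(right_mult f ^^ Suc i) u = right_mult f (\<pi> (u * f ^ i))"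
    using Suc by simp
  also have "\<dots> = \<pi> (u * (f ^ i * f))"
    by (simp add: right_mult_def \<pi>_mult mult.assoc)
  finally have "(right_mult f ^^ Suc i) u = \<pi> (u * (f ^ i * f))" .
  then show ?case by (simp only: power_Suc2)
qed

lemma torsionfree_imp:
  assumes "torsionfree (hpq p q) N (hclass p q f)" "u \<in> range \<pi>" "\<pi> (u * f) = 0"
  shows "u = 0"
proof -
  have "\<psi> u \<triangleleft>\<^bsub>N\<^esub> (hclass p q f [^]\<^bsub>hpq p q\<^esub> (1::nat)) = \<zero>\<^bsub>N\<^esub>"
    using assms(3) by (simp only: hclass_power power_one_right \<pi>_ker \<psi>_mult)
  then have "\<psi> u = \<zero>\<^bsub>N\<^esub>"
    by (rule assms(1)[unfolded torsionfree_def, rule_format, OF \<psi>_closed])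
  then show ?thesis using \<pi>_ker[of u] \<pi>_range[OF assms(2)] by simp
qed

lemma torsion_imp:
  assumes "torsion (hpq p q) N (hclass p q f)" "u \<in> range \<pi>"
  shows "\<exists>i. (right_mult f ^^ i) u = 0"
proof -
  obtain i :: nat where "\<psi> u \<triangleleft>\<^bsub>N\<^esub> (hclass p q f [^]\<^bsub>hpq p q\<^esub> i) = \<zero>\<^bsub>N\<^esub>"
    using assms(1)[unfolded torsion_def, rule_format, OF \<psi>_closed] by blast
  then show ?thesis
    using right_mult_power[OF assms(2)] by (auto simp: hclass_power \<pi>_ker \<psi>_mult)
qed

lemma simple_hmodule_range:
  assumes pq: "p \<noteq> 0" "q \<noteq> 0" "p * q \<noteq> 1"
    and l: "0 < l" "p ^ l = 1" "q ^ l = 1" "\<And>i. p ^ i = 1 \<Longrightarrow> q ^ i = 1 \<Longrightarrow> l dvd i"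
    and tf: "torsionfree (hpq p q) N (hz p q)"
  shows "simple_hmodule fscale p q (right_mult (fgen GX)) (right_mult (fgen GY)) (right_mult (fgen GZ))
    (range \<pi>) l"
proof -
  have relator: "\<pi> (u * a) = \<pi> (u * b)" if "a - b \<in> relators p q" for u a b
    using \<pi>_relator[OF that, of u] by (simp add: right_diff_distrib \<pi>_diff)
  have 1: "\<pi> (u * (fgen GZ * fgen GX)) = fscale (inverse p) (\<pi> (u * (fgen GX * fgen GZ)))"
    and 2: "\<pi> (u * (fgen GZ * fgen GY)) = fscale p (\<pi> (u * (fgen GY * fgen GZ)))"
    and 3: "\<pi> (u * (fgen GY * fgen GX)) = fscale q (\<pi> (u * (fgen GX * fgen GY))) + \<pi> (u * fgen GZ)" for u
    using relator[of "fgen GZ * fgen GX" "fscale (inverse p) (fgen GX * fgen GZ)" u]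
      relator[of "fgen GZ * fgen GY" "fscale p (fgen GY * fgen GZ)" u]
      relator[of "fgen GY * fgen GX" "fscale q (fgen GX * fgen GY) + fgen GZ" u]
    by (simp_all add: relators_def diff_diff_add fscale_mult \<pi>_scale distrib_left \<pi>_add flip: fscale_def)
  interpret ring_action fscale by (rule fs.ring_action)
  have comm: "commuting (right_mult f)" for f
    by (simp add: commuting_def right_mult_def distrib_right \<pi>_add fscale_mult \<pi>_scale)
  have mm: "right_mult g (right_mult f u) = \<pi> (u * (f * g))" for f g u
    by (simp add: right_mult_def \<pi>_mult mult.assoc)
  show ?thesis
  proof (intro simple_hmodule.intro simple_hmodule_axioms.intro fs.ring_action fs.vector_space_axioms comm pq l)
    show "right_mult (fgen GX) (right_mult (fgen GZ) w) =
        fscale (inverse p) (right_mult (fgen GZ) (right_mult (fgen GX) w))" for w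
      unfolding mm by (rule 1)
    show "right_mult (fgen GY) (right_mult (fgen GZ) w) =
        fscale p (right_mult (fgen GZ) (right_mult (fgen GY) w))" for w
      unfolding mm by (rule 2)
    show "right_mult (fgen GX) (right_mult (fgen GY) w) =
        fscale q (right_mult (fgen GY) (right_mult (fgen GX) w)) + right_mult (fgen GZ) w" for w
      unfolding mm by (simp add: right_mult_def 3)
    show "fs.subspace (range \<pi>)"
      by (rule fs.subspaceI) (auto simp flip: \<pi>_add \<pi>_scale intro: range_eqI[of _ _ 0] simp: \<pi>_zero)
    have "\<pi> 1 \<noteq> 0" using w0(2) by (simp add: \<pi>_ker \<psi>_one)
    then show "range \<pi> \<noteq> {0}" by auto
    show "V = {0} \<or> V = range \<pi>" if "fs.subspace V" "V \<subseteq> range \<pi>"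
      "\<And>w. w \<in> V \<Longrightarrow> right_mult (fgen GX) w \<in> V \<and> right_mult (fgen GY) w \<in> V \<and> right_mult (fgen GZ) w \<in> V"
      for V
    proof (rule simple_range[OF that(1,2)])
      show "right_mult (fgen g) u \<in> V" if "u \<in> V" for u g
        using \<open>\<And>w. w \<in> V \<Longrightarrow> _\<close>[OF that] by (cases g) auto
    qed
    show "w = 0" if "w \<in> range \<pi>" "right_mult (fgen GZ) w = 0" for w
      using torsionfree_imp[OF _ that(1), of "fgen GZ"] tf that(2) by (simp add: hz_def right_mult_def)
  qed (auto simp: right_mult_def)
qed

text \<open>The coordinate map h intertwines the formal action on coordinates with right
  multiplication. Composed with \<open>\<psi>\<close> it is an isomorphism from the basis module
  onto N, which is then inverted.\<close>

lemma basis_imp_iso: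
  assumes supp: "\<And>g k j. k < d \<Longrightarrow> d \<le> j \<Longrightarrow> ims g k j = 0"
    and act: "\<And>g k. k < d \<Longrightarrow> right_mult (fgen g) (v k) = (\<Sum>j<d. fscale (ims g k j) (v j))"
    and bij: "bij_betw (\<lambda>c. \<Sum>j<d. fscale (c j) (v j)) {c. \<forall>k\<ge>d. c k = 0} (range \<pi>)"
  shows "right_module_iso (hpq p q) N (basis_module d ims)"
proof -
  let ?C = "{c. \<forall>k\<ge>d. c k = 0} :: (nat \<Rightarrow> 'k) set" and ?V = "basis_module d ims"
  define h where "h c = (\<Sum>j<d. fscale (c j) (v j))" for c
  have bij: "bij_betw h ?C (range \<pi>)" using bij by (simp add: h_def[abs_def])
  have h_sum: "h (\<lambda>j. \<Sum>i\<in>I. a i * c i j) = (\<Sum>i\<in>I. fscale (a i) (h (c i)))" for a c and I :: "'z set"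
    unfolding h_def by (simp add: fs.scale_sum_left fs.scale_sum_right) (rule sum.swap)
  have h_add: "h (\<lambda>j. c j + e j) = h c + h e" for c e
    by (simp add: h_def fs.scale_left_distrib sum.distrib)
  have h_range: "\<pi> (h c) = h c" for c
  proof -
    have "h c = h (\<lambda>j. if j < d then c j else 0)" by (simp add: h_def)
    also have "\<dots> \<in> range \<pi>" using bij_betw_apply[OF bij] by auto
    finally show ?thesis by (rule \<pi>_range)
  qed
  have h_gen: "h (lin_ext d (ims g) c) = \<pi> (h c * fgen g)" for g c
  proof -
    have "\<pi> (h c * fgen g) = (\<Sum>k<d. fscale (c k) (right_mult (fgen g) (v k)))"
      by (simp add: h_def right_mult_def sum_distrib_right \<pi>_sum fscale_mult \<pi>_scale)
    also have "\<dots> = (\<Sum>k<d. fscale (c k) (h (ims g k)))"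
      by (intro sum.cong) (simp_all add: act h_def)
    also have "\<dots> = h (lin_ext d (ims g) c)"
      unfolding lin_ext_def by (rule h_sum[symmetric])
    finally show ?thesis by simp
  qed
  have h_word: "h (fold (\<lambda>g. lin_ext d (ims g)) gs c) = \<pi> (h c * Poly_Mapping.single (Word gs) 1)" for gs c
  proof (induction gs arbitrary: c)
    case Nil
    have "Poly_Mapping.single (Word []) 1 = (1 :: 'k free_alg)"
      by (simp add: zero_gword_def flip: single_one)
    then show ?case by (simp add: h_range)
  next
    case (Cons g gs)
    have "Poly_Mapping.single (Word (g # gs)) 1 = fgen g * (Poly_Mapping.single (Word gs) 1 :: 'k free_alg)"
      by (simp add: fgen_def mult_single plus_gword_def)
    then show ?case by (simp add: Cons h_gen \<pi>_mult mult.assoc)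
  qed
  have h_act: "h (free_act d ims c f) = \<pi> (h c * f)" for c f
    using h_word[of "letters w" c for w]
    unfolding free_act_def h_sum \<pi>_expansion[of "h c" f] by (simp add: word_act_def)
  have C_act: "free_act d ims c f \<in> ?C" if "c \<in> ?C" for c f
    using free_act_supp[of d c ims f] supp that by blast
  \<comment> \<open>The relations for the images follow from those in N: relators vanish after h,
    and h is injective on coordinates supported below d.\<close>
  have ok: "rep_ok p q d ims"
    unfolding rep_ok_def
  proof (intro conjI allI impI ballI supp)
    fix k r assume k: "k < d" and r: "r \<in> relators p q"
    have "h (free_act d ims (bvec 1 k) r) = h (\<lambda>_. 0)"
      unfolding h_act \<pi>_relator[OF r] by (simp add: h_def)
    moreover have "free_act d ims (bvec 1 k) r \<in> ?C"
      by (rule C_act) (use k in \<open>auto simp: bvec_def\<close>)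
    ultimately show "free_act d ims (bvec 1 k) r = (\<lambda>_. 0)"
      by (rule inj_onD[OF bij_betw_imp_inj_on[OF bij]]) simp
  qed
  interpret V: right_module "hpq p q" ?V by (rule basis_module_right_module[OF ok])
  have car: "carrier ?V = ?C" by (simp add: basis_module_def)
  define \<phi> where "\<phi> c = \<psi> (h c)" for c
  have "bij_betw \<psi> (range \<pi>) (carrier N)"
  proof (rule bij_betw_imageI)
    show "inj_on \<psi> (range \<pi>)"
    proof (rule inj_onI)
      fix s t assume "s \<in> range \<pi>" "t \<in> range \<pi>" "\<psi> s = \<psi> t"
      then show "s = t" using \<pi>_eq_iff[of s t] \<pi>_range[of s] \<pi>_range[of t] by simp
    qed
    show "\<psi> ` range \<pi> = carrier N"
      unfolding \<psi>_surj[symmetric] image_image \<psi>_\<pi> ..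
  qed
  from bij_betw_trans[OF bij this] have \<phi>: "bij_betw \<phi> (carrier ?V) (carrier N)"
    by (simp add: car \<phi>_def[abs_def] comp_def)
  have iso: "\<phi> \<in> iso (add_monoid ?V) (add_monoid N)"
    using \<phi> bij_betw_apply[OF \<phi>]
    by (auto simp: iso_def hom_def) (simp add: basis_module_def \<phi>_def h_add \<psi>_add)
  have equi: "\<phi> (c \<triangleleft>\<^bsub>?V\<^esub> hclass p q f) = \<phi> c \<triangleleft>\<^bsub>N\<^esub> hclass p q f" if "c \<in> carrier ?V" for c f
  proof -
    have "c \<triangleleft>\<^bsub>?V\<^esub> hclass p q f = free_act d ims c f"
      using that by (intro basis_module_act ok) (simp add: car)
    then show ?thesis by (simp add: \<phi>_def h_act \<psi>_\<pi> \<psi>_mult)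
  qed
  let ?i = "inv_into (carrier ?V) \<phi>"
  have "?i \<in> iso (add_monoid N) (add_monoid ?V)"
    using group.iso_set_sym[OF V.M.a_group iso] by simp
  moreover have "?i (w \<triangleleft>\<^bsub>N\<^esub> a) = ?i w \<triangleleft>\<^bsub>?V\<^esub> a" if w: "w \<in> carrier N" and a: "a \<in> carrier (hpq p q)" for w a
  proof -
    obtain f where f: "a = hclass p q f" using a by (auto simp: carrier_hpq)
    have i: "?i w \<in> carrier ?V" "\<phi> (?i w) = w"
      using \<phi> w by (auto simp: bij_betw_def inv_into_into f_inv_into_f)
    have "w \<triangleleft>\<^bsub>N\<^esub> a = \<phi> (?i w \<triangleleft>\<^bsub>?V\<^esub> a)"
      by (simp add: f equi i)
    then show ?thesis
      using inv_into_f_f[OF bij_betw_imp_inj_on[OF \<phi>]] V.ract_closed[OF i(1) a] by simp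
  qed
  ultimately show ?thesis unfolding right_module_iso_def by blast
qed

end

lemma primitive_root_dvd:
  assumes "primitive_root_of_unity m a" "a ^ i = 1"
  shows "m dvd i"
proof -
  have m: "0 < m" "a ^ m = 1" "\<And>k. 0 < k \<Longrightarrow> k < m \<Longrightarrow> a ^ k \<noteq> 1"
    using assms(1) by (auto simp: primitive_root_of_unity_def)
  have "a ^ i = a ^ (m * (i div m) + i mod m)" by simp
  also have "\<dots> = a ^ (i mod m)" by (simp only: power_add power_mult m power_one mult_1)
  finally have "a ^ (i mod m) = 1" using assms(2) by simp
  then have "i mod m = 0" using m(3)[of "i mod m"] m(1) by (metis gr0I mod_less_divisor)
  then show ?thesis by auto
qed

theorem theorem6p1:
  fixes p q :: "'k::alg_closed_field"
    and m n l :: nat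
    and N :: "('k free_alg set, 'v) rmodule"
  assumes "p \<noteq> 0" and "q \<noteq> 0" and "p * q \<noteq> 1"
    and "primitive_root_of_unity m p" and "primitive_root_of_unity n q"
    and "l = lcm m n"
    and "simple_right_module (hpq p q) N"
    and "torsionfree (hpq p q) N (hz p q)" and "torsionfree (hpq p q) N (htheta p q)"
  shows
    "(torsionfree (hpq p q) N (hx p q) \<longrightarrow>
        (\<exists>\<mu> lam \<gamma>. \<mu> \<noteq> 0 \<and> lam \<noteq> 0 \<and> \<gamma> \<noteq> 0 \<and> right_module_iso (hpq p q) N (V1 p q l \<mu> lam \<gamma>))) \<and>
     (torsion (hpq p q) N (hx p q) \<and> torsionfree (hpq p q) N (hy p q) \<longrightarrow>
        (\<exists>\<mu> lam. \<mu> \<noteq> 0 \<and> lam \<noteq> 0 \<and> right_module_iso (hpq p q) N (V2 p q l \<mu> lam))) \<and>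
     (torsion (hpq p q) N (hx p q) \<and> torsion (hpq p q) N (hy p q) \<longrightarrow>
        (\<exists>lam. lam \<noteq> 0 \<and> right_module_iso (hpq p q) N (V3 p q lam)))"
proof -
  interpret N: right_module "hpq p q" N using assms(7) by (simp add: simple_right_module_def)
  obtain w0 where w0: "w0 \<in> carrier N" "w0 \<noteq> \<zero>\<^bsub>N\<^esub>"
    using assms(7) N.M.zero_closed by (auto simp: simple_right_module_def)
  interpret hpq_simple_module p q N w0
    by (intro hpq_simple_module.intro assms(7) w0)
  obtain \<pi> where \<pi>: "\<And>u w. \<pi> (u + w) = \<pi> u + \<pi> w" "\<And>c u. \<pi> (fscale c u) = fscale c (\<pi> u)"
    "\<And>u. \<pi> u = 0 \<longleftrightarrow> u \<in> {f. \<psi> f = \<zero>\<^bsub>N\<^esub>}" "\<And>u. \<pi> (\<pi> u) = \<pi> u"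
    by (rule fs.complement_projection[OF kernel_subspace]) blast
  interpret hpq_module_projection p q N w0 \<pi>
    by unfold_locales (use \<pi> in auto)
  have mn: "0 < m" "p ^ m = 1" "0 < n" "q ^ n = 1"
    using assms(4,5) by (auto simp: primitive_root_of_unity_def)
  have l: "0 < l" using mn by (simp add: assms(6) lcm_pos_nat)
  obtain i j where "l = m * i" "l = n * j"
    using assms(6) by (metis dvd_def dvd_lcm1 dvd_lcm2)
  then have pl: "p ^ l = 1" "q ^ l = 1"
    using mn by (metis power_mult power_one)+
  have l_dvd: "l dvd i" if "p ^ i = 1" "q ^ i = 1" for i
    unfolding assms(6)
    using primitive_root_dvd[OF assms(4) that(1)] primitive_root_dvd[OF assms(5) that(2)] by simp
  interpret H: simple_hmodule fscale p q "right_mult (fgen GX)" "right_mult (fgen GY)"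
    "right_mult (fgen GZ)" "range \<pi>" l
    by (rule simple_hmodule_range[OF assms(1-3) l pl l_dvd assms(8)])
  have gen: "H.gen_act g = right_mult (fgen g)" for g
    by (cases g) (simp_all add: H.gen_act_def)
  have iso: "right_module_iso (hpq p q) N (basis_module d ims)"
    if "H.is_basis_for d ims v" "\<And>g k j. k < d \<Longrightarrow> d \<le> j \<Longrightarrow> ims g k j = 0" for d ims v
    using that by (intro basis_imp_iso[of d ims v]) (auto simp: H.is_basis_for_def gen)
  have \<Theta>: "H.\<Theta> u = \<pi> (u * (fgen GY * fgen GX - fconst (inverse p) * (fgen GX * fgen GY)))" for u
    by (simp add: H.\<Theta>_def right_mult_def \<pi>_mult right_diff_distrib \<pi>_diff fscale_mult mult.assoc
        flip: \<pi>_scale fscale_def)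
  have htheta: "htheta p q = hclass p q (fgen GY * fgen GX - fconst (inverse p) * (fgen GX * fgen GY))"
    by (simp add: htheta_def hx_def hy_def hscalar_def hpq_mult hclass_minus)
  obtain w where w: "w \<in> range \<pi>" "w \<noteq> 0"
    using H.S(2) fs.subspace_0[OF H.S(1)] by blast
  have 1: "\<exists>\<mu> lam \<gamma>. \<mu> \<noteq> 0 \<and> lam \<noteq> 0 \<and> \<gamma> \<noteq> 0 \<and> right_module_iso (hpq p q) N (V1 p q l \<mu> lam \<gamma>)"
    if tf: "torsionfree (hpq p q) N (hx p q)"
  proof -
    have "\<exists>\<mu> lam \<gamma> v. \<mu> \<noteq> 0 \<and> lam \<noteq> 0 \<and> \<gamma> \<noteq> 0 \<and> H.is_basis_for l (V1_images p q l \<mu> lam \<gamma>) v"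
    proof (rule H.x_torsionfree_case)
      show "w = 0" if "w \<in> range \<pi>" "right_mult (fgen GX) w = 0" for w
        by (rule torsionfree_imp[OF tf[unfolded hx_def] that(1)]) (simp only: that(2) flip: right_mult_def)
      show "w = 0" if "w \<in> range \<pi>" "H.\<Theta> w = 0" for w
        by (rule torsionfree_imp[OF assms(9)[unfolded htheta] that(1)]) (simp only: that(2) flip: \<Theta>)
    qed
    then obtain \<mu> lam \<gamma> v where *: "\<mu> \<noteq> 0" "lam \<noteq> 0" "\<gamma> \<noteq> 0" "H.is_basis_for l (V1_images p q l \<mu> lam \<gamma>) v"
      by blast
    have "V1_images p q l \<mu> lam \<gamma> g k j = 0" if "k < l" "l \<le> j" for g k j
      using that by (cases g) (auto simp: bvec_def)
    from iso[OF *(4) this] * show ?thesis unfolding V1_def by blast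
  qed
  have 2: "\<exists>\<mu> lam. \<mu> \<noteq> 0 \<and> lam \<noteq> 0 \<and> right_module_iso (hpq p q) N (V2 p q l \<mu> lam)"
    if t: "torsion (hpq p q) N (hx p q)" and tf: "torsionfree (hpq p q) N (hy p q)"
  proof -
    obtain i where i: "(right_mult (fgen GX) ^^ i) w = 0"
      using torsion_imp[OF t[unfolded hx_def] w(1)] by blast
    have "\<exists>\<mu> lam v. \<mu> \<noteq> 0 \<and> lam \<noteq> 0 \<and> H.is_basis_for l (V2_images p q l \<mu> lam) v"
    proof (rule H.x_torsion_y_torsionfree_case[OF w i])
      show "w = 0" if "w \<in> range \<pi>" "right_mult (fgen GY) w = 0" for w
        by (rule torsionfree_imp[OF tf[unfolded hy_def] that(1)]) (simp only: that(2) flip: right_mult_def)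
    qed
    then obtain \<mu> lam v where *: "\<mu> \<noteq> 0" "lam \<noteq> 0" "H.is_basis_for l (V2_images p q l \<mu> lam) v"
      by blast
    have "V2_images p q l \<mu> lam g k j = 0" if "k < l" "l \<le> j" for g k j
      using that by (cases g) (auto simp: bvec_def)
    from iso[OF *(3) this] * show ?thesis unfolding V2_def by blast
  qed
  have 3: "\<exists>lam. lam \<noteq> 0 \<and> right_module_iso (hpq p q) N (V3 p q lam)"
    if t: "torsion (hpq p q) N (hx p q)" "torsion (hpq p q) N (hy p q)"
  proof -
    obtain i where i: "(right_mult (fgen GX) ^^ i) w = 0"
      using torsion_imp[OF t(1)[unfolded hx_def] w(1)] by blast
    have "\<exists>lam v. lam \<noteq> 0 \<and> H.is_basis_for (mult_order (p * q)) (V3_images p q lam) v"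
      by (rule H.x_torsion_y_torsion_case[OF w i torsion_imp[OF t(2)[unfolded hy_def]]])
    then obtain lam v where *: "lam \<noteq> 0" "H.is_basis_for (mult_order (p * q)) (V3_images p q lam) v"
      by blast
    have "V3_images p q lam g k j = 0" if "k < mult_order (p * q)" "mult_order (p * q) \<le> j" for g k j
      using that by (cases g) (auto simp: bvec_def)
    from iso[OF *(2) this] * show ?thesis unfolding V3_def by blast
  qed
  show ?thesis using 1 2 3 by blast
qed

end
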